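(* Let $d\ge1$ and let $G=(V,E)$ be a graph that has a globally rigid gluing construction in $\mathbb{R}^d$. Then $G$ is $d$-joined. In particular, $G$ is globally rigid in $\mathbb{R}^d$ if and only if it is $(d+1)$-connected.
   Context: A $d$-dimensional realization of $G=(V,E)$ is a pair $(G,p)$ with $p:V\to\mathbb{R}^d$; it is generic if the $d|V|$ coordinates of $p$ are algebraically independent over $\mathbb{Q}$. $(G,p),(G,q)$ are equivalent if $\|p(x)-p(y)\|=\|q(x)-q(y)\|$ for all edges $xy$, congruent if this holds for all pairs of vertices. $G$ is rigid in $\mathbb{R}^d$ if for a generic realization $(G,p)$ there is $\varepsilon>0$ such that every equivalent $(G,q)$ with $\|p(x)-q(x)\|<\varepsilon$ for all $x$ is congruent to $(G,p)$; $G$ is globally rigid in $\mathbb{R}^d$ if for every generic realization every equivalent realization in $\mathbb{R}^d$ is congruent to it. A pair $\{x,y\}$ is globally linked in $G$ in $\mathbb{R}^d$ if for every generic realization $(G,p)$ in $\mathbb{R}^d$ and every equivalent realization $(G,q)$ in $\mathbb{R}^d$, $\|p(x)-p(y)\|=\|q(x)-q(y)\|$. $\kappa(G,x,y)$ is the maximum number of internally vertex-disjoint $x$–$y$ paths. $G$ is $d$-joined if $|V|\ge d+1$, $G$ is rigid in $\mathbb{R}^d$, and for all $x,y\in V$: $\{x,y\}$ is globally linked iff $xy\in E$ or $\kappa(G,x,y)\ge d+1$. $G$ is $k$-connected if it has at least $k+1$ vertices and no vertex set of size at most $k-1$ whose removal disconnects it. For a graph $G$ on at least $d+1$ vertices,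 a globally rigid gluing construction in $\mathbb{R}^d$ of $G$ is a sequence of graphs $G_1,\dots,G_k=G$ such that for every $i$, either $G_i$ is a graph on at least $d+1$ vertices that is globally rigid in $\mathbb{R}^d$, or there are indices $1\le j<l<i$ such that $G_i$ is the union of $G_j$ and $G_l$ (union of vertex sets and of edge sets) with $V(G_j)\ne V(G_i)\ne V(G_l)$ and $|V(G_j)\cap V(G_l)|\ge d$.
   Formalization: The "in particular" equivalence is stated only for graphs with at least d+2 vertices, since K_{d+1} (the only graph with a gluing construction on d+1 vertices) is globally rigid but has too few vertices to be (d+1)-connected. *)

theory Defs
  imports "HOL-Analysis.Analysis" "HOL-Library.Poly_Mapping"
begin

section \<open>Finite simple graphs\<close>

record 'a ugraph =
  verts :: "'a set"
  edges :: "'a set set"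

definition simple_graph :: "'a ugraph \<Rightarrow> bool" where
  "simple_graph G \<longleftrightarrow> finite (verts G) \<and> (\<forall>e\<in>edges G. e \<subseteq> verts G \<and> card e = 2)"

definition graph_union :: "'a ugraph \<Rightarrow> 'a ugraph \<Rightarrow> 'a ugraph" where
  "graph_union G H = \<lparr>verts = verts G \<union> verts H, edges = edges G \<union> edges H\<rparr>"

definition remove_verts :: "'a ugraph \<Rightarrow> 'a set \<Rightarrow> 'a ugraph" where
  "remove_verts G S = \<lparr>verts = verts G - S, edges = {e \<in> edges G. e \<inter> S = {}}\<rparr>"

text \<open>Paths are given by their (pairwise distinct) vertices, in order from x to y.\<close>

definition is_path :: "'a ugraph \<Rightarrow> 'a \<Rightarrow> 'a \<Rightarrow> 'a list \<Rightarrow> bool" where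
  "is_path G x y vs \<longleftrightarrow> vs \<noteq> [] \<and> hd vs = x \<and> last vs = y \<and> distinct vs \<and>
     set vs \<subseteq> verts G \<and> successively (\<lambda>u v. {u, v} \<in> edges G) vs"

definition graph_connected :: "'a ugraph \<Rightarrow> bool" where
  "graph_connected G \<longleftrightarrow> (\<forall>x\<in>verts G. \<forall>y\<in>verts G. \<exists>vs. is_path G x y vs)"

definition k_connected :: "nat \<Rightarrow> 'a ugraph \<Rightarrow> bool" where
  "k_connected k G \<longleftrightarrow> card (verts G) \<ge> k + 1 \<and>
     (\<forall>S\<subseteq>verts G. card S < k \<longrightarrow> graph_connected (remove_verts G S))"

definition internally_disjoint_paths :: "'a ugraph \<Rightarrow> 'a \<Rightarrow> 'a \<Rightarrow> 'a list set \<Rightarrow> bool" where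
  "internally_disjoint_paths G x y P \<longleftrightarrow> (\<forall>vs\<in>P. is_path G x y vs) \<and>
     (\<forall>vs\<in>P. \<forall>ws\<in>P. vs \<noteq> ws \<longrightarrow> set vs \<inter> set ws \<subseteq> {x, y})"

text \<open>For a finite graph there are only finitely many paths, so the maximum is attained.  The path
  consisting of the single edge xy counts (once) if x and y are adjacent.\<close>

definition local_connectivity :: "'a ugraph \<Rightarrow> 'a \<Rightarrow> 'a \<Rightarrow> nat" where
  "local_connectivity G x y = Max {card P | P. internally_disjoint_paths G x y P}"

section \<open>Generic realizations\<close>

text \<open>Polynomials with rational coefficients in variables indexed by 'i: finitely supported maps
  from monomials (finitely supported exponent vectors) to coefficients.\<close>

type_synonym 'i rat_mpoly = "('i \<Rightarrow>\<^sub>0 nat) \<Rightarrow>\<^sub>0 rat"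

definition rat_mpoly_eval :: "('i \<Rightarrow> real) \<Rightarrow> 'i rat_mpoly \<Rightarrow> real" where
  "rat_mpoly_eval a f = (\<Sum>m\<in>Poly_Mapping.keys f. of_rat (Poly_Mapping.lookup f m) *
     (\<Prod>i\<in>Poly_Mapping.keys m. a i ^ Poly_Mapping.lookup m i))"

definition algebraically_independent_rat :: "'i set \<Rightarrow> ('i \<Rightarrow> real) \<Rightarrow> bool" where
  "algebraically_independent_rat I a \<longleftrightarrow>
     (\<forall>f :: 'i rat_mpoly. (\<forall>m\<in>Poly_Mapping.keys f. Poly_Mapping.keys m \<subseteq> I) \<and>
        rat_mpoly_eval a f = 0 \<longrightarrow> f = 0)"

text \<open>A realization in dimension d = CARD('d) is a map into real ^ 'd, of which only the values on
  the vertex set matter.  Notions that depend on the dimension only take it as an argument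
  TYPE('d).\<close>

definition generic :: "'a ugraph \<Rightarrow> ('a \<Rightarrow> real ^ 'd) \<Rightarrow> bool" where
  "generic G p \<longleftrightarrow> algebraically_independent_rat (verts G \<times> (UNIV :: 'd set)) (\<lambda>(v, i). p v $ i)"

definition equivalent_realizations ::
    "'a ugraph \<Rightarrow> ('a \<Rightarrow> real ^ 'd) \<Rightarrow> ('a \<Rightarrow> real ^ 'd) \<Rightarrow> bool" where
  "equivalent_realizations G p q \<longleftrightarrow>
     (\<forall>x y. {x, y} \<in> edges G \<longrightarrow> norm (p x - p y) = norm (q x - q y))"

definition congruent_realizations ::
    "'a ugraph \<Rightarrow> ('a \<Rightarrow> real ^ 'd) \<Rightarrow> ('a \<Rightarrow> real ^ 'd) \<Rightarrow> bool" where
  "congruent_realizations G p q \<longleftrightarrow>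
     (\<forall>x\<in>verts G. \<forall>y\<in>verts G. norm (p x - p y) = norm (q x - q y))"

section \<open>Rigidity, global rigidity, globally linked pairs\<close>

text \<open>Rigidity is a generic property; it is required here of every generic realization (such
  realizations exist for every finite graph).\<close>

definition rigid :: "'d::finite itself \<Rightarrow> 'a ugraph \<Rightarrow> bool" where
  "rigid _ G \<longleftrightarrow> (\<forall>p :: 'a \<Rightarrow> real ^ 'd. generic G p \<longrightarrow>
     (\<exists>\<epsilon>>0. \<forall>q :: 'a \<Rightarrow> real ^ 'd. equivalent_realizations G p q \<and>
        (\<forall>x\<in>verts G. norm (p x - q x) < \<epsilon>) \<longrightarrow> congruent_realizations G p q))"

definition globally_rigid :: "'d::finite itself \<Rightarrow> 'a ugraph \<Rightarrow> bool" where
  "globally_rigid _ G \<longleftrightarrow> (\<forall>p q :: 'a \<Rightarrow> real ^ 'd. generic G p \<and>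
     equivalent_realizations G p q \<longrightarrow> congruent_realizations G p q)"

definition globally_linked :: "'d::finite itself \<Rightarrow> 'a ugraph \<Rightarrow> 'a \<Rightarrow> 'a \<Rightarrow> bool" where
  "globally_linked _ G x y \<longleftrightarrow> (\<forall>p q :: 'a \<Rightarrow> real ^ 'd. generic G p \<and>
     equivalent_realizations G p q \<longrightarrow> norm (p x - p y) = norm (q x - q y))"

text \<open>A pair of vertices consists of two distinct vertices.\<close>

definition joined :: "'d::finite itself \<Rightarrow> 'a ugraph \<Rightarrow> bool" where
  "joined D G \<longleftrightarrow> card (verts G) \<ge> CARD('d) + 1 \<and> rigid D G \<and>
     (\<forall>x\<in>verts G. \<forall>y\<in>verts G. x \<noteq> y \<longrightarrow>
        (globally_linked D G x y \<longleftrightarrow>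
           {x, y} \<in> edges G \<or> local_connectivity G x y \<ge> CARD('d) + 1))"

section \<open>Globally rigid gluing constructions\<close>

definition gluing_construction ::
    "'d::finite itself \<Rightarrow> 'a ugraph list \<Rightarrow> 'a ugraph \<Rightarrow> bool" where
  "gluing_construction D Gs G \<longleftrightarrow>
     card (verts G) \<ge> CARD('d) + 1 \<and> Gs \<noteq> [] \<and> last Gs = G \<and>
     (\<forall>i<length Gs. simple_graph (Gs ! i) \<and>
        ((card (verts (Gs ! i)) \<ge> CARD('d) + 1 \<and> globally_rigid D (Gs ! i)) \<or>
         (\<exists>j l. j < l \<and> l < i \<and>
            Gs ! i = graph_union (Gs ! j) (Gs ! l) \<and>
            verts (Gs ! j) \<noteq> verts (Gs ! i) \<and> verts (Gs ! i) \<noteq> verts (Gs ! l) \<and>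
            card (verts (Gs ! j) \<inter> verts (Gs ! l)) \<ge> CARD('d))))"

end

theory Submission imports Defs begin

text \<open>A graph with a gluing construction has a chordal skeleton: a chordal graph E on the same vertices,
  each new vertex being joined to a clique of at least d old ones, that contains the edges and whose
  edge lengths are all preserved by every equivalent realization of a generic one. For a union of two
  graphs, skeletons are merged as follows. If in addition to E a clique U is preserved, then
  removing the last vertex v of U shows that all neighbours of v may be added to U: normalize q
  to agree with p on v and its neighbours; then q u is rational in the positions of the other
  vertices, so it can have the distance of p u to the generic point p v only if q u = p u.
  If the two graphs meet in exactly d vertices, the distances within the intersection are rational in
  the positions of either graph alone, hence in those of the intersection, and again
  genericity forces them to be preserved.

  In a maximal skeleton, non-adjacent vertices are separated by d vertices, so a pair with more than
  d disjoint paths is adjacent in the skeleton and thus globally linked. Conversely, by Menger's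
  theorem, a non-adjacent pair with at most d disjoint paths has a separator of size at most d, and
  reflecting one side in a hyperplane through it changes the distance of the pair.\<close>

section \<open>Rational polynomial functions and generic points\<close>

text \<open>A pair in the overlap may be unlinked in both pieces and yet be forced by their union,
  so the overlap cannot be treated through the pieces one at a time; fields of rational functions
  are what lets the two sides be compared. The rationality used throughout comes from the
  construction order. A vertex attached to d points in known position has at most two candidate
  positions, mirror images in the hyperplane through these points, and reflecting a rational point
  in a rational hyperplane gives a rational point. Hence as soon as \<open>q\<close> agrees with
  \<open>p\<close> on a clique of d + 1 vertices, all of \<open>q\<close> has coordinates in the
  field generated by those of \<open>p\<close>. The same order drives the inductions: the
  coordinates of the last vertex are independent over the field of the others, and comparing two
  distances to that vertex is a linear condition on it, because its squared norm cancels. Membership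
  in a smaller field is tested by substituting rational numbers for generic coordinates, which
  leaves no need for rigidity matrices or dimension counts.\<close>

inductive qpoly :: "'i set \<Rightarrow> (('i \<Rightarrow> real) \<Rightarrow> real) \<Rightarrow> bool" for W where
  qpoly_const: "qpoly W (\<lambda>a. of_rat c)"
| qpoly_var: "i \<in> W \<Longrightarrow> qpoly W (\<lambda>a. a i)"
| qpoly_add: "qpoly W f \<Longrightarrow> qpoly W g \<Longrightarrow> qpoly W (\<lambda>a. f a + g a)"
| qpoly_mult: "qpoly W f \<Longrightarrow> qpoly W g \<Longrightarrow> qpoly W (\<lambda>a. f a * g a)"

definition monom_eval :: "('i \<Rightarrow> real) \<Rightarrow> ('i \<Rightarrow>\<^sub>0 nat) \<Rightarrow> real" where
  "monom_eval a m = (\<Prod>i\<in>Poly_Mapping.keys m. a i ^ Poly_Mapping.lookup m i)"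

lemma monom_eval_superset:
  assumes "finite A" "Poly_Mapping.keys m \<subseteq> A"
  shows "monom_eval a m = (\<Prod>i\<in>A. a i ^ Poly_Mapping.lookup m i)"
  unfolding monom_eval_def using assms
  by (intro prod.mono_neutral_left) (auto simp: in_keys_iff)

lemma keys_add_nat: "Poly_Mapping.keys (k + l :: 'i \<Rightarrow>\<^sub>0 nat) = Poly_Mapping.keys k \<union> Poly_Mapping.keys l"
  by (auto simp: in_keys_iff lookup_add)

lemma monom_eval_add: "monom_eval a (k + l) = monom_eval a k * monom_eval a l"
proof -
  let ?A = "Poly_Mapping.keys k \<union> Poly_Mapping.keys l"
  have "monom_eval a (k + l) = (\<Prod>i\<in>?A. a i ^ Poly_Mapping.lookup (k + l) i)"
    by (rule monom_eval_superset) (auto simp: keys_add_nat)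
  also have "\<dots> = (\<Prod>i\<in>?A. a i ^ Poly_Mapping.lookup k i) * (\<Prod>i\<in>?A. a i ^ Poly_Mapping.lookup l i)"
    by (simp add: lookup_add power_add prod.distrib)
  also have "\<dots> = monom_eval a k * monom_eval a l"
    using monom_eval_superset[of ?A k a] monom_eval_superset[of ?A l a] by simp
  finally show ?thesis .
qed

lemma rat_mpoly_eval_superset:
  assumes "finite A" "Poly_Mapping.keys f \<subseteq> A"
  shows "rat_mpoly_eval a f = (\<Sum>m\<in>A. of_rat (Poly_Mapping.lookup f m) * monom_eval a m)"
  unfolding rat_mpoly_eval_def monom_eval_def using assms
  by (intro sum.mono_neutral_left) (auto simp: in_keys_iff)

lemma rat_mpoly_eval_add: "rat_mpoly_eval a (f + g) = rat_mpoly_eval a f + rat_mpoly_eval a g"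
proof -
  let ?A = "Poly_Mapping.keys f \<union> Poly_Mapping.keys g"
  have "rat_mpoly_eval a (f + g) = (\<Sum>m\<in>?A. of_rat (Poly_Mapping.lookup (f + g) m) * monom_eval a m)"
    using Poly_Mapping.keys_add by (intro rat_mpoly_eval_superset) (auto intro!: Poly_Mapping.keys_add)
  also have "\<dots> = rat_mpoly_eval a f + rat_mpoly_eval a g"
    using rat_mpoly_eval_superset[of ?A f a] rat_mpoly_eval_superset[of ?A g a]
    by (simp add: lookup_add of_rat_add distrib_right sum.distrib)
  finally show ?thesis .
qed

lemma rat_mpoly_eval_single:
  "rat_mpoly_eval a (Poly_Mapping.single k c) = of_rat c * monom_eval a k"
  by (simp add: rat_mpoly_eval_superset[of "{k}"])

definition mpoly_fun :: "'i set \<Rightarrow> (('i \<Rightarrow> real) \<Rightarrow> real) \<Rightarrow> bool" where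
  "mpoly_fun W f \<longleftrightarrow> (\<exists>m :: 'i rat_mpoly. (\<forall>k\<in>Poly_Mapping.keys m. Poly_Mapping.keys k \<subseteq> W) \<and>
     f = (\<lambda>a. rat_mpoly_eval a m))"

lemma mpoly_fun_monom:
  assumes "Poly_Mapping.keys k \<subseteq> W"
  shows "mpoly_fun W (\<lambda>a. of_rat c * monom_eval a k)"
  unfolding mpoly_fun_def
  by (rule exI[of _ "Poly_Mapping.single k c"]) (use assms in \<open>auto simp: rat_mpoly_eval_single\<close>)

lemma mpoly_fun_add:
  assumes "mpoly_fun W f" "mpoly_fun W g"
  shows "mpoly_fun W (\<lambda>a. f a + g a)"
proof -
  obtain m n where "\<forall>k\<in>Poly_Mapping.keys m. Poly_Mapping.keys k \<subseteq> W" "f = (\<lambda>a. rat_mpoly_eval a m)"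
    "\<forall>k\<in>Poly_Mapping.keys n. Poly_Mapping.keys k \<subseteq> W" "g = (\<lambda>a. rat_mpoly_eval a n)"
    using assms unfolding mpoly_fun_def by blast
  then show ?thesis
    unfolding mpoly_fun_def using Poly_Mapping.keys_add[of m n]
    by (intro exI[of _ "m + n"]) (auto simp: rat_mpoly_eval_add)
qed

lemma mpoly_fun_sum:
  assumes "finite A" "\<And>x. x \<in> A \<Longrightarrow> mpoly_fun W (f x)"
  shows "mpoly_fun W (\<lambda>a. \<Sum>x\<in>A. f x a)"
  using assms
proof (induction A)
  case empty
  show ?case using mpoly_fun_monom[of 0 W 0] by simp
next
  case (insert x A)
  then show ?case using mpoly_fun_add[of W "f x" "\<lambda>a. \<Sum>x\<in>A. f x a"] by simp
qed

lemma mpoly_fun_mult: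
  assumes "mpoly_fun W f" "mpoly_fun W g"
  shows "mpoly_fun W (\<lambda>a. f a * g a)"
proof -
  obtain m n where m: "\<forall>k\<in>Poly_Mapping.keys m. Poly_Mapping.keys k \<subseteq> W" "f = (\<lambda>a. rat_mpoly_eval a m)"
    and n: "\<forall>k\<in>Poly_Mapping.keys n. Poly_Mapping.keys k \<subseteq> W" "g = (\<lambda>a. rat_mpoly_eval a n)"
    using assms unfolding mpoly_fun_def by blast
  have "(\<lambda>a. f a * g a) = (\<lambda>a. \<Sum>k\<in>Poly_Mapping.keys m. \<Sum>l\<in>Poly_Mapping.keys n.
     of_rat (Poly_Mapping.lookup m k * Poly_Mapping.lookup n l) * monom_eval a (k + l))"
    unfolding m(2) n(2) rat_mpoly_eval_def monom_eval_add
    unfolding monom_eval_def sum_product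
    by (simp add: of_rat_mult mult_ac)
  moreover have "mpoly_fun W \<dots>"
    using m(1) n(1) by (intro mpoly_fun_sum mpoly_fun_monom) (auto simp: keys_add_nat)
  ultimately show ?thesis by simp
qed

text \<open>Bridge to the formal polynomials of the genericity definition. Elsewhere
  \<open>qpoly\<close> is more convenient: determinants and squared distances are recognized as
  polynomial by introduction rules alone.\<close>

lemma qpoly_imp_mpoly_fun: "qpoly W f \<Longrightarrow> mpoly_fun W f"
proof (induction rule: qpoly.induct)
  case (qpoly_const c)
  show ?case using mpoly_fun_monom[of 0 W c] by (simp add: monom_eval_def)
next
  case (qpoly_var i)
  then show ?case using mpoly_fun_monom[of "Poly_Mapping.single i 1" W 1] by (simp add: monom_eval_def)
qed (auto intro: mpoly_fun_add mpoly_fun_mult)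

text \<open>The gateway for genericity: an equation at the generic point becomes an identity of
  functions, which may then be evaluated at any convenient point \<open>b\<close>.\<close>

lemma qpoly_generic_zero:
  assumes "algebraically_independent_rat W a" "qpoly W f" "f a = 0"
  shows "f b = 0"
proof -
  obtain m where "\<forall>k\<in>Poly_Mapping.keys m. Poly_Mapping.keys k \<subseteq> W" "f = (\<lambda>a. rat_mpoly_eval a m)"
    using qpoly_imp_mpoly_fun[OF assms(2)] unfolding mpoly_fun_def by blast
  with assms have "m = 0" unfolding algebraically_independent_rat_def by blast
  then show ?thesis using \<open>f = _\<close> by (simp add: rat_mpoly_eval_def)
qed

lemma algebraically_independent_rat_mono:
  "algebraically_independent_rat W a \<Longrightarrow> W' \<subseteq> W \<Longrightarrow> algebraically_independent_rat W' a"
  unfolding algebraically_independent_rat_def by blast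

lemma qpoly_mono: "qpoly W f \<Longrightarrow> W \<subseteq> W' \<Longrightarrow> qpoly W' f"
  by (induction rule: qpoly.induct) (auto intro: qpoly.intros)

lemma qpoly_cong: "qpoly W f \<Longrightarrow> (\<And>i. i \<in> W \<Longrightarrow> a i = b i) \<Longrightarrow> f a = f b"
  by (induction rule: qpoly.induct) auto

lemma qpoly_upd_continuous: "qpoly W f \<Longrightarrow> continuous_on UNIV (\<lambda>t. f (a(i := t)))"
proof (induction rule: qpoly.induct)
  case (qpoly_var j)
  then show ?case by (cases "i = j") (auto intro: continuous_intros)
qed (auto intro: continuous_intros)

lemma qpoly_upd_rat: "qpoly W f \<Longrightarrow> qpoly (W - {i}) (\<lambda>a. f (a(i := of_rat c)))"
proof (induction rule: qpoly.induct)
  case (qpoly_var j)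
  then show ?case by (cases "i = j") (auto intro: qpoly.intros)
qed (auto intro: qpoly.intros)

lemma qpoly_uminus: "qpoly W f \<Longrightarrow> qpoly W (\<lambda>a. - f a)"
  using qpoly_mult[OF qpoly_const[of W "-1"], of f] by simp

lemma qpoly_diff: "qpoly W f \<Longrightarrow> qpoly W g \<Longrightarrow> qpoly W (\<lambda>a. f a - g a)"
  using qpoly_add[OF _ qpoly_uminus, of W f g] by simp

lemma qpoly_sum:
  "finite A \<Longrightarrow> (\<And>x. x \<in> A \<Longrightarrow> qpoly W (f x)) \<Longrightarrow> qpoly W (\<lambda>a. \<Sum>x\<in>A. f x a)"
proof (induction rule: finite_induct)
  case empty
  show ?case using qpoly_const[of W 0] by simp
next
  case (insert x A)
  then show ?case using qpoly_add[of W "f x" "\<lambda>a. \<Sum>x\<in>A. f x a"] by simp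
qed

lemma qpoly_prod:
  "finite A \<Longrightarrow> (\<And>x. x \<in> A \<Longrightarrow> qpoly W (f x)) \<Longrightarrow> qpoly W (\<lambda>a. \<Prod>x\<in>A. f x a)"
proof (induction rule: finite_induct)
  case empty
  show ?case using qpoly_const[of W 1] by simp
next
  case (insert x A)
  then show ?case using qpoly_mult[of W "f x" "\<lambda>a. \<Prod>x\<in>A. f x a"] by simp
qed

lemma qpoly_power: "qpoly W f \<Longrightarrow> qpoly W (\<lambda>a. f a ^ n)"
  using qpoly_prod[of "{..<n}" W "\<lambda>_. f"] by simp

text \<open>Nonvanishing is an open condition in each variable and the rationals are dense. A value
  different from \<open>a i\<close> is demanded so that \<open>qfield_sphere_center\<close> can
  compare two distinct substitutions.\<close>

lemma qpoly_nonzero_upd: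
  assumes "qpoly W g" "g a \<noteq> 0"
  shows "\<exists>c. of_rat c \<noteq> a i \<and> g (a(i := of_rat c)) \<noteq> 0"
proof -
  have "open {t. g (a(i := t)) \<noteq> 0}"
    using qpoly_upd_continuous[OF assms(1)] by (intro open_Collect_neq) auto
  moreover have "a i \<in> {t. g (a(i := t)) \<noteq> 0}" using assms by simp
  ultimately obtain e where e: "e > 0" "\<And>t. dist t (a i) < e \<Longrightarrow> g (a(i := t)) \<noteq> 0"
    unfolding open_dist by blast
  obtain r where r: "r \<in> \<rat>" "a i < r" "r < a i + e"
    using Rats_dense_in_real[of "a i" "a i + e"] e(1) by auto
  then obtain c where "r = of_rat c" by (auto elim: Rats_cases)
  with r e(2)[of r] show ?thesis by (intro exI[of _ c]) (auto simp: dist_real_def)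
qed

lemma qpoly_specialize:
  assumes "finite J" "qpoly W g" "g a \<noteq> 0"
  shows "\<exists>b. (\<forall>i\<in>J. b i \<in> \<rat>) \<and> (\<forall>i. i \<notin> J \<longrightarrow> b i = a i) \<and> g b \<noteq> 0"
  using assms(1)
proof (induction J)
  case empty
  then show ?case using assms(3) by blast
next
  case (insert j J)
  then obtain b where b: "\<forall>i\<in>J. b i \<in> \<rat>" "\<forall>i. i \<notin> J \<longrightarrow> b i = a i" "g b \<noteq> 0" by blast
  obtain c where "g (b(j := of_rat c)) \<noteq> 0"
    using qpoly_nonzero_upd[OF assms(2) b(3), of j] by blast
  moreover have "\<forall>i\<in>insert j J. (b(j := of_rat c)) i \<in> \<rat>" "\<forall>i. i \<notin> insert j J \<longrightarrow> (b(j := of_rat c)) i = a i"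
    using b by auto
  ultimately show ?case by (intro exI[of _ "b(j := of_rat c)"] conjI)
qed

text \<open>Rational values are absorbed into the coefficients, so the variables in \<open>J\<close>
  disappear. The function \<open>f'\<close> is fixed before \<open>a\<close> and serves every point
  that agrees with \<open>b\<close> off \<open>J\<close>.\<close>

lemma qpoly_specialized:
  assumes "finite J" "qpoly W f" "\<forall>i\<in>J. b i \<in> \<rat>"
  shows "\<exists>f'. qpoly (W - J) f' \<and> (\<forall>a. (\<forall>i. i \<notin> J \<longrightarrow> b i = a i) \<longrightarrow> f b = f' a)"
  using assms(1,3)
proof (induction J)
  case empty
  show ?case using assms(2) by (auto intro!: exI[of _ f] arg_cong[of _ _ f])
next
  case (insert j J)
  then obtain f' where f': "qpoly (W - J) f'" "\<And>a. (\<forall>i. i \<notin> J \<longrightarrow> b i = a i) \<Longrightarrow> f b = f' a"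
    by auto
  obtain c where c: "b j = of_rat c" using insert.prems by (auto elim: Rats_cases)
  have "f b = f' (a(j := of_rat c))" if "\<forall>i. i \<notin> insert j J \<longrightarrow> b i = a i" for a
    using that c by (intro f'(2)) auto
  moreover have "qpoly (W - insert j J) (\<lambda>a. f' (a(j := of_rat c)))"
    using qpoly_upd_rat[OF f'(1), of j c] by (auto intro: qpoly_mono)
  ultimately show ?case by blast
qed

section \<open>Fields of rational functions at a generic point\<close>

text \<open>The convention \<open>inverse 0 = 0\<close> makes closure under inverses unconditional.
  Keeping the field abstract lets the geometric lemmas conclude membership for every field that
  contains the data.\<close>

definition real_subfield :: "real set \<Rightarrow> bool" where
  "real_subfield F \<longleftrightarrow> (\<forall>c. of_rat c \<in> F) \<and> (\<forall>x\<in>F. \<forall>y\<in>F. x + y \<in> F \<and> x * y \<in> F) \<and>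
     (\<forall>x\<in>F. - x \<in> F \<and> inverse x \<in> F)"

text \<open>The field generated over the rationals by the numbers \<open>a i\<close> with
  \<open>i\<close> in \<open>W\<close>.\<close>

definition qfield :: "'i set \<Rightarrow> ('i \<Rightarrow> real) \<Rightarrow> real set" where
  "qfield W a = {f a / g a | f g. qpoly W f \<and> qpoly W g \<and> g a \<noteq> 0}"

lemma qfieldI: "qpoly W f \<Longrightarrow> qpoly W g \<Longrightarrow> g a \<noteq> 0 \<Longrightarrow> f a / g a \<in> qfield W a"
  unfolding qfield_def by blast

lemma qfieldE:
  assumes "x \<in> qfield W a"
  obtains f g where "qpoly W f" "qpoly W g" "g a \<noteq> 0" "x = f a / g a"
  using assms unfolding qfield_def by blast

lemma qpoly_in_qfield: "qpoly W f \<Longrightarrow> f a \<in> qfield W a"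
  using qfieldI[OF _ qpoly_const[of W 1], of f a] by simp

lemma real_subfield_qfield: "real_subfield (qfield W a)"
  unfolding real_subfield_def
proof (intro conjI allI ballI)
  show "of_rat c \<in> qfield W a" for c
    by (rule qpoly_in_qfield[OF qpoly_const])
next
  fix x y assume "x \<in> qfield W a" "y \<in> qfield W a"
  then obtain f g f' g' where *: "qpoly W f" "qpoly W g" "g a \<noteq> 0" "x = f a / g a"
    "qpoly W f'" "qpoly W g'" "g' a \<noteq> 0" "y = f' a / g' a" by (auto elim!: qfieldE)
  have "x + y = (f a * g' a + f' a * g a) / (g a * g' a)" using * by (simp add: field_simps)
  also have "\<dots> \<in> qfield W a"
    using * by (intro qfieldI[where f="\<lambda>a. f a * g' a + f' a * g a" and g="\<lambda>a. g a * g' a"]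
      qpoly_add qpoly_mult) auto
  finally show "x + y \<in> qfield W a" .
  have "x * y = (f a * f' a) / (g a * g' a)" using * by simp
  also have "\<dots> \<in> qfield W a"
    using * by (intro qfieldI[where f="\<lambda>a. f a * f' a" and g="\<lambda>a. g a * g' a"] qpoly_mult) auto
  finally show "x * y \<in> qfield W a" .
next
  fix x assume "x \<in> qfield W a"
  then obtain f g where *: "qpoly W f" "qpoly W g" "g a \<noteq> 0" "x = f a / g a" by (auto elim!: qfieldE)
  show "- x \<in> qfield W a" using * qfieldI[OF qpoly_uminus[of W f], of g a] by simp
  show "inverse x \<in> qfield W a"
  proof (cases "f a = 0")
    case True
    then show ?thesis using qpoly_in_qfield[OF qpoly_const[of W 0], of a] * by simp
  next
    case False
    then show ?thesis using qfieldI[of W g f a] * by simp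
  qed
qed

lemma qfield_mono: "W \<subseteq> W' \<Longrightarrow> qfield W a \<subseteq> qfield W' a"
  unfolding qfield_def using qpoly_mono by blast

context
  fixes F assumes F: "real_subfield F"
begin

lemma subfield_rat: "of_rat c \<in> F" using F unfolding real_subfield_def by blast
lemma subfield_rats: "x \<in> \<rat> \<Longrightarrow> x \<in> F" using subfield_rat by (auto elim: Rats_cases)
lemma subfield_add: "x \<in> F \<Longrightarrow> y \<in> F \<Longrightarrow> x + y \<in> F" using F unfolding real_subfield_def by blast
lemma subfield_mult: "x \<in> F \<Longrightarrow> y \<in> F \<Longrightarrow> x * y \<in> F" using F unfolding real_subfield_def by blast
lemma subfield_uminus: "x \<in> F \<Longrightarrow> - x \<in> F" using F unfolding real_subfield_def by blast
lemma subfield_diff: "x \<in> F \<Longrightarrow> y \<in> F \<Longrightarrow> x - y \<in> F"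
  using subfield_add[of x "- y"] subfield_uminus[of y] by simp
lemma subfield_divide: "x \<in> F \<Longrightarrow> y \<in> F \<Longrightarrow> x / y \<in> F"
  using subfield_mult[of x "inverse y"] F unfolding real_subfield_def by (simp add: divide_inverse)
lemma subfield_sum: "(\<And>i. i \<in> A \<Longrightarrow> f i \<in> F) \<Longrightarrow> sum f A \<in> F"
  by (induction A rule: infinite_finite_induct) (auto intro: subfield_add subfield_rats)
lemma subfield_prod: "(\<And>i. i \<in> A \<Longrightarrow> f i \<in> F) \<Longrightarrow> prod f A \<in> F"
  by (induction A rule: infinite_finite_induct) (auto intro: subfield_mult subfield_rats)

end

lemma qfield_common_denominator:
  assumes "finite J" "\<forall>j\<in>J. c j \<in> qfield W a"
  shows "\<exists>f g. qpoly W g \<and> g a \<noteq> 0 \<and> (\<forall>j\<in>J. qpoly W (f j) \<and> c j = f j a / g a)"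
  using assms
proof (induction J rule: finite_induct)
  case empty
  show ?case using qpoly_const[of W 1] by (intro exI[of _ "\<lambda>_ _. 1"] exI[of _ "\<lambda>_. 1"]) auto
next
  case (insert j J)
  then obtain f g where fg: "qpoly W g" "g a \<noteq> 0" "\<forall>i\<in>J. qpoly W (f i) \<and> c i = f i a / g a"
    by auto
  obtain f0 g0 where 0: "qpoly W f0" "qpoly W g0" "g0 a \<noteq> 0" "c j = f0 a / g0 a"
    using insert.prems by (auto elim: qfieldE)
  define f' where "f' i = (if i = j then (\<lambda>a. f0 a * g a) else (\<lambda>a. f i a * g0 a))" for i
  have "qpoly W (f' i) \<and> c i = f' i a / (g a * g0 a)" if "i \<in> insert j J" for i
    using that fg 0 by (auto simp: f'_def intro: qpoly_mult)
  moreover have "qpoly W (\<lambda>a. g a * g0 a)" "g a * g0 a \<noteq> 0"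
    using fg 0 by (auto intro: qpoly_mult)
  ultimately show ?case by (intro exI[of _ f'] exI[of _ "\<lambda>a. g a * g0 a"]) blast
qed

text \<open>Clearing denominators turns the relation into a polynomial \<open>h\<close> that
  vanishes at a generic point, hence everywhere. Its coefficients depend on \<open>W\<close> only,
  so setting the \<open>J\<close> coordinates to 0, and then only coordinate \<open>j\<close> to 1,
  isolates the coefficient of \<open>a j\<close>.\<close>

lemma generic_linear_independent:
  assumes gen: "algebraically_independent_rat (W \<union> J) a" and J: "finite J" "W \<inter> J = {}"
    and c: "c0 \<in> qfield W a" "\<And>j. j \<in> J \<Longrightarrow> c j \<in> qfield W a"
    and eq: "c0 + (\<Sum>j\<in>J. c j * a j) = 0" and j: "j \<in> J"
  shows "c j = 0"
proof -
  define c' where "c' k = (case k of None \<Rightarrow> c0 | Some i \<Rightarrow> c i)" for k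
  have "c' k \<in> qfield W a" if "k \<in> insert None (Some ` J)" for k
    using that c by (auto simp: c'_def)
  then obtain f g where fg: "qpoly W g" "g a \<noteq> 0"
      "\<forall>k\<in>insert None (Some ` J). qpoly W (f k) \<and> c' k = f k a / g a"
    using qfield_common_denominator[of "insert None (Some ` J)" c' W a] J(1) by blast
  have f: "qpoly W (f None)" "c0 = f None a / g a" "\<And>i. i \<in> J \<Longrightarrow> qpoly W (f (Some i))"
     "\<And>i. i \<in> J \<Longrightarrow> c i = f (Some i) a / g a"
    using fg(3) by (auto simp: c'_def)
  define h where "h b = f None b + (\<Sum>j\<in>J. f (Some j) b * b j)" for b
  have "qpoly (W \<union> J) h"
    unfolding h_def[abs_def] using f J(1)
    by (intro qpoly_add qpoly_sum qpoly_mult qpoly_var) (auto intro: qpoly_mono)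
  moreover have "h a = 0"
  proof -
    have "h a = g a * (c0 + (\<Sum>j\<in>J. c j * a j))"
      using f fg(2) by (auto simp: h_def distrib_left sum_distrib_left intro!: sum.cong)
    then show ?thesis using eq by simp
  qed
  ultimately have h0: "h b = 0" for b by (rule qpoly_generic_zero[OF gen])
  define b0 where "b0 i = (if i \<in> J then 0 else a i)" for i
  have W: "a i = b0 i" "a i = (b0(j := 1)) i" if "i \<in> W" for i
    using that J j by (auto simp: b0_def)
  have "f None a = f None b0" "\<And>i. i \<in> J \<Longrightarrow> f (Some i) a = f (Some i) b0"
    "f None a = f None (b0(j := 1))" "\<And>i. i \<in> J \<Longrightarrow> f (Some i) a = f (Some i) (b0(j := 1))"
    by (rule qpoly_cong[OF f(1)] qpoly_cong[OF f(3)], (assumption)?, erule W)+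
  note e = this
  have "h b0 = f None a" using e by (simp add: h_def b0_def)
  moreover have "h (b0(j := 1)) = f None a + (\<Sum>i\<in>J. if i = j then f (Some i) a else 0)"
    unfolding h_def using e by (auto simp: b0_def intro!: sum.cong)
  ultimately have "f (Some j) a = 0" using h0 J(1) j by simp
  then show ?thesis using f j by simp
qed

text \<open>Equality of the two quotients is a polynomial identity, so it survives putting rational
  numbers into the coordinates of \<open>W1 - W2\<close>. The \<open>W2\<close> quotient does not
  notice, while the \<open>W1\<close> quotient becomes an expression in the common
  coordinates.\<close>

lemma qfield_Int:
  assumes gen: "algebraically_independent_rat (W1 \<union> W2) a" and fin: "finite W1"
    and x: "x \<in> qfield W1 a" "x \<in> qfield W2 a"
  shows "x \<in> qfield (W1 \<inter> W2) a"
proof -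
  obtain f1 g1 where 1: "qpoly W1 f1" "qpoly W1 g1" "g1 a \<noteq> 0" "x = f1 a / g1 a"
    using x(1) by (rule qfieldE)
  obtain f2 g2 where 2: "qpoly W2 f2" "qpoly W2 g2" "g2 a \<noteq> 0" "x = f2 a / g2 a"
    using x(2) by (rule qfieldE)
  have "qpoly (W1 \<union> W2) (\<lambda>b. f1 b * g2 b - f2 b * g1 b)"
    using 1 2 by (intro qpoly_diff qpoly_mult) (auto intro: qpoly_mono)
  moreover have "f1 a * g2 a - f2 a * g1 a = 0" using 1 2 by (simp add: field_simps)
  ultimately have eq: "f1 b * g2 b - f2 b * g1 b = 0" for b
    using qpoly_generic_zero[OF gen] by blast
  let ?J = "W1 - W2"
  have fJ: "finite ?J" using fin by simp
  obtain b where b: "\<forall>i\<in>?J. b i \<in> \<rat>" "\<forall>i. i \<notin> ?J \<longrightarrow> b i = a i" "g1 b \<noteq> 0"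
    using qpoly_specialize[of ?J W1 g1 a] fJ 1 by blast
  obtain f' where f': "qpoly (W1 - ?J) f'" "f1 b = f' a"
    using qpoly_specialized[OF fJ 1(1) b(1)] b(2) by blast
  obtain g' where g': "qpoly (W1 - ?J) g'" "g1 b = g' a"
    using qpoly_specialized[OF fJ 1(2) b(1)] b(2) by blast
  have "f2 b = f2 a" "g2 b = g2 a" using b(2) by (auto intro!: qpoly_cong[OF 2(1)] qpoly_cong[OF 2(2)])
  then have "f1 b / g1 b = f2 a / g2 a" using eq[of b] b(3) 2(3) by (simp add: frac_eq_eq)
  then have "x = f1 b / g1 b" using 2(4) by simp
  then have "x = f' a / g' a" using f' g' by simp
  moreover have "W1 - ?J = W1 \<inter> W2" by auto
  ultimately show ?thesis using f' g' b(3) by (auto intro: qfieldI)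
qed

text \<open>Here \<open>y\<close> is a point rational over \<open>W\<close>, and \<open>a\<close> on
  \<open>J\<close> is a generic point whose squared distance to \<open>y\<close> is known in terms
  of \<open>U\<close>. Replacing the generic point by rational points gives squared distances from
  \<open>y\<close> that no longer involve \<open>J\<close>; two of them determine a coordinate of
  \<open>y\<close>.\<close>

lemma qfield_sphere_center:
  assumes gen: "algebraically_independent_rat (W \<union> J) a" and fin: "finite J" and WJ: "W \<inter> J = {}"
    and U: "U \<subseteq> W \<union> J"
    and y: "\<And>j. j \<in> J \<Longrightarrow> y j \<in> qfield W a"
    and d: "(\<Sum>j\<in>J. (y j - a j)\<^sup>2) \<in> qfield U a" and j: "j \<in> J"
  shows "y j \<in> qfield (U - J) a"
proof -
  let ?F = "qfield (U - J) a"
  have F: "real_subfield ?F" by (rule real_subfield_qfield)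
  obtain f g where g: "qpoly W g" "g a \<noteq> 0"
    and f': "\<forall>j\<in>J. qpoly W (f j) \<and> y j = f j a / g a"
    using qfield_common_denominator[OF fin, of y W a] y by blast
  have f: "\<And>j. j \<in> J \<Longrightarrow> qpoly W (f j) \<and> y j = f j a / g a" using f' by blast
  have fy: "f j a = g a * y j" if "j \<in> J" for j using f[OF that] g(2) by simp
  obtain f2 g2 where 2: "qpoly U f2" "qpoly U g2" "g2 a \<noteq> 0" "(\<Sum>j\<in>J. (y j - a j)\<^sup>2) = f2 a / g2 a"
    using d by (rule qfieldE)
  define h where "h b = g2 b * (\<Sum>j\<in>J. (f j b - g b * b j)\<^sup>2) - f2 b * (g b)\<^sup>2" for b
  have "qpoly (W \<union> J) h"
    unfolding h_def[abs_def] using f g 2 fin U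
    by (intro qpoly_diff qpoly_sum qpoly_mult qpoly_var qpoly_power) (auto intro: qpoly_mono)
  moreover have "h a = 0"
  proof -
    have "(\<Sum>j\<in>J. (f j a - g a * a j)\<^sup>2) = (\<Sum>j\<in>J. (g a)\<^sup>2 * (y j - a j)\<^sup>2)"
    proof (rule sum.cong[OF refl])
      fix j assume "j \<in> J"
      then have "f j a - g a * a j = g a * (y j - a j)" using fy by (simp add: right_diff_distrib)
      then show "(f j a - g a * a j)\<^sup>2 = (g a)\<^sup>2 * (y j - a j)\<^sup>2" by (simp only: power_mult_distrib)
    qed
    then have "(\<Sum>j\<in>J. (f j a - g a * a j)\<^sup>2) = (g a)\<^sup>2 * (f2 a / g2 a)"
      using 2(4) by (simp only: sum_distrib_left[symmetric])
    then show ?thesis using 2(3) unfolding h_def by simp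
  qed
  ultimately have h0: "h b = 0" for b by (rule qpoly_generic_zero[OF gen])
  \<comment> \<open>The numerators and the denominator of \<open>y\<close> live on \<open>W\<close>,
    so \<open>y\<close> stays put when \<open>a\<close> is changed on \<open>J\<close>; only the
    right-hand side of the distance equation is specialized.\<close>
  have key: "(\<Sum>j\<in>J. (y j - b j)\<^sup>2) \<in> ?F"
    if b: "\<forall>i\<in>J. b i \<in> \<rat>" "\<forall>i. i \<notin> J \<longrightarrow> b i = a i" "g2 b \<noteq> 0" for b
  proof -
    have W: "b i = a i" if "i \<in> W" for i using that WJ b(2) by blast
    have e: "f j b = f j a" if "j \<in> J" for j
      using qpoly_cong[OF conjunct1[OF f[OF that]] W] .
    have e': "g b = g a" using qpoly_cong[OF g(1) W] .
    have "(\<Sum>j\<in>J. (f j b - g b * b j)\<^sup>2) = (\<Sum>j\<in>J. (g a)\<^sup>2 * (y j - b j)\<^sup>2)"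
    proof (rule sum.cong[OF refl])
      fix j assume "j \<in> J"
      then have "f j b - g b * b j = g a * (y j - b j)" using fy e e' by (simp add: right_diff_distrib)
      then show "(f j b - g b * b j)\<^sup>2 = (g a)\<^sup>2 * (y j - b j)\<^sup>2" by (simp only: power_mult_distrib)
    qed
    then have "(\<Sum>j\<in>J. (f j b - g b * b j)\<^sup>2) = (g a)\<^sup>2 * (\<Sum>j\<in>J. (y j - b j)\<^sup>2)"
      by (simp only: sum_distrib_left[symmetric])
    then have "(g a)\<^sup>2 * (g2 b * (\<Sum>j\<in>J. (y j - b j)\<^sup>2)) = (g a)\<^sup>2 * f2 b"
      using h0[of b] e' unfolding h_def by (simp add: mult_ac)
    then have "g2 b * (\<Sum>j\<in>J. (y j - b j)\<^sup>2) = f2 b" using g(2) by simp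
    then have "(\<Sum>j\<in>J. (y j - b j)\<^sup>2) = f2 b / g2 b" using b(3) by (metis nonzero_mult_div_cancel_left)
    moreover obtain f' where f': "qpoly (U - J) f'" "f2 b = f' a"
      using qpoly_specialized[OF fin 2(1) b(1)] b(2) by blast
    moreover obtain g' where g': "qpoly (U - J) g'" "g2 b = g' a"
      using qpoly_specialized[OF fin 2(2) b(1)] b(2) by blast
    ultimately show ?thesis using b(3) by (auto intro: qfieldI)
  qed
  obtain b where b: "\<forall>i\<in>J. b i \<in> \<rat>" "\<forall>i. i \<notin> J \<longrightarrow> b i = a i" "g2 b \<noteq> 0"
    using qpoly_specialize[OF fin 2(2,3)] by blast
  obtain c where c: "of_rat c \<noteq> b j" "g2 (b(j := of_rat c)) \<noteq> 0"
    using qpoly_nonzero_upd[OF 2(2) b(3)] by blast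
  let ?b = "b(j := of_rat c)"
  have k1: "(\<Sum>j\<in>J. (y j - b j)\<^sup>2) \<in> ?F" by (rule key[OF b])
  have k2: "(\<Sum>j\<in>J. (y j - ?b j)\<^sup>2) \<in> ?F" 
  proof (rule key)
    show "\<forall>i\<in>J. ?b i \<in> \<rat>" "\<forall>i. i \<notin> J \<longrightarrow> ?b i = a i" using b j by auto
  qed (rule c(2))
  have "(\<Sum>j\<in>J. (y j - b j)\<^sup>2) = (y j - b j)\<^sup>2 + (\<Sum>i\<in>J - {j}. (y i - b i)\<^sup>2)"
    using fin j by (simp add: sum.remove)
  moreover have "(\<Sum>i\<in>J. (y i - ?b i)\<^sup>2) = (y j - of_rat c)\<^sup>2 + (\<Sum>i\<in>J - {j}. (y i - b i)\<^sup>2)"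
    using fin j by (simp add: sum.remove)
  ultimately have D: "(y j - b j)\<^sup>2 - (y j - of_rat c)\<^sup>2 \<in> ?F" (is "?D \<in> _")
    using subfield_diff[OF F k1 k2] by simp
  have r: "b j \<in> ?F" "of_rat c \<in> ?F" "(1::real) + 1 \<in> ?F"
    using b j subfield_rats[OF F] subfield_rat[OF F] by auto
  \<comment> \<open>The two points differ only in coordinate \<open>j\<close>, so all other squares
    have cancelled and (y - b)^2 - (y - c)^2 = 2 y (c - b) + b^2 - c^2 is solved for y.\<close>
  have "(?D - b j * b j + of_rat c * of_rat c) / ((1 + 1) * (of_rat c - b j)) \<in> ?F"
    by (rule subfield_divide[OF F subfield_add[OF F subfield_diff[OF F D] ]]
       subfield_diff[OF F] subfield_mult[OF F] r)+
  moreover have "?D - b j * b j + of_rat c * of_rat c = y j * ((1 + 1) * (of_rat c - b j))"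
    by (simp add: algebra_simps power2_eq_square)
  ultimately show ?thesis using c(1) by simp
qed

section \<open>Existence of generic points\<close>

text \<open>A finitely supported map is determined by the finite set of pairs that is its graph over
  the support. This coding is used twice, first for monomials and then for polynomials over
  them.\<close>

lemma countable_rat_mpoly:
  assumes "countable I"
  shows "countable {f :: 'i rat_mpoly. \<forall>m\<in>Poly_Mapping.keys f. Poly_Mapping.keys m \<subseteq> I}"
proof -
  let ?M = "{m :: 'i \<Rightarrow>\<^sub>0 nat. Poly_Mapping.keys m \<subseteq> I}"
  define gr :: "('i \<Rightarrow>\<^sub>0 nat) \<Rightarrow> ('i \<times> nat) set"
    where "gr m = (\<lambda>i. (i, Poly_Mapping.lookup m i)) ` Poly_Mapping.keys m" for m
  have "inj gr"
  proof (rule injI, rule poly_mapping_eqI)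
    fix m m' k assume "gr m = gr m'"
    then have "(k, n) \<in> gr m \<longleftrightarrow> (k, n) \<in> gr m'" for n by simp
    from this[of "Poly_Mapping.lookup m k"] this[of "Poly_Mapping.lookup m' k"]
    show "Poly_Mapping.lookup m k = Poly_Mapping.lookup m' k"
      unfolding gr_def by (auto simp: image_iff in_keys_iff)
  qed
  moreover have "gr ` ?M \<subseteq> {S. finite S \<and> S \<subseteq> I \<times> UNIV}" by (auto simp: gr_def)
  moreover have "countable {S. finite S \<and> S \<subseteq> I \<times> (UNIV :: nat set)}"
    using assms by (intro countable_Collect_finite_subset countable_SIGMA) auto
  ultimately have M: "countable ?M"
    by (meson countable_image_inj_on countable_subset inj_on_subset subset_UNIV)
  define gr' :: "'i rat_mpoly \<Rightarrow> (('i \<Rightarrow>\<^sub>0 nat) \<times> rat) set"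
    where "gr' f = (\<lambda>i. (i, Poly_Mapping.lookup f i)) ` Poly_Mapping.keys f" for f
  have "inj gr'"
  proof (rule injI, rule poly_mapping_eqI)
    fix m m' k assume "gr' m = gr' m'"
    then have "(k, n) \<in> gr' m \<longleftrightarrow> (k, n) \<in> gr' m'" for n by simp
    from this[of "Poly_Mapping.lookup m k"] this[of "Poly_Mapping.lookup m' k"]
    show "Poly_Mapping.lookup m k = Poly_Mapping.lookup m' k"
      unfolding gr'_def by (auto simp: image_iff in_keys_iff)
  qed
  moreover have "gr' ` {f. \<forall>m\<in>Poly_Mapping.keys f. Poly_Mapping.keys m \<subseteq> I} \<subseteq> {S. finite S \<and> S \<subseteq> ?M \<times> UNIV}"
    by (auto simp: gr'_def)
  moreover have "countable {S. finite S \<and> S \<subseteq> ?M \<times> (UNIV :: rat set)}"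
    using M by (intro countable_Collect_finite_subset countable_SIGMA) auto
  ultimately show ?thesis
    by (meson countable_image_inj_on countable_subset inj_on_subset subset_UNIV)
qed

text \<open>Sorted by the exponent of \<open>i\<close>, the polynomial becomes one in
  \<open>t\<close> with coefficients \<open>c k\<close>. For an exponent that occurs, the
  coefficient comes from a nonzero polynomial over \<open>I\<close>, since monomials with equal
  exponent of \<open>i\<close> stay distinct after \<open>i\<close> is deleted; independence of
  \<open>a\<close> keeps its value nonzero.\<close>

lemma finite_roots_generic_extension:
  fixes f :: "'i rat_mpoly"
  assumes a: "algebraically_independent_rat I a" and i: "i \<notin> I"
    and keys: "\<forall>m\<in>Poly_Mapping.keys f. Poly_Mapping.keys m \<subseteq> insert i I" and f0: "f \<noteq> 0"
  shows "finite {t. rat_mpoly_eval (a(i := t)) f = 0}"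
proof -
  define rem where "rem m = Poly_Mapping.update i 0 m" for m :: "'i \<Rightarrow>\<^sub>0 nat"
  define e where "e m = Poly_Mapping.lookup m i" for m :: "'i \<Rightarrow>\<^sub>0 nat"
  have lr: "Poly_Mapping.lookup (rem m) j = (if j = i then 0 else Poly_Mapping.lookup m j)" for m j
    by (simp add: rem_def lookup_update)
  have kr: "Poly_Mapping.keys (rem m) = Poly_Mapping.keys m - {i}" for m
    by (auto simp: in_keys_iff lr split: if_splits)
  have mon: "monom_eval (a(i := t)) m = monom_eval a (rem m) * t ^ e m" for t m
  proof -
    let ?A = "insert i (Poly_Mapping.keys m)"
    have "monom_eval (a(i := t)) m = (\<Prod>j\<in>?A. (a(i := t)) j ^ Poly_Mapping.lookup m j)"
      by (rule monom_eval_superset) auto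
    also have "\<dots> = t ^ e m * (\<Prod>j\<in>?A - {i}. (a(i := t)) j ^ Poly_Mapping.lookup m j)"
      by (subst prod.remove[of _ i]) (auto simp: e_def)
    also have "(\<Prod>j\<in>?A - {i}. (a(i := t)) j ^ Poly_Mapping.lookup m j)
        = (\<Prod>j\<in>?A - {i}. a j ^ Poly_Mapping.lookup (rem m) j)"
      by (intro prod.cong) (auto simp: lr)
    also have "\<dots> = monom_eval a (rem m)"
      by (rule monom_eval_superset[symmetric]) (auto simp: kr)
    finally show ?thesis by (simp only: mult.commute)
  qed
  define K where "K k = {m \<in> Poly_Mapping.keys f. e m = k}" for k
  define c where "c k = (\<Sum>m\<in>K k. of_rat (Poly_Mapping.lookup f m) * monom_eval a (rem m))" for k
  define n where "n = Max (e ` Poly_Mapping.keys f)"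
  have "rat_mpoly_eval (a(i := t)) f = (\<Sum>k\<le>n. c k * t ^ k)" for t
  proof -
    have "rat_mpoly_eval (a(i := t)) f
        = (\<Sum>m\<in>Poly_Mapping.keys f. of_rat (Poly_Mapping.lookup f m) * monom_eval (a(i := t)) m)"
      by (simp add: rat_mpoly_eval_def monom_eval_def)
    also have "\<dots> = (\<Sum>k\<le>n. \<Sum>m\<in>K k. of_rat (Poly_Mapping.lookup f m) * monom_eval (a(i := t)) m)"
      unfolding K_def by (rule sum.group[symmetric]) (auto simp: n_def)
    also have "\<dots> = (\<Sum>k\<le>n. c k * t ^ k)"
      unfolding c_def sum_distrib_right by (intro sum.cong) (auto simp: mon K_def)
    finally show ?thesis .
  qed
  moreover have "\<exists>k\<le>n. c k \<noteq> 0"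
  proof -
    obtain m0 where m0: "m0 \<in> Poly_Mapping.keys f" using f0 by fastforce
    have fK: "finite (K k)" for k by (simp add: K_def)
    let ?k = "e m0"
    define g where "g = (\<Sum>m\<in>K ?k. Poly_Mapping.single (rem m) (Poly_Mapping.lookup f m))"
    have "rat_mpoly_eval a (\<Sum>m\<in>S. Poly_Mapping.single (rem m) (Poly_Mapping.lookup f m))
      = (\<Sum>m\<in>S. of_rat (Poly_Mapping.lookup f m) * monom_eval a (rem m))" if "finite S" for S
      using that
      by (induction S rule: finite_induct)
        (auto simp: rat_mpoly_eval_add rat_mpoly_eval_single, simp add: rat_mpoly_eval_def)
    from this[OF fK] have eg: "rat_mpoly_eval a g = c ?k" by (simp add: g_def c_def)
    have "Poly_Mapping.keys g \<subseteq> rem ` K ?k"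
      unfolding g_def by (rule order_trans[OF Poly_Mapping.keys_sum]) (auto split: if_splits)
    moreover have "Poly_Mapping.keys (rem m) \<subseteq> I" if "m \<in> K ?k" for m
      using that keys unfolding K_def kr by blast
    ultimately have kg: "\<forall>m\<in>Poly_Mapping.keys g. Poly_Mapping.keys m \<subseteq> I" by blast
    have "Poly_Mapping.lookup g (rem m0)
        = (\<Sum>m\<in>K ?k. if m = m0 then Poly_Mapping.lookup f m else 0)"
      unfolding g_def lookup_sum
    proof (rule sum.cong[OF refl])
      fix m assume "m \<in> K ?k"
      then have "e m = e m0" by (simp add: K_def)
      then have "rem m = rem m0 \<longleftrightarrow> m = m0"
        by (auto simp: poly_mapping_eq_iff fun_eq_iff lr e_def)
      then show "Poly_Mapping.lookup (Poly_Mapping.single (rem m) (Poly_Mapping.lookup f m)) (rem m0)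
          = (if m = m0 then Poly_Mapping.lookup f m else 0)"
        by (auto simp: lookup_single when_def)
    qed
    also have "\<dots> = Poly_Mapping.lookup f m0" using fK m0 by (simp add: K_def)
    finally have "g \<noteq> 0" using m0 by (auto simp: in_keys_iff)
    then have "c ?k \<noteq> 0" using a kg eg unfolding algebraically_independent_rat_def by metis
    moreover have "?k \<le> n" using m0 by (simp add: n_def)
    ultimately show ?thesis by blast
  qed
  ultimately show ?thesis using polyfun_finite_roots[of c n] by simp
qed

text \<open>A new coordinate has to avoid the roots of countably many nonzero polynomials, each with
  finitely many roots, and the reals are uncountable.\<close>

lemma exists_algebraically_independent_rat:
  "finite I \<Longrightarrow> \<exists>a. algebraically_independent_rat I a"
proof (induction rule: finite_induct)
  case empty
  have "f = 0" if "\<forall>m\<in>Poly_Mapping.keys f. Poly_Mapping.keys m \<subseteq> {}" "rat_mpoly_eval a f = 0"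
    for f :: "'a rat_mpoly" and a
  proof -
    have "Poly_Mapping.keys f \<subseteq> {0}" using that(1) by auto
    then have "rat_mpoly_eval a f = of_rat (Poly_Mapping.lookup f 0)"
      by (simp add: rat_mpoly_eval_superset[of "{0}"] monom_eval_def)
    with that(2) have "0 \<notin> Poly_Mapping.keys f" by (simp add: in_keys_iff)
    with \<open>Poly_Mapping.keys f \<subseteq> {0}\<close> have "Poly_Mapping.keys f = {}" by blast
    then show ?thesis by (simp only: keys_eq_empty)
  qed
  then show ?case unfolding algebraically_independent_rat_def by blast
next
  case (insert i I)
  then obtain a where a: "algebraically_independent_rat I a" by blast
  let ?M = "{f :: 'a rat_mpoly. \<forall>m\<in>Poly_Mapping.keys f. Poly_Mapping.keys m \<subseteq> insert i I} - {0}"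
  have "countable ?M"
    using insert.hyps by (intro countable_Diff countable_rat_mpoly) (auto intro: countable_finite)
  moreover have "countable {t. rat_mpoly_eval (a(i := t)) f = 0}" if "f \<in> ?M" for f
    using that by (intro countable_finite finite_roots_generic_extension[OF a insert.hyps(2)]) auto
  ultimately have "countable (\<Union>f\<in>?M. {t. rat_mpoly_eval (a(i := t)) f = 0})"
    by (rule countable_UN)
  then have "(\<Union>f\<in>?M. {t. rat_mpoly_eval (a(i := t)) f = 0}) \<noteq> UNIV"
    using uncountable_UNIV_real by (auto simp only:)
  then obtain t where "t \<notin> (\<Union>f\<in>?M. {t. rat_mpoly_eval (a(i := t)) f = 0})" by blast
  then have "algebraically_independent_rat (insert i I) (a(i := t))"
    unfolding algebraically_independent_rat_def by blast
  then show ?case by blast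
qed

section \<open>Frames in Euclidean space\<close>

definition coords :: "('a \<Rightarrow> real ^ 'd) \<Rightarrow> 'a \<times> 'd \<Rightarrow> real" where
  "coords p = (\<lambda>(v, i). p v $ i)"

definition generic_on :: "'a set \<Rightarrow> ('a \<Rightarrow> real ^ 'd) \<Rightarrow> bool" where
  "generic_on V p \<longleftrightarrow> algebraically_independent_rat (V \<times> UNIV) (coords p)"

lemma generic_on_mono: "generic_on V p \<Longrightarrow> W \<subseteq> V \<Longrightarrow> generic_on W p"
  unfolding generic_on_def by (rule algebraically_independent_rat_mono) auto

definition vecs :: "real set \<Rightarrow> (real ^ 'd) set" where
  "vecs F = {x. \<forall>i. x $ i \<in> F}"

abbreviation Qvecs :: "'a set \<Rightarrow> ('a \<Rightarrow> real ^ 'd::finite) \<Rightarrow> (real ^ 'd) set" where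
  "Qvecs V p \<equiv> vecs (qfield (V \<times> UNIV) (coords p))"

lemma point_in_Qvecs: "v \<in> V \<Longrightarrow> p v \<in> Qvecs V p"
proof -
  assume "v \<in> V"
  then have "coords p (v, i) \<in> qfield (V \<times> UNIV) (coords p)" for i
    by (intro qpoly_in_qfield[OF qpoly_var]) simp
  then show ?thesis unfolding vecs_def coords_def by simp
qed

lemma points_in_Qvecs: "p ` V \<subseteq> Qvecs V p"
  by (rule image_subsetI) (rule point_in_Qvecs)

lemma Qvecs_mono: "V \<subseteq> W \<Longrightarrow> Qvecs V p \<subseteq> Qvecs W p"
  unfolding vecs_def by (auto intro: subsetD[OF qfield_mono, rotated])

context
  fixes F assumes F: "real_subfield F"
begin

lemma vecs_add: "x \<in> vecs F \<Longrightarrow> y \<in> vecs F \<Longrightarrow> x + y \<in> vecs F"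
  unfolding vecs_def by (auto intro: subfield_add[OF F])
lemma vecs_diff: "x \<in> vecs F \<Longrightarrow> y \<in> vecs F \<Longrightarrow> x - y \<in> vecs F"
  unfolding vecs_def by (auto intro: subfield_diff[OF F])
lemma vecs_scaleR: "c \<in> F \<Longrightarrow> y \<in> vecs F \<Longrightarrow> c *\<^sub>R y \<in> vecs F"
  unfolding vecs_def by (auto intro: subfield_mult[OF F])
lemma vecs_sum: "(\<And>i. i \<in> A \<Longrightarrow> f i \<in> vecs F) \<Longrightarrow> sum f A \<in> vecs F"
  unfolding vecs_def by (auto intro: subfield_sum[OF F])
lemma vecs_inner: "x \<in> vecs F \<Longrightarrow> y \<in> vecs F \<Longrightarrow> x \<bullet> y \<in> F"
  unfolding vecs_def inner_vec_def by (auto intro!: subfield_sum[OF F] subfield_mult[OF F])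
lemma vecs_dist: "x \<in> vecs F \<Longrightarrow> y \<in> vecs F \<Longrightarrow> (dist x y)\<^sup>2 \<in> F"
  by (simp add: dist_norm power2_norm_eq_inner vecs_inner vecs_diff)
lemma subfield_det: "(\<And>i j. A $ i $ j \<in> F) \<Longrightarrow> det A \<in> F"
  unfolding det_def
  by (intro subfield_sum[OF F] subfield_mult[OF F]; (intro subfield_prod[OF F])?)
    (auto intro: subfield_rats[OF F])

end

lemma real_subfield_UNIV: "real_subfield UNIV"
  unfolding real_subfield_def by simp

lemma dist_eq_dist_iff_inner: "dist a b = dist c d \<longleftrightarrow> (a - b) \<bullet> (a - b) = (c - d) \<bullet> (c - d)"
  for a b c d :: "'b::real_inner"
  by (simp add: dist_norm norm_eq)

text \<open>The term \<open>s \<bullet> s\<close> cancels, so equidistance is linear in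
  \<open>s\<close>. All later uniqueness arguments rest on this.\<close>

lemma equidistant_iff: "dist y s = dist z s \<longleftrightarrow> y \<bullet> y - z \<bullet> z = 2 * ((y - z) \<bullet> s)"
  for y z s :: "'b::real_inner"
  unfolding dist_eq_dist_iff_inner by (auto simp: inner_simps inner_commute)

text \<open>Affine independence of the d + 1 points over \<open>insert w K\<close>, based at
  \<open>w\<close>. The bijection with the index type both enforces \<open>card K = CARD('d)\<close>
  and provides the rows of the determinant.\<close>

definition frame :: "('a \<Rightarrow> real ^ 'd) \<Rightarrow> 'a \<Rightarrow> 'a set \<Rightarrow> bool" where
  "frame p w K \<longleftrightarrow> (\<exists>\<sigma>. bij_betw \<sigma> (UNIV :: 'd set) K \<and> det (\<chi> i. p (\<sigma> i) - p w) \<noteq> 0)"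

lemma frame_finite: "frame p w K \<Longrightarrow> finite K"
  unfolding frame_def using bij_betw_finite finite by blast

lemma frame_nonempty: "frame p w K \<Longrightarrow> K \<noteq> {}"
  unfolding frame_def by (auto simp: bij_betw_def)

lemma generic_frame:
  fixes p :: "'a \<Rightarrow> real ^ 'd::finite"
  assumes gen: "generic_on V p" and w: "w \<in> V" "w \<notin> K" and K: "K \<subseteq> V" "card K = CARD('d)"
  shows "frame p w K"
proof -
  have "finite K" using K(2) by (metis card.infinite zero_less_card_finite less_irrefl)
  then obtain \<sigma> where \<sigma>: "bij_betw \<sigma> (UNIV :: 'd set) K"
    using K(2) by (metis finite finite_same_card_bij)
  then have inj: "\<sigma> i = \<sigma> j \<longleftrightarrow> i = j" for i j unfolding bij_betw_def inj_on_def by auto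
  have \<sigma>K: "\<sigma> i \<in> K" for i using \<sigma> unfolding bij_betw_def by auto
  define f where "f a = det (\<chi> i j. a (\<sigma> i, j) - a (w, j))" for a :: "'a \<times> 'd \<Rightarrow> real"
  have "qpoly (V \<times> UNIV) f"
    unfolding f_def[abs_def] det_def
  proof (intro qpoly_sum qpoly_mult)
    fix \<pi> :: "'d \<Rightarrow> 'd"
    show "qpoly (V \<times> (UNIV :: 'd set)) (\<lambda>a. of_int (sign \<pi>))"
      using qpoly_const[of "V \<times> UNIV" "of_int (sign \<pi>)"] by simp
    show "qpoly (V \<times> UNIV) (\<lambda>a. \<Prod>i\<in>UNIV. (\<chi> i j. a (\<sigma> i, j) - a (w, j)) $ i $ \<pi> i)"
      using w K \<sigma>K by (auto intro!: qpoly_prod qpoly_diff qpoly_var)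
  qed simp
  \<comment> \<open>Witness that the determinant is not identically zero: \<open>w\<close> at the
    origin and each \<open>\<sigma> i\<close> at the i-th unit vector.\<close>
  moreover have "f (\<lambda>(v, j). if v = \<sigma> j then 1 else 0) \<noteq> 0"
  proof -
    have "(\<chi> i j. (if \<sigma> i = \<sigma> j then 1 else 0) - (if w = \<sigma> j then 1 else 0)) = (mat 1 :: real ^ 'd ^ 'd)"
      using w(2) \<sigma>K by (auto simp: vec_eq_iff mat_def inj)
    then show ?thesis by (simp add: f_def)
  qed
  ultimately have "f (coords p) \<noteq> 0"
    using qpoly_generic_zero gen unfolding generic_on_def by blast
  moreover have "(\<chi> i j. coords p (\<sigma> i, j) - coords p (w, j)) = (\<chi> i. p (\<sigma> i) - p w)"
    by (simp add: vec_eq_iff coords_def)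
  ultimately show ?thesis using \<sigma> unfolding frame_def f_def by auto
qed

text \<open>Cramer's quotients of determinants form one solution that works for all fields
  containing the data, hence the choice of \<open>x\<close> before \<open>F\<close>.\<close>

lemma cramer_subfield:
  fixes A :: "real ^ 'd ^ 'd"
  assumes "det A \<noteq> 0"
  shows "\<exists>x. A *v x = b \<and> (\<forall>F. real_subfield F \<and> (\<forall>i j. A $ i $ j \<in> F) \<and> b \<in> vecs F \<longrightarrow> x \<in> vecs F)"
proof (intro exI conjI allI impI)
  let ?x = "\<chi> k. det (\<chi> i j. if j = k then b $ i else A $ i $ j) / det A"
  show "A *v ?x = b" using cramer[OF assms, of ?x b] by simp
  fix F assume F: "real_subfield F \<and> (\<forall>i j. A $ i $ j \<in> F) \<and> b \<in> vecs F"
  then show "?x \<in> vecs F"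
    unfolding vecs_def by (auto intro!: subfield_divide subfield_det)
qed

lemma frame_solve:
  assumes "frame p w K"
  shows "\<exists>n. (\<forall>s\<in>K. n \<bullet> (p s - p w) = b s) \<and>
    (\<forall>F. real_subfield F \<and> p ` insert w K \<subseteq> vecs F \<and> b ` K \<subseteq> F \<longrightarrow> n \<in> vecs F)"
proof -
  obtain \<sigma> where \<sigma>: "bij_betw \<sigma> UNIV K" "det (\<chi> i. p (\<sigma> i) - p w) \<noteq> 0"
    using assms unfolding frame_def by blast
  let ?A = "\<chi> i. p (\<sigma> i) - p w"
  obtain n where n: "?A *v n = (\<chi> i. b (\<sigma> i))" "\<And>F. real_subfield F \<Longrightarrow> \<forall>i j. ?A $ i $ j \<in> F \<Longrightarrow>
      (\<chi> i. b (\<sigma> i)) \<in> vecs F \<Longrightarrow> n \<in> vecs F"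
    using cramer_subfield[OF \<sigma>(2), of "\<chi> i. b (\<sigma> i)"] by blast
  show ?thesis
  proof (intro exI conjI ballI allI impI)
    fix s assume "s \<in> K"
    then obtain i where i: "s = \<sigma> i" using \<sigma>(1) unfolding bij_betw_def by blast
    have "(?A *v n) $ i = b (\<sigma> i)" using n(1) by simp
    then show "n \<bullet> (p s - p w) = b s"
      by (simp add: matrix_vector_mul_component i inner_commute)
  next
    fix F assume F: "real_subfield F \<and> p ` insert w K \<subseteq> vecs F \<and> b ` K \<subseteq> F"
    have "\<sigma> i \<in> K" for i using \<sigma>(1) unfolding bij_betw_def by auto
    then have "p (\<sigma> i) - p w \<in> vecs F" "b (\<sigma> i) \<in> F" for i using F by (auto intro!: vecs_diff)
    then show "n \<in> vecs F" using F by (intro n(2)) (auto simp: vecs_def)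
  qed
qed

lemma frame_orthogonal_zero:
  assumes "frame p w K" "\<And>s. s \<in> K \<Longrightarrow> m \<bullet> (p s - p w) = 0"
  shows "m = 0"
proof -
  obtain \<sigma> where \<sigma>: "bij_betw \<sigma> UNIV K" "det (\<chi> i. p (\<sigma> i) - p w) \<noteq> 0"
    using assms unfolding frame_def by blast
  let ?A = "\<chi> i. p (\<sigma> i) - p w"
  have "\<sigma> i \<in> K" for i using \<sigma>(1) unfolding bij_betw_def by auto
  then have "(p (\<sigma> i) - p w) \<bullet> m = 0" for i
    using assms(2)[of "\<sigma> i"] by (simp only: inner_commute[of m])
  then have "?A *v m = 0" unfolding vec_eq_iff matrix_vector_mul_component by simp
  moreover have "?A *v 0 = 0" by simp
  ultimately show ?thesis using cramer[OF \<sigma>(2), of m 0] cramer[OF \<sigma>(2), of 0 0] by simp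
qed

lemma frame_coordinates:
  assumes "frame p w K"
  shows "\<exists>c. x = (\<Sum>s\<in>K. c s *\<^sub>R (p s - p w)) \<and>
    (\<forall>F. real_subfield F \<and> p ` insert w K \<subseteq> vecs F \<and> x \<in> vecs F \<longrightarrow> c ` K \<subseteq> F)"
proof -
  obtain \<sigma> where \<sigma>: "bij_betw \<sigma> UNIV K" "det (\<chi> i. p (\<sigma> i) - p w) \<noteq> 0"
    using assms unfolding frame_def by blast
  let ?A = "\<chi> i. p (\<sigma> i) - p w"
  have "det (transpose ?A) \<noteq> 0" using \<sigma>(2) by (simp add: det_transpose)
  from cramer_subfield[OF this, of x] obtain u where u: "transpose ?A *v u = x"
    "\<And>F. real_subfield F \<Longrightarrow> \<forall>i j. transpose ?A $ i $ j \<in> F \<Longrightarrow> x \<in> vecs F \<Longrightarrow> u \<in> vecs F"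
    by blast
  have \<sigma>K: "\<sigma> i \<in> K" for i using \<sigma>(1) unfolding bij_betw_def by auto
  have inv: "the_inv_into UNIV \<sigma> (\<sigma> i) = i" for i
    using \<sigma>(1) by (auto simp: bij_betw_def the_inv_into_f_f)
  let ?c = "\<lambda>s. u $ (the_inv_into UNIV \<sigma> s)"
  show ?thesis
  proof (intro exI conjI allI impI)
    have "x = (\<Sum>i\<in>UNIV. u $ i *\<^sub>R (p (\<sigma> i) - p w))"
      unfolding u(1)[symmetric]
      by (auto simp: vec_eq_iff matrix_vector_mult_def transpose_def mult.commute)
    also have "\<dots> = (\<Sum>i\<in>UNIV. ?c (\<sigma> i) *\<^sub>R (p (\<sigma> i) - p w))" by (simp add: inv)
    also have "\<dots> = (\<Sum>s\<in>K. ?c s *\<^sub>R (p s - p w))"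
      by (rule sum.reindex_bij_betw[OF \<sigma>(1)])
    finally show "x = (\<Sum>s\<in>K. ?c s *\<^sub>R (p s - p w))" .
  next
    fix F assume F: "real_subfield F \<and> p ` insert w K \<subseteq> vecs F \<and> x \<in> vecs F"
    then have "p (\<sigma> i) - p w \<in> vecs F" for i using \<sigma>K by (auto intro!: vecs_diff)
    then have "u \<in> vecs F" using F by (intro u(2)) (auto simp: vecs_def transpose_def)
    then show "?c ` K \<subseteq> F" by (auto simp: vecs_def)
  qed
qed

lemma frame_point_unique:
  assumes "frame p w K" "\<And>s. s \<in> insert w K \<Longrightarrow> dist y (p s) = dist z (p s)"
  shows "y = z"
proof -
  have "(y - z) \<bullet> (p s - p w) = 0" if "s \<in> K" for s
    using assms(2)[of s] assms(2)[of w] that by (simp add: equidistant_iff inner_diff_right)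
  then show ?thesis using frame_orthogonal_zero[OF assms(1)] by fastforce
qed

text \<open>The d points over \<open>K\<close> span a hyperplane, and \<open>z'\<close> is the
  mirror image of \<open>z\<close> in it. Normalizing the normal vector by
  \<open>n \<bullet> (p s - p w) = 1\<close> on \<open>K\<close> makes it the solution of a linear
  system over \<open>F\<close>, so the reflection formula stays in \<open>F\<close>.\<close>

lemma frame_equidistant:
  fixes p :: "'a \<Rightarrow> real ^ 'd::finite"
  assumes fr: "frame p w K" and F: "real_subfield F" "p ` insert w K \<subseteq> vecs F" "z \<in> vecs F"
  shows "\<exists>z'\<in>vecs F. \<forall>y. (\<forall>s\<in>K. dist y (p s) = dist z (p s)) \<longrightarrow> y = z \<or> y = z'"
proof -
  obtain n where n: "\<And>s. s \<in> K \<Longrightarrow> n \<bullet> (p s - p w) = 1" "n \<in> vecs F"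
    using frame_solve[OF fr, of "\<lambda>_. 1"] F subfield_rats[OF F(1), of 1] by fastforce
  obtain s0 where s0: "s0 \<in> K" using frame_nonempty[OF fr] by blast
  have nn: "n \<bullet> n \<noteq> 0" using n(1)[OF s0] by auto
  define z' where "z' = z - ((1 + 1) * (n \<bullet> (z - p s0)) / (n \<bullet> n)) *\<^sub>R n"
  have "z' \<in> vecs F"
    unfolding z'_def using F n s0 subfield_rats[OF F(1) Rats_1]
    by (intro vecs_diff vecs_scaleR subfield_divide subfield_mult subfield_add vecs_inner) auto
  moreover have "y = z \<or> y = z'" if y: "\<forall>s\<in>K. dist y (p s) = dist z (p s)" for y
  proof -
    \<comment> \<open>Equidistance from all of \<open>K\<close> makes the product of
      \<open>y - z\<close> with \<open>p s - p w\<close> independent of \<open>s\<close>, so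
      \<open>y - z\<close> is a multiple of \<open>n\<close>; the distance to one point
      \<open>p s0\<close> leaves two multiples.\<close>
    define \<mu> where "\<mu> = (y - z) \<bullet> (p s0 - p w)"
    have "(y - z) \<bullet> (p s - p w) = \<mu>" if "s \<in> K" for s
    proof -
      have "2 * ((y - z) \<bullet> p s) = 2 * ((y - z) \<bullet> p s0)" using y that s0 unfolding equidistant_iff by metis
      then show ?thesis unfolding \<mu>_def inner_diff_right by simp
    qed
    then have "(y - z - \<mu> *\<^sub>R n) \<bullet> (p s - p w) = 0" if "s \<in> K" for s
      using that n(1) by (simp add: inner_diff_left)
    then have m: "y - z - \<mu> *\<^sub>R n = 0" by (rule frame_orthogonal_zero[OF fr])
    then have yz: "y = z + \<mu> *\<^sub>R n" by (simp add: algebra_simps)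
    have "dist y (p s0) = dist z (p s0)" using y s0 by blast
    then have "\<mu> * (2 * (n \<bullet> (z - p s0)) + \<mu> * (n \<bullet> n)) = 0"
      unfolding dist_eq_dist_iff_inner yz by (simp add: inner_simps inner_commute algebra_simps)
    then have "\<mu> = 0 \<or> 2 * (n \<bullet> (z - p s0)) + \<mu> * (n \<bullet> n) = 0"
      by (simp only: mult_eq_0_iff)
    then have "\<mu> = 0 \<or> \<mu> * (n \<bullet> n) = - (2 * (n \<bullet> (z - p s0)))" by auto
    then have "\<mu> = 0 \<or> \<mu> = - (2 * (n \<bullet> (z - p s0))) / (n \<bullet> n)"
      using nn by (metis nonzero_eq_divide_eq)
    then show ?thesis unfolding yz z'_def by auto
  qed
  ultimately show ?thesis by blast
qed

definition same_dist :: "('a \<times> 'a) set \<Rightarrow> ('a \<Rightarrow> real ^ 'd) \<Rightarrow> ('a \<Rightarrow> real ^ 'd) \<Rightarrow> bool" where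
  "same_dist E p q \<longleftrightarrow> (\<forall>(x, y)\<in>E. dist (p x) (p y) = dist (q x) (q y))"

lemma same_distD: "same_dist E p q \<Longrightarrow> (x, y) \<in> E \<Longrightarrow> dist (p x) (p y) = dist (q x) (q y)"
  unfolding same_dist_def by blast

lemma same_dist_mono: "same_dist E p q \<Longrightarrow> E' \<subseteq> E \<Longrightarrow> same_dist E' p q"
  unfolding same_dist_def by blast

lemma same_dist_Un: "same_dist (E \<union> E') p q \<longleftrightarrow> same_dist E p q \<and> same_dist E' p q"
  unfolding same_dist_def by blast

text \<open>Equal distances give equal Gram matrices of the difference vectors. Reading coordinates
  in the frame of \<open>p\<close> and reusing them in that of \<open>q\<close> is therefore an
  isometry, and those coordinates lie in every field containing the data.\<close>

lemma frame_isometry: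
  fixes p q :: "'a \<Rightarrow> real ^ 'd::finite"
  assumes fr: "frame p w K"
    and pq: "same_dist (insert w K \<times> insert w K) p q"
  obtains T where "\<And>x y. dist (T x) (T y) = dist x y" "surj T" "\<And>s. s \<in> insert w K \<Longrightarrow> T (p s) = q s"
    "\<And>F. real_subfield F \<Longrightarrow> p ` insert w K \<subseteq> vecs F \<Longrightarrow> q ` insert w K \<subseteq> vecs F \<Longrightarrow> T ` vecs F \<subseteq> vecs F"
proof -
  have d: "dist (p s) (p t) = dist (q s) (q t)" if "s \<in> insert w K" "t \<in> insert w K" for s t
    using same_distD[OF pq] that by blast
  have fin: "finite K" by (rule frame_finite[OF fr])
  define e where "e s = p s - p w" for s
  define f where "f s = q s - q w" for s
  have inner: "e s \<bullet> e t = f s \<bullet> f t" if "s \<in> K" "t \<in> K" for s t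
    using d[of s t] d[of s w] d[of t w] that unfolding e_def f_def dist_eq_dist_iff_inner
    by (simp add: inner_simps inner_commute)
  have nrm: "norm (\<Sum>s\<in>K. g s *\<^sub>R e s) = norm (\<Sum>s\<in>K. g s *\<^sub>R f s)" for g
  proof -
    have "(\<Sum>s\<in>K. g s *\<^sub>R e s) \<bullet> (\<Sum>s\<in>K. g s *\<^sub>R e s) = (\<Sum>s\<in>K. g s *\<^sub>R f s) \<bullet> (\<Sum>s\<in>K. g s *\<^sub>R f s)"
      unfolding inner_sum_left inner_sum_right by (intro sum.cong refl) (simp add: inner)
    then show ?thesis by (simp add: norm_eq)
  qed
  have "\<forall>x. \<exists>c. x = (\<Sum>s\<in>K. c s *\<^sub>R e s) \<and>
    (\<forall>F. real_subfield F \<and> p ` insert w K \<subseteq> vecs F \<and> x \<in> vecs F \<longrightarrow> c ` K \<subseteq> F)"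
    using frame_coordinates[OF fr] unfolding e_def by blast
  then obtain c where c: "\<And>x. x = (\<Sum>s\<in>K. c x s *\<^sub>R e s)"
    "\<And>x F. real_subfield F \<Longrightarrow> p ` insert w K \<subseteq> vecs F \<Longrightarrow> x \<in> vecs F \<Longrightarrow> c x ` K \<subseteq> F"
    by metis
  define T where "T x = q w + (\<Sum>s\<in>K. c (x - p w) s *\<^sub>R f s)" for x
  have iso: "dist (T x) (T y) = dist x y" for x y
  proof -
    have "norm (x - y) = norm (\<Sum>s\<in>K. (c (x - p w) s - c (y - p w) s) *\<^sub>R e s)"
      using c(1)[of "x - p w"] c(1)[of "y - p w"] unfolding scaleR_diff_left sum_subtractf by simp
    also have "\<dots> = norm (T x - T y)"
      unfolding nrm unfolding T_def scaleR_diff_left sum_subtractf by simp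
    finally show ?thesis by (simp add: dist_norm)
  qed
  have Tp: "T (p s) = q s" if s: "s \<in> insert w K" for s
  proof -
    \<comment> \<open>The coordinates of \<open>p s - p w\<close> in the frame, with the zero vector
      covering \<open>s = w\<close>.\<close>
    define \<delta> where "\<delta> t = (if t = s \<and> s \<in> K \<and> s \<noteq> w then 1 else 0 :: real)" for t
    have \<delta>: "(\<Sum>t\<in>K. \<delta> t *\<^sub>R g t) = (if s \<in> K \<and> s \<noteq> w then g s else 0)" for g :: "'a \<Rightarrow> real ^ 'd"
    proof -
      have "(\<Sum>t\<in>K. \<delta> t *\<^sub>R g t) = (\<Sum>t\<in>K. if t = s then (if s \<in> K \<and> s \<noteq> w then g s else 0) else 0)"
        unfolding \<delta>_def by (intro sum.cong) auto
      then show ?thesis using fin by auto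
    qed
    have "norm (T (p s) - q s) = norm (\<Sum>t\<in>K. (c (p s - p w) t - \<delta> t) *\<^sub>R f t)"
      using s \<delta>[of f] unfolding scaleR_diff_left sum_subtractf T_def f_def
      by (auto simp: algebra_simps split: if_splits)
    also have "\<dots> = norm (\<Sum>t\<in>K. (c (p s - p w) t - \<delta> t) *\<^sub>R e t)" by (rule nrm[symmetric])
    also have "(\<Sum>t\<in>K. (c (p s - p w) t - \<delta> t) *\<^sub>R e t) = 0"
      using s \<delta>[of e] c(1)[of "p s - p w", symmetric] unfolding scaleR_diff_left sum_subtractf
      by (auto simp: e_def split: if_splits)
    finally show ?thesis by simp
  qed
  have "surj T"
  proof -
    have "orthogonal_transformation (\<lambda>x. T x - T 0)"
      unfolding orthogonal_transformation_isometry using iso by (simp add: dist_norm)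
    then have "surj (\<lambda>x. T x - T 0)" by (rule orthogonal_transformation_surj)
    then have "\<exists>x. y - T 0 = T x - T 0" for y by (rule surjD)
    then show ?thesis by (simp add: surj_def)
  qed
  moreover have "T ` vecs F \<subseteq> vecs F"
    if F: "real_subfield F" "p ` insert w K \<subseteq> vecs F" "q ` insert w K \<subseteq> vecs F" for F
  proof
    fix y assume "y \<in> T ` vecs F"
    then obtain x where x: "x \<in> vecs F" "y = T x" by blast
    have "x - p w \<in> vecs F" using x F by (auto intro: vecs_diff)
    from c(2)[OF F(1,2) this] have "c (x - p w) s \<in> F" if "s \<in> K" for s using that by blast
    then show "y \<in> vecs F"
      unfolding x(2) T_def f_def using F
      by (intro vecs_add[OF F(1)] vecs_sum[OF F(1)] vecs_scaleR[OF F(1)] vecs_diff[OF F(1)]) auto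
  qed
  ultimately show ?thesis using that[of T] iso Tp by presburger
qed

section \<open>A vertex that is generic over the others\<close>

text \<open>By \<open>equidistant_iff\<close> the hypothesis is a linear relation between the
  coordinates of \<open>p v\<close> with coefficients rational over \<open>V\<close>; independence
  kills the coefficients, which are multiples of those of \<open>y - z\<close>.\<close>

lemma generic_equidistant_unique:
  fixes p :: "'a \<Rightarrow> real ^ 'd::finite"
  assumes gen: "generic_on (insert v V) p" and v: "v \<notin> V"
    and yz: "y \<in> Qvecs V p" "z \<in> Qvecs V p" and d: "dist y (p v) = dist z (p v)"
  shows "y = z"
proof -
  let ?F = "qfield (V \<times> (UNIV :: 'd set)) (coords p)"
  have F: "real_subfield ?F" by (rule real_subfield_qfield)
  let ?J = "{v} \<times> (UNIV :: 'd set)"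
  have c0: "y \<bullet> y - z \<bullet> z \<in> ?F" using yz by (intro subfield_diff[OF F] vecs_inner[OF F])
  have c: "- (1 + 1) * (y - z) $ i \<in> ?F" for i
  proof (rule subfield_mult[OF F])
    show "- (1 + 1) \<in> ?F" by (intro subfield_rats[OF F]) simp
    show "(y - z) $ i \<in> ?F" using vecs_diff[OF F yz] unfolding vecs_def by blast
  qed
  have "(\<Sum>j\<in>?J. - (1 + 1) * (y - z) $ snd j * coords p j) = (\<Sum>i\<in>UNIV. - 2 * ((y - z) $ i * p v $ i))"
    by (rule sum.reindex_bij_witness[of _ "\<lambda>i. (v, i)" snd]) (auto simp: coords_def algebra_simps)
  also have "\<dots> = - 2 * ((y - z) \<bullet> p v)"
    unfolding inner_vec_def sum_distrib_left by simp
  finally have "y \<bullet> y - z \<bullet> z + (\<Sum>j\<in>?J. - (1 + 1) * (y - z) $ snd j * coords p j) = 0"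
    using d unfolding equidistant_iff by simp
  moreover have "algebraically_independent_rat (V \<times> UNIV \<union> ?J) (coords p)"
    using gen unfolding generic_on_def by (rule algebraically_independent_rat_mono) auto
  ultimately have "- (1 + 1) * (y - z) $ snd j = 0" if "j \<in> ?J" for j
    using that v c c0
    by (intro generic_linear_independent[where W = "V \<times> UNIV" and J = ?J and a = "coords p" and
      c = "\<lambda>j. - (1 + 1) * (y - z) $ snd j" and ?c0.0 = "y \<bullet> y - z \<bullet> z"]) auto
  from this[of "(v, _)"] have "y $ i = z $ i" for i by simp
  then show ?thesis by (simp add: vec_eq_iff)
qed

lemma generic_center_descends:
  fixes p :: "'a \<Rightarrow> real ^ 'd::finite"
  assumes gen: "generic_on (insert v V) p" and v: "v \<notin> V"
    and y: "y \<in> Qvecs V p" and U: "U \<subseteq> insert v V"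
    and d: "(dist y (p v))\<^sup>2 \<in> qfield (U \<times> UNIV) (coords p)"
  shows "y \<in> Qvecs (U - {v}) p"
proof -
  let ?J = "{v} \<times> (UNIV :: 'd set)"
  have "(\<Sum>j\<in>?J. (y $ snd j - coords p j)\<^sup>2) = (\<Sum>i\<in>UNIV. (y $ i - p v $ i)\<^sup>2)"
    by (rule sum.reindex_bij_witness[of _ "\<lambda>i. (v, i)" snd]) (auto simp: coords_def)
  also have "\<dots> = (dist y (p v))\<^sup>2"
    unfolding dist_norm power2_norm_eq_inner inner_vec_def by (simp add: power2_eq_square)
  finally have s: "(\<Sum>j\<in>?J. (y $ snd j - coords p j)\<^sup>2) \<in> qfield (U \<times> UNIV) (coords p)"
    using d by simp
  have g: "algebraically_independent_rat (V \<times> UNIV \<union> ?J) (coords p)"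
    using gen unfolding generic_on_def by (rule algebraically_independent_rat_mono) auto
  have UJ: "U \<times> UNIV - ?J = (U - {v}) \<times> UNIV" by auto
  have "y $ snd j \<in> qfield (U \<times> UNIV - ?J) (coords p)" if "j \<in> ?J" for j
    using y v U
    by (intro qfield_sphere_center[OF g _ _ _ _ s that]) (auto simp: vecs_def)
  from this[of "(v, _)"] show ?thesis unfolding vecs_def UJ by simp
qed

section \<open>Chordal skeletons\<close>

text \<open>\<open>E\<close> consists of ordered pairs with loops, so that a clique is simply
  \<open>X \<times> X \<subseteq> E\<close>. The construction order is a reversed perfect
  elimination order, and the d + 1 initial vertices provide a full affine frame.\<close>

inductive chordal :: "nat \<Rightarrow> 'a set \<Rightarrow> ('a \<times> 'a) set \<Rightarrow> bool" for d where
  chordal_base: "finite V \<Longrightarrow> card V = Suc d \<Longrightarrow> chordal d V (V \<times> V)"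
| chordal_step: "chordal d V E \<Longrightarrow> v \<notin> V \<Longrightarrow> K \<subseteq> V \<Longrightarrow> d \<le> card K \<Longrightarrow> K \<times> K \<subseteq> E \<Longrightarrow>
    chordal d (insert v V) (E \<union> insert v K \<times> insert v K)"

lemma chordal_finite: "chordal d V E \<Longrightarrow> finite V"
  by (induction rule: chordal.induct) auto

lemma chordal_subset: "chordal d V E \<Longrightarrow> E \<subseteq> V \<times> V"
  by (induction rule: chordal.induct) auto

lemma chordal_refl: "chordal d V E \<Longrightarrow> v \<in> V \<Longrightarrow> (v, v) \<in> E"
  by (induction rule: chordal.induct) auto

lemma chordal_sym: "chordal d V E \<Longrightarrow> (u, v) \<in> E \<Longrightarrow> (v, u) \<in> E"
  by (induction rule: chordal.induct) auto

lemma chordal_clique: "chordal d V E \<Longrightarrow> \<exists>C\<subseteq>V. card C = Suc d \<and> C \<times> C \<subseteq> E"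
  by (induction rule: chordal.induct) blast+

lemma clique_restrict:
  assumes "E \<subseteq> V \<times> V" "K \<times> K \<subseteq> E" "v \<notin> X" "X \<times> X \<subseteq> E \<union> insert v K \<times> insert v K"
  shows "X \<times> X \<subseteq> E"
  using assms by blast

lemma clique_nbhd:
  assumes "E \<subseteq> V \<times> V" "v \<notin> V" "v \<in> X" "X \<times> X \<subseteq> E \<union> insert v K \<times> insert v K"
  shows "X - {v} \<subseteq> K"
  using assms by blast

text \<open>Supplies the auxiliary vertex that completes d known points to a frame. If
  \<open>X\<close> contains the last vertex \<open>v\<close>, the other d - 1 vertices of
  \<open>X\<close> lie in \<open>K\<close>, which has a vertex to spare.\<close>

lemma chordal_extend_clique:
  assumes "chordal d V E" "X \<subseteq> V" "X \<times> X \<subseteq> E" "card X = d"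
  shows "\<exists>w\<in>V - X. insert w X \<times> insert w X \<subseteq> E"
  using assms
proof (induction arbitrary: X rule: chordal.induct)
  case (chordal_base V)
  then have "X \<noteq> V" by auto
  then show ?case using chordal_base by blast
next
  case (chordal_step V E v K)
  note EV = chordal_subset[OF chordal_step.hyps(1)]
  show ?case
  proof (cases "v \<in> X")
    case False
    have "X \<times> X \<subseteq> E" using clique_restrict[OF EV chordal_step.hyps(5) False] chordal_step.prems by blast
    moreover have "X \<subseteq> V" using chordal_step.prems(1) False by blast
    ultimately show ?thesis using chordal_step.IH[of X] chordal_step.prems(3) by blast
  next
    case True
    have XK: "X - {v} \<subseteq> K"
      using clique_nbhd[OF EV chordal_step.hyps(2) True] chordal_step.prems by blast
    have "finite X" using chordal_step.prems(1) chordal_finite[OF chordal_step.hyps(1)]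
      by (meson finite_insert finite_subset)
    then have "card (X - {v}) < card K"
      using True chordal_step.hyps(4) chordal_step.prems(3) by (metis card_Diff1_less less_le_trans)
    then have "X - {v} \<noteq> K" by auto
    then obtain w where "w \<in> K" "w \<notin> X" using XK chordal_step.hyps(2,3) by blast
    then show ?thesis using XK chordal_step.hyps(3) by blast
  qed
qed

text \<open>Pulled back by the isometry of the frame, \<open>q b\<close> has the same distances from
  the d points over \<open>K\<close> as \<open>p b\<close>; it is \<open>p b\<close> or its mirror
  image, and the isometry carries both to points over \<open>F\<close>.\<close>

lemma frame_rational_extension:
  fixes p q :: "'a \<Rightarrow> real ^ 'd::finite"
  assumes fr: "frame p a K" and pq: "same_dist (insert a K \<times> insert a K) p q"
    and F: "real_subfield F" "p ` insert a K \<subseteq> vecs F" "q ` insert a K \<subseteq> vecs F" "p b \<in> vecs F"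
    and b: "\<And>s. s \<in> K \<Longrightarrow> dist (p b) (p s) = dist (q b) (q s)"
  shows "q b \<in> vecs F"
proof -
  obtain T where T: "\<And>x y. dist (T x) (T y) = dist x y" "surj T"
    "\<And>s. s \<in> insert a K \<Longrightarrow> T (p s) = q s"
    "\<And>F. real_subfield F \<Longrightarrow> p ` insert a K \<subseteq> vecs F \<Longrightarrow> q ` insert a K \<subseteq> vecs F \<Longrightarrow> T ` vecs F \<subseteq> vecs F"
    by (rule frame_isometry[OF fr pq]) (rule that; blast)
  obtain y where y: "q b = T y" using T(2) by (metis surjD)
  obtain z where z: "z \<in> vecs F" "\<And>y. \<forall>s\<in>K. dist y (p s) = dist (p b) (p s) \<Longrightarrow> y = p b \<or> y = z"
    using frame_equidistant[OF fr F(1,2,4)] by blast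
  have "dist y (p s) = dist (p b) (p s)" if "s \<in> K" for s
    using T(1)[of y "p s"] T(3)[of s] b[OF that] that by (simp add: y)
  then have "y = p b \<or> y = z" using z(2) by blast
  then have "y \<in> vecs F" using z(1) F(4) by blast
  then show ?thesis using T(4)[OF F(1-3)] y by blast
qed

text \<open>Every attached vertex is known up to a reflection from d of its neighbours, so
  rationality spreads from a single clique. That clique is arbitrary because it need not be the one
  the construction starts with.\<close>

lemma chordal_rational:
  fixes p q :: "'a \<Rightarrow> real ^ 'd::finite"
  assumes "chordal CARD('d) V E" "generic_on V p" "same_dist E p q" "real_subfield F" "p ` V \<subseteq> vecs F"
    "C \<subseteq> V" "card C = Suc CARD('d)" "C \<times> C \<subseteq> E" "q ` C \<subseteq> vecs F"
  shows "q ` V \<subseteq> vecs F"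
  using assms
proof (induction arbitrary: C rule: chordal.induct)
  case (chordal_base V)
  then have "C = V" by (metis card_subset_eq)
  then show ?case using chordal_base by blast
next
  case (chordal_step V E v K)
  note EV = chordal_subset[OF chordal_step.hyps(1)]
  have gen: "generic_on V p" using chordal_step.prems(1) by (rule generic_on_mono) blast
  have sE: "same_dist E p q" using chordal_step.prems(2) by (rule same_dist_mono) blast
  have sK: "same_dist (insert v K \<times> insert v K) p q" using chordal_step.prems(2) by (rule same_dist_mono) blast
  have pV: "p ` V \<subseteq> vecs F" using chordal_step.prems(4) by blast
  show ?case
  proof (cases "v \<in> C")
    case False
    have C: "C \<subseteq> V" using False chordal_step.prems(5) by blast
    have "C \<times> C \<subseteq> E" using clique_restrict[OF EV chordal_step.hyps(5) False chordal_step.prems(7)] .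
    then have qV: "q ` V \<subseteq> vecs F"
      using chordal_step.IH[OF gen sE chordal_step.prems(3) pV C] chordal_step.prems by blast
    obtain K0 where K0: "K0 \<subseteq> K" "card K0 = CARD('d)"
      using chordal_step.hyps(4) by (metis obtain_subset_with_card_n)
    have "K0 \<times> K0 \<subseteq> E" "K0 \<subseteq> V" using K0 chordal_step.hyps by blast+
    then obtain w where w: "w \<in> V - K0" "insert w K0 \<times> insert w K0 \<subseteq> E"
      using chordal_extend_clique[OF chordal_step.hyps(1) _ _ K0(2)] by blast
    have fr: "frame p w K0" using generic_frame[OF gen] w K0(2) \<open>K0 \<subseteq> V\<close> by blast
    have wK: "insert w K0 \<subseteq> V" using w \<open>K0 \<subseteq> V\<close> by blast
    have "q v \<in> vecs F"
    proof (rule frame_rational_extension[OF fr same_dist_mono[OF sE w(2)] chordal_step.prems(3)])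
      show "p ` insert w K0 \<subseteq> vecs F" "q ` insert w K0 \<subseteq> vecs F" "p v \<in> vecs F"
        using wK pV qV chordal_step.prems(4) by blast+
      show "dist (p v) (p s) = dist (q v) (q s)" if "s \<in> K0" for s
        using same_distD[OF sK] K0 that by blast
    qed
    then show ?thesis using qV by blast
  next
    case True
    let ?K = "C - {v}"
    have KK: "?K \<subseteq> K" by (rule clique_nbhd[OF EV chordal_step.hyps(2) True chordal_step.prems(7)])
    have KV: "?K \<subseteq> V" and KE: "?K \<times> ?K \<subseteq> E" using KK chordal_step.hyps by blast+
    have "finite C" using chordal_step.prems(6) by (simp add: card_ge_0_finite)
    then have cK: "card ?K = CARD('d)" using True chordal_step.prems(6) by simp
    \<comment> \<open>Exchange step: \<open>v\<close> cannot serve in the induction hypothesis, so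
      another common neighbour \<open>w\<close> of \<open>C - {v}\<close> takes its place;
      \<open>q w\<close> is rational by the frame on \<open>C\<close>.\<close>
    obtain w where w: "w \<in> V - ?K" "insert w ?K \<times> insert w ?K \<subseteq> E"
      using chordal_extend_clique[OF chordal_step.hyps(1) KV KE cK] by blast
    have ivC: "insert v ?K = C" using True by blast
    have fr: "frame p v ?K"
      using generic_frame[OF chordal_step.prems(1), of v ?K] cK KV by blast
    have qw: "q w \<in> vecs F"
    proof (rule frame_rational_extension[OF fr _ chordal_step.prems(3)])
      show "same_dist (insert v ?K \<times> insert v ?K) p q"
        unfolding ivC using chordal_step.prems(2,7) by (rule same_dist_mono)
      show "p ` insert v ?K \<subseteq> vecs F" "q ` insert v ?K \<subseteq> vecs F" "p w \<in> vecs F"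
        unfolding ivC using chordal_step.prems w(1) by blast+
      show "dist (p w) (p s) = dist (q w) (q s)" if "s \<in> ?K" for s
        using same_distD[OF sE] w(2) that by blast
    qed
    have "card (insert w ?K) = Suc CARD('d)" using w(1) cK \<open>finite C\<close> by simp
    moreover have "insert w ?K \<subseteq> V" "q ` insert w ?K \<subseteq> vecs F"
      using KV w(1) qw chordal_step.prems(8) by blast+
    ultimately have "q ` V \<subseteq> vecs F"
      using chordal_step.IH[OF gen sE chordal_step.prems(3) pV _ _ w(2)] by blast
    then show ?thesis using True chordal_step.prems(8) by blast
  qed
qed

lemma normalize_on_frame:
  fixes p q :: "'a \<Rightarrow> real ^ 'd::finite"
  assumes fr: "frame p a K" and pq: "same_dist (insert a K \<times> insert a K) p q"
  obtains q' where "\<And>x y. dist (q' x) (q' y) = dist (q x) (q y)" "\<And>s. s \<in> insert a K \<Longrightarrow> q' s = p s"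
proof -
  obtain T where T: "\<And>x y. dist (T x) (T y) = dist x y" "surj T"
    "\<And>s. s \<in> insert a K \<Longrightarrow> T (p s) = q s"
    "\<And>F. real_subfield F \<Longrightarrow> p ` insert a K \<subseteq> vecs F \<Longrightarrow> q ` insert a K \<subseteq> vecs F \<Longrightarrow> T ` vecs F \<subseteq> vecs F"
    by (rule frame_isometry[OF fr pq]) (rule that; blast)
  have "inj T" using T(1) by (metis dist_eq_0_iff injI)
  show thesis
  proof (rule that[of "\<lambda>x. inv T (q x)"])
    fix x y show "dist (inv T (q x)) (inv T (q y)) = dist (q x) (q y)"
      using T(1)[of "inv T (q x)" "inv T (q y)"] by (simp add: surj_f_inv_f[OF T(2)])
  next
    fix s assume "s \<in> insert a K"
    then show "inv T (q s) = p s" using T(3) \<open>inj T\<close> by (metis inv_f_f)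
  qed
qed

text \<open>The field obtained does not involve \<open>p v\<close>, although \<open>q'\<close> is
  fixed at \<open>v\<close>. The reason is that a vertex \<open>w\<close> of \<open>V\<close>
  completing \<open>K\<close> goes to \<open>p w\<close> or to its mirror image in the hyperplane
  through the points of \<open>K\<close>, and neither point depends on \<open>p v\<close>;
  \<open>chordal_rational\<close> does the rest.\<close>

lemma chordal_normalize:
  fixes p q :: "'a \<Rightarrow> real ^ 'd::finite"
  assumes ch: "chordal CARD('d) V E" and v: "v \<notin> V" and K: "K \<subseteq> V" "K \<times> K \<subseteq> E" "card K = CARD('d)"
    and gen: "generic_on (insert v V) p" and pq: "same_dist (E \<union> insert v K \<times> insert v K) p q"
  obtains q' where "\<And>x y. dist (q' x) (q' y) = dist (q x) (q y)"
    "\<And>s. s \<in> insert v K \<Longrightarrow> q' s = p s" "q' ` V \<subseteq> Qvecs V p"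
proof -
  let ?F = "qfield (V \<times> UNIV) (coords p)"
  have fr: "frame p v K" using generic_frame[OF gen, of v K] v K by blast
  have "same_dist (insert v K \<times> insert v K) p q" using pq by (rule same_dist_mono) blast
  from normalize_on_frame[OF fr this] obtain q'
    where q': "\<And>x y. dist (q' x) (q' y) = dist (q x) (q y)" "\<And>s. s \<in> insert v K \<Longrightarrow> q' s = p s"
    by blast
  have genV: "generic_on V p" using gen by (rule generic_on_mono) blast
  have pq': "same_dist E p q'" using pq unfolding same_dist_def q'(1) by blast
  obtain w where w: "w \<in> V - K" "insert w K \<times> insert w K \<subseteq> E"
    using chordal_extend_clique[OF ch K] by blast
  have fw: "frame p w K" using generic_frame[OF genV, of w K] w K by blast
  have pF: "p ` V \<subseteq> vecs ?F" by (rule points_in_Qvecs)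
  have "q' w \<in> vecs ?F"
  proof -
    have "dist (q' w) (p s) = dist (p w) (p s)" if "s \<in> K" for s
    proof -
      have "dist (p w) (p s) = dist (q' w) (q' s)" using same_distD[OF pq'] w that by blast
      then show ?thesis using q'(2)[of s] that by simp
    qed
    moreover have "p ` insert w K \<subseteq> vecs ?F" "p w \<in> vecs ?F" using pF w(1) K(1) by blast+
    from frame_equidistant[OF fw real_subfield_qfield this] obtain z where z: "z \<in> vecs ?F"
      "\<And>y. \<forall>s\<in>K. dist y (p s) = dist (p w) (p s) \<Longrightarrow> y = p w \<or> y = z"
      by blast
    ultimately have "q' w = p w \<or> q' w = z" by blast
    then show ?thesis using z(1) \<open>p w \<in> vecs ?F\<close> by auto
  qed
  moreover have "q' s \<in> vecs ?F" if "s \<in> K" for s using q'(2)[of s] that pF K(1) by auto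
  ultimately have "q' ` insert w K \<subseteq> vecs ?F" by blast
  moreover have "finite K" using K(3) by (simp add: card_ge_0_finite)
  then have "card (insert w K) = Suc CARD('d)" using w(1) K(3) by simp
  ultimately have "q' ` V \<subseteq> vecs ?F"
    using chordal_rational[OF ch genV pq' real_subfield_qfield pF _ _ w(2)] w(1) K(1) by blast
  then show thesis using that q' by blast
qed

lemma subset_with_card_containing:
  assumes "n \<le> card K" "s \<in> K" "0 < n"
  obtains L where "s \<in> L" "L \<subseteq> K" "card L = n"
proof -
  have fK: "finite K" using assms by (metis card.infinite not_le)
  then have "n - 1 \<le> card (K - {s})" using assms by simp
  then obtain L where L: "L \<subseteq> K - {s}" "card L = n - 1" "finite L"
    by (metis obtain_subset_with_card_n)
  then have "card (insert s L) = n" using assms(3) by (subst card_insert_disjoint) auto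
  then show thesis using that[of "insert s L"] L assms(2) by blast
qed

text \<open>Normalization fixes exactly d neighbours of \<open>v\<close>, so each \<open>s\<close>
  gets its own d-subset \<open>L\<close> of \<open>K\<close> containing it.\<close>

lemma chordal_new_edge:
  fixes p q :: "'a \<Rightarrow> real ^ 'd::finite"
  assumes ch: "chordal CARD('d) V E" and v: "v \<notin> V" and K: "K \<subseteq> V" "K \<times> K \<subseteq> E" "CARD('d) \<le> card K"
    and gen: "generic_on (insert v V) p" and pq: "same_dist (E \<union> insert v K \<times> insert v K) p q"
    and u: "u \<in> V" "dist (p u) (p v) = dist (q u) (q v)" and s: "s \<in> K"
  shows "dist (p u) (p s) = dist (q u) (q s)"
proof -
  obtain L where L: "s \<in> L" "L \<subseteq> K" "card L = CARD('d)"
    by (rule subset_with_card_containing[OF K(3) s zero_less_card_finite])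
  have "L \<subseteq> V" "L \<times> L \<subseteq> E" using L(2) K by blast+
  moreover have "same_dist (E \<union> insert v L \<times> insert v L) p q"
    using pq L(2) by (intro same_dist_mono[OF pq]) blast
  ultimately obtain q' where q': "\<And>x y. dist (q' x) (q' y) = dist (q x) (q y)"
    "\<And>s. s \<in> insert v L \<Longrightarrow> q' s = p s" "q' ` V \<subseteq> Qvecs V p"
    using chordal_normalize[OF ch v _ _ L(3) gen] by blast
  have "q' u = p u"
  proof (rule generic_equidistant_unique[OF gen v])
    show "q' u \<in> Qvecs V p" "p u \<in> Qvecs V p" using q'(3) u(1) points_in_Qvecs[of p V] by blast+
    show "dist (q' u) (p v) = dist (p u) (p v)" using q'(1)[of u v] q'(2)[of v] u(2) by simp
  qed
  then show ?thesis using q'(1)[of u s] q'(2)[of s] L(1) by simp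
qed

section \<open>Forced pairs and the merging of skeletons\<close>

definition forces :: "'d::finite itself \<Rightarrow> 'a set \<Rightarrow> ('a \<times> 'a) set \<Rightarrow> ('a \<times> 'a) set \<Rightarrow> bool" where
  "forces _ V E E' \<longleftrightarrow> (\<forall>p q :: 'a \<Rightarrow> real ^ 'd. generic_on V p \<and> same_dist E p q \<longrightarrow> same_dist E' p q)"

lemma forces_mono: "forces D V E E' \<Longrightarrow> V \<subseteq> W \<Longrightarrow> E \<subseteq> F \<Longrightarrow> F' \<subseteq> E' \<Longrightarrow> forces D W F F'"
  unfolding forces_def using generic_on_mono same_dist_mono by blast

lemma forces_trans: "forces D V E E' \<Longrightarrow> forces D V E' E'' \<Longrightarrow> forces D V E E''"
  unfolding forces_def by blast

lemma forces_subset: "E' \<subseteq> E \<Longrightarrow> forces D V E E'"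
  unfolding forces_def using same_dist_mono by blast

lemma forces_Un: "forces D V E E' \<Longrightarrow> forces D V E E'' \<Longrightarrow> forces D V E (E' \<union> E'')"
  unfolding forces_def same_dist_Un by blast

text \<open>To stay chordal, \<open>v\<close> must have a clique as its neighbourhood among the
  earlier vertices. If \<open>U\<close> contains \<open>v\<close> and leaves its closed
  neighbourhood, the new neighbourhood is \<open>(U - {v}) \<union> K\<close>; this larger set is
  made a clique below \<open>v\<close> first, and its pairs are forced by
  \<open>chordal_new_edge\<close>.\<close>

lemma chordal_add_clique:
  assumes "chordal CARD('d::finite) V E" "U \<subseteq> V"
  shows "\<exists>E'. chordal CARD('d) V E' \<and> E \<union> U \<times> U \<subseteq> E' \<and> forces TYPE('d) V (E \<union> U \<times> U) E'"
  using assms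
proof (induction arbitrary: U rule: chordal.induct)
  case (chordal_base V)
  then show ?case using chordal.chordal_base[of V "CARD('d)"] by (blast intro: forces_subset)
next
  case (chordal_step V E v K)
  let ?E = "E \<union> insert v K \<times> insert v K"
  have E: "chordal CARD('d) (insert v V) ?E" using chordal_step.hyps by (rule chordal.chordal_step)
  consider "v \<notin> U" | "v \<in> U" "U \<subseteq> insert v K" | "v \<in> U" "\<not> U \<subseteq> insert v K" by blast
  then show ?case
  proof cases
    case 1
    then have "U \<subseteq> V" using chordal_step.prems by blast
    then obtain E' where E': "chordal CARD('d) V E'" "E \<union> U \<times> U \<subseteq> E'" "forces TYPE('d) V (E \<union> U \<times> U) E'"
      using chordal_step.IH by blast
    have "K \<times> K \<subseteq> E'" using chordal_step.hyps E'(2) by blast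
    then have "chordal CARD('d) (insert v V) (E' \<union> insert v K \<times> insert v K)"
      using chordal.chordal_step[OF E'(1)] chordal_step.hyps by blast
    moreover have "forces TYPE('d) (insert v V) (?E \<union> U \<times> U) (E' \<union> insert v K \<times> insert v K)"
      by (rule forces_Un[OF forces_mono[OF E'(3)] forces_subset]) blast+
    moreover have "?E \<union> U \<times> U \<subseteq> E' \<union> insert v K \<times> insert v K" using E'(2) by blast
    ultimately show ?thesis by blast
  next
    case 2
    then have "?E \<union> U \<times> U = ?E" by blast
    then show ?thesis using E by (metis forces_subset order_refl)
  next
    case 3
    let ?U = "(U - {v}) \<union> K"
    have UV: "?U \<subseteq> V" using chordal_step.prems chordal_step.hyps by blast
    then obtain E' where E': "chordal CARD('d) V E'" "E \<union> ?U \<times> ?U \<subseteq> E'" "forces TYPE('d) V (E \<union> ?U \<times> ?U) E'"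
      using chordal_step.IH by blast
    have "forces TYPE('d) (insert v V) (?E \<union> U \<times> U) (?U \<times> ?U)"
      unfolding forces_def
    proof (intro allI impI, elim conjE)
      fix p q :: "'a \<Rightarrow> real ^ 'd"
      assume gen: "generic_on (insert v V) p" and pq: "same_dist (?E \<union> U \<times> U) p q"
      have pqE: "same_dist ?E p q" using pq by (rule same_dist_mono) blast
      have *: "dist (p u) (p s) = dist (q u) (q s)" if "u \<in> U - {v}" "s \<in> K" for u s
      proof (rule chordal_new_edge[OF chordal_step.hyps(1-3,5,4) gen pqE])
        show "u \<in> V" "s \<in> K" using that UV by blast+
        show "dist (p u) (p v) = dist (q u) (q v)" using same_distD[OF pq] that 3(1) by blast
      qed
      have "dist (p x) (p y) = dist (q x) (q y)" if xy: "x \<in> ?U" "y \<in> ?U" for x y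
      proof -
        consider "x \<in> U" "y \<in> U" | "x \<in> K" "y \<in> K" | "x \<in> U - {v}" "y \<in> K" | "y \<in> U - {v}" "x \<in> K"
          using xy by blast
        then show ?thesis
        proof cases
          case 4
          then show ?thesis using *[of y x] by (simp add: dist_commute)
        qed (use * same_distD[OF pq] chordal_step.hyps(5) in blast)+
      qed
      then show "same_dist (?U \<times> ?U) p q" unfolding same_dist_def by blast
    qed
    then have "forces TYPE('d) (insert v V) (?E \<union> U \<times> U) (E \<union> ?U \<times> ?U)"
      by (intro forces_Un[OF forces_subset]) auto
    moreover have "forces TYPE('d) (insert v V) (E \<union> ?U \<times> ?U) E'"
      by (rule forces_mono[OF E'(3)]) auto
    ultimately have f: "forces TYPE('d) (insert v V) (?E \<union> U \<times> U) E'" by (rule forces_trans)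
    have U': "insert v ?U \<times> insert v ?U \<subseteq> E' \<union> (?E \<union> U \<times> U)"
      using 3(1) E'(2) by blast
    have "forces TYPE('d) (insert v V) (?E \<union> U \<times> U) (E' \<union> insert v ?U \<times> insert v ?U)"
      by (rule forces_mono[OF forces_Un[OF f forces_subset[OF subset_refl]] subset_refl subset_refl])
        (use U' in blast)
    moreover have "CARD('d) \<le> card ?U"
    proof -
      have "finite ?U" using UV chordal_finite[OF chordal_step.hyps(1)] finite_subset by blast
      then show ?thesis using chordal_step.hyps(4) card_mono[of ?U K] by simp
    qed
    then have "chordal CARD('d) (insert v V) (E' \<union> insert v ?U \<times> insert v ?U)"
      using chordal.chordal_step[OF E'(1) chordal_step.hyps(2) UV] E'(2) by blast
    moreover have "?E \<union> U \<times> U \<subseteq> E' \<union> insert v ?U \<times> insert v ?U" using E'(2) 3(1) by blast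
    ultimately show ?thesis by blast
  qed
qed

lemma chordal_attach_clique:
  assumes "finite X" "chordal d V E" "U \<subseteq> V" "U \<times> U \<subseteq> E" "d \<le> card U" "X \<inter> V = {}"
  shows "chordal d (V \<union> X) (E \<union> (U \<union> X) \<times> (U \<union> X))"
  using assms
proof (induction X rule: finite_induct)
  case empty
  then have "E \<union> (U \<union> {}) \<times> (U \<union> {}) = E" by blast
  then show ?case using empty by simp
next
  case (insert x X)
  let ?E = "E \<union> (U \<union> X) \<times> (U \<union> X)"
  have ch: "chordal d (V \<union> X) ?E" using insert by blast
  have "card U \<le> card (U \<union> X)"
    using insert.hyps chordal_finite[OF insert.prems(1)] insert.prems(2)
    by (intro card_mono) (auto intro: finite_subset)
  then have "chordal d (insert x (V \<union> X)) (?E \<union> insert x (U \<union> X) \<times> insert x (U \<union> X))"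
    using insert by (intro chordal.chordal_step[OF ch]) auto
  moreover have "?E \<union> insert x (U \<union> X) \<times> insert x (U \<union> X) = E \<union> (U \<union> insert x X) \<times> (U \<union> insert x X)"
    by blast
  ultimately show ?case by simp
qed

text \<open>The construction order of \<open>V2\<close> need not start with \<open>U\<close>, so it
  is undone from the end. Vertices outside \<open>V1\<close> are simply attached again at the
  end.\<close>

lemma chordal_glue:
  assumes "chordal d V2 E2" "chordal d V1 E1" "V1 \<inter> V2 = U" "U \<times> U \<subseteq> E1" "U \<times> U \<subseteq> E2" "d \<le> card U"
  shows "chordal d (V1 \<union> V2) (E1 \<union> E2)"
  using assms
proof (induction arbitrary: V1 E1 U rule: chordal.induct)
  case (chordal_base V)
  have "chordal d (V1 \<union> (V - V1)) (E1 \<union> (U \<union> (V - V1)) \<times> (U \<union> (V - V1)))"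
    using chordal_base by (intro chordal_attach_clique) auto
  moreover have "U \<union> (V - V1) = V" "V1 \<union> (V - V1) = V1 \<union> V" using chordal_base.prems(2) by blast+
  ultimately show ?case by simp
next
  case (chordal_step V E v K)
  note EV = chordal_subset[OF chordal_step.hyps(1)]
  show ?case
  proof (cases "v \<in> V1")
    case False
    then have "v \<notin> U" and U: "V1 \<inter> V = U" using chordal_step.prems(2) by blast+
    have "U \<times> U \<subseteq> E"
      using clique_restrict[OF EV chordal_step.hyps(5) \<open>v \<notin> U\<close> chordal_step.prems(4)] .
    then have ch: "chordal d (V1 \<union> V) (E1 \<union> E)"
      using chordal_step.IH[OF chordal_step.prems(1) U] chordal_step.prems by blast
    have "chordal d (insert v (V1 \<union> V)) (E1 \<union> E \<union> insert v K \<times> insert v K)"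
      using chordal_step.hyps False by (intro chordal.chordal_step[OF ch]) auto
    then show ?thesis by (simp add: Un_assoc)
  next
    case True
    then have vU: "v \<in> U" using chordal_step.prems(2) by blast
    have UK: "U - {v} \<subseteq> K"
      by (rule clique_nbhd[OF EV chordal_step.hyps(2) vU chordal_step.prems(4)])
    \<comment> \<open>A last vertex \<open>v\<close> in the overlap is already present in
      \<open>V1\<close>. Its missing neighbours are attached to \<open>V1\<close> as part of the
      clique \<open>insert v K\<close>, after which the rest is glued along \<open>K\<close> instead
      of \<open>U\<close>.\<close>
    let ?X = "K - U"
    have X: "?X \<inter> V1 = {}" using chordal_step.hyps(3) chordal_step.prems(2) by blast
    have fX: "finite ?X" using chordal_finite[OF chordal_step.hyps(1)] chordal_step.hyps(3)
      by (meson Diff_subset finite_subset)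
    have UX: "U \<union> ?X = insert v K" using vU UK by blast
    have ch: "chordal d (V1 \<union> ?X) (E1 \<union> insert v K \<times> insert v K)"
      using chordal_attach_clique[OF fX chordal_step.prems(1) _ chordal_step.prems(3,5) X]
        chordal_step.prems(2) unfolding UX by blast
    have "(V1 \<union> ?X) \<inter> V = K"
      using chordal_step.hyps(2,3) chordal_step.prems(2) UK vU by blast
    from chordal_step.IH[OF ch this] have "chordal d (V1 \<union> ?X \<union> V) (E1 \<union> insert v K \<times> insert v K \<union> E)"
      using chordal_step.hyps by blast
    moreover have "V1 \<union> ?X \<union> V = V1 \<union> insert v V" using True chordal_step.hyps(3) by blast
    ultimately show ?thesis by (simp add: Un_ac)
  qed
qed

lemma chordal_dist_rational:
  fixes p q :: "'a \<Rightarrow> real ^ 'd::finite"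
  assumes ch: "chordal CARD('d) V E" and gen: "generic_on V p" and pq: "same_dist E p q"
    and u: "u \<in> V" "u' \<in> V"
  shows "(dist (q u) (q u'))\<^sup>2 \<in> qfield (V \<times> UNIV) (coords p)"
proof -
  obtain C where C: "C \<subseteq> V" "card C = Suc CARD('d)" "C \<times> C \<subseteq> E" using chordal_clique[OF ch] by blast
  then obtain a where a: "a \<in> C" by fastforce
  have fin: "finite C" using C(2) by (simp add: card_ge_0_finite)
  have aC: "insert a (C - {a}) = C" using a by blast
  have fr: "frame p a (C - {a})"
    using C a fin by (intro generic_frame[OF gen]) auto
  have "same_dist (insert a (C - {a}) \<times> insert a (C - {a})) p q"
    unfolding aC using pq C(3) by (rule same_dist_mono)
  from normalize_on_frame[OF fr this] obtain q'
    where q': "\<And>x y. dist (q' x) (q' y) = dist (q x) (q y)" "\<And>s. s \<in> C \<Longrightarrow> q' s = p s"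
    unfolding aC by blast
  let ?F = "qfield (V \<times> UNIV) (coords p)"
  have pF: "p ` V \<subseteq> vecs ?F" by (rule points_in_Qvecs)
  have "same_dist E p q'" using pq unfolding same_dist_def q'(1) by blast
  moreover have "q' ` C \<subseteq> vecs ?F"
  proof
    fix y assume "y \<in> q' ` C"
    then obtain s where "s \<in> C" "y = p s" using q'(2) by auto
    then show "y \<in> vecs ?F" using pF C(1) by blast
  qed
  ultimately have "q' ` V \<subseteq> vecs ?F"
    using chordal_rational[OF ch gen _ real_subfield_qfield pF C] by blast
  then have "(dist (q' u) (q' u'))\<^sup>2 \<in> ?F" using u by (intro vecs_dist[OF real_subfield_qfield]) auto
  then show ?thesis by (simp add: q'(1))
qed

text \<open>If the distances within a d-set U depend only on the positions of U, they are preserved: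
  for a last vertex v in U, placing q on v and its neighbours makes the positions q u rational in
  U - v, which rules out the reflected positions.\<close>

lemma chordal_independent_dist:
  fixes p q :: "'a \<Rightarrow> real ^ 'd::finite"
  assumes "chordal CARD('d) V E" "generic_on V p" "same_dist E p q" "U \<subseteq> V" "card U = CARD('d)"
    "\<And>u u'. u \<in> U \<Longrightarrow> u' \<in> U \<Longrightarrow> (dist (q u) (q u'))\<^sup>2 \<in> qfield (U \<times> UNIV) (coords p)"
  shows "same_dist (U \<times> U) p q"
  using assms
proof (induction arbitrary: U rule: chordal.induct)
  case (chordal_base V)
  show ?case using chordal_base.prems(2) by (rule same_dist_mono) (use chordal_base.prems(3) in blast)
next
  case (chordal_step V E v K)
  have gen: "generic_on V p" using chordal_step.prems(1) by (rule generic_on_mono) blast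
  have sE: "same_dist E p q" using chordal_step.prems(2) by (rule same_dist_mono) blast
  show ?case
  proof (cases "v \<in> U")
    case False
    then show ?thesis using chordal_step.IH[OF gen sE] chordal_step.prems by blast
  next
    case True
    let ?U = "U - {v}"
    have UV: "?U \<subseteq> V" using chordal_step.prems(3) by blast
    have fU: "finite U" using chordal_step.prems(4) by (simp add: card_ge_0_finite)
    obtain L where L: "L \<subseteq> K" "card L = CARD('d)"
      using chordal_step.hyps(4) by (metis obtain_subset_with_card_n)
    have "L \<subseteq> V" "L \<times> L \<subseteq> E" using L(1) chordal_step.hyps by blast+
    moreover have "same_dist (E \<union> insert v L \<times> insert v L) p q"
      by (rule same_dist_mono[OF chordal_step.prems(2)]) (use L(1) in blast)
    ultimately obtain q' where q': "\<And>x y. dist (q' x) (q' y) = dist (q x) (q y)"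
      "\<And>s. s \<in> insert v L \<Longrightarrow> q' s = p s" "q' ` V \<subseteq> Qvecs V p"
      using chordal_normalize[OF chordal_step.hyps(1,2) _ _ L(2) chordal_step.prems(1)] by blast
    have qu: "q' u \<in> Qvecs ?U p" if u: "u \<in> ?U" for u
    proof (rule generic_center_descends[OF chordal_step.prems(1) chordal_step.hyps(2) _ chordal_step.prems(3)])
      show "q' u \<in> Qvecs V p" using q'(3) UV u by blast
      have "(dist (q u) (q v))\<^sup>2 \<in> qfield (U \<times> UNIV) (coords p)"
        using chordal_step.prems(5) u True by blast
      then show "(dist (q' u) (p v))\<^sup>2 \<in> qfield (U \<times> UNIV) (coords p)"
        using q'(1)[of u v] q'(2)[of v] by simp
    qed
    \<comment> \<open>Pigeonhole: \<open>?U\<close> has d - 1 elements and \<open>L\<close> has d.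
      Exchanging \<open>v\<close> for a vertex \<open>s\<close> of \<open>L\<close> gives a d-set
      inside \<open>V\<close>, and since \<open>q' s = p s\<close> its distances are again rational
      in its own positions.\<close>
    have "card ?U < card L" using fU True chordal_step.prems(4) L(2) by (metis card_Diff1_less)
    then have "\<not> L \<subseteq> ?U" using fU card_mono[of ?U L] by (auto simp: not_le[symmetric])
    then obtain s where s: "s \<in> L" "s \<notin> ?U" by blast
    let ?S = "insert s ?U"
    have SV: "?S \<subseteq> V" using s(1) \<open>L \<subseteq> V\<close> UV by blast
    have S: "same_dist (?S \<times> ?S) p q"
    proof (rule chordal_step.IH[OF gen sE SV])
      have "0 < card U" using fU True card_gt_0_iff by blast
      then show "card ?S = CARD('d)" using fU True s(2) chordal_step.prems(4) by simp
      have "q' u \<in> Qvecs ?S p" if "u \<in> ?S" for u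
      proof (cases "u = s")
        case True
        then show ?thesis using q'(2)[of s] s(1) point_in_Qvecs[of s ?S p] by simp
      next
        case False
        then have "q' u \<in> Qvecs ?U p" using qu that by blast
        then show ?thesis using Qvecs_mono[of ?U ?S p] by blast
      qed
      then show "(dist (q u) (q u'))\<^sup>2 \<in> qfield (?S \<times> UNIV) (coords p)" if "u \<in> ?S" "u' \<in> ?S" for u u'
        using vecs_dist[OF real_subfield_qfield, of "q' u" "?S \<times> UNIV" "coords p" "q' u'"] that
        by (simp add: q'(1))
    qed
    \<comment> \<open>With the distances to \<open>s\<close> preserved, \<open>s\<close> now plays
      the generic vertex over \<open>?U\<close>.\<close>
    have eq: "q' u = p u" if u: "u \<in> ?U" for u
    proof (rule generic_equidistant_unique[OF _ s(2) qu[OF u]])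
      show "generic_on ?S p" using gen SV by (rule generic_on_mono)
      show "p u \<in> Qvecs ?U p" using u by (rule point_in_Qvecs)
      have "dist (p u) (p s) = dist (q u) (q s)" using same_distD[OF S] u by blast
      then show "dist (q' u) (p s) = dist (p u) (p s)" using q'(1)[of u s] q'(2)[of s] s(1) by simp
    qed
    then have "q' u = p u" if "u \<in> U" for u using that q'(2)[of v] by (cases "u = v") auto
    then have "dist (p x) (p y) = dist (q x) (q y)" if "x \<in> U" "y \<in> U" for x y
      using q'(1)[of x y] that by simp
    then show ?thesis unfolding same_dist_def by blast
  qed
qed

text \<open>Each side shows the squared distances in the overlap to be rational in its own
  positions, and \<open>qfield_Int\<close> restricts them to the overlap. Once forced, the overlap
  is made a clique on both sides so that \<open>chordal_glue\<close> applies.\<close>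

lemma chordal_union_hinge:
  assumes 1: "chordal CARD('d::finite) V1 E1" and 2: "chordal CARD('d) V2 E2"
    and card: "card (V1 \<inter> V2) = CARD('d)"
  shows "\<exists>E'. chordal CARD('d) (V1 \<union> V2) E' \<and> E1 \<union> E2 \<subseteq> E' \<and> forces TYPE('d) (V1 \<union> V2) (E1 \<union> E2) E'"
proof -
  let ?U = "V1 \<inter> V2" and ?V = "V1 \<union> V2" and ?E = "E1 \<union> E2"
  have fU: "forces TYPE('d) ?V ?E (?U \<times> ?U)"
    unfolding forces_def
  proof (intro allI impI, elim conjE)
    fix p q :: "'a \<Rightarrow> real ^ 'd"
    assume gen: "generic_on ?V p" and pq: "same_dist ?E p q"
    have g: "generic_on V1 p" "generic_on V2 p" using generic_on_mono[OF gen] by blast+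
    have s: "same_dist E1 p q" "same_dist E2 p q" using pq unfolding same_dist_Un by blast+
    have alg: "algebraically_independent_rat (V1 \<times> UNIV \<union> V2 \<times> UNIV) (coords p)"
      using gen unfolding generic_on_def by (simp only: Sigma_Un_distrib1)
    have fin: "finite (V1 \<times> (UNIV :: 'd set))" using chordal_finite[OF 1] by simp
    have I: "V1 \<times> (UNIV :: 'd set) \<inter> V2 \<times> UNIV = ?U \<times> UNIV" by blast
    show "same_dist (?U \<times> ?U) p q"
    proof (rule chordal_independent_dist[OF 2 g(2) s(2) _ card])
      show "(dist (q u) (q u'))\<^sup>2 \<in> qfield (?U \<times> UNIV) (coords p)" if "u \<in> ?U" "u' \<in> ?U" for u u'
        using qfield_Int[OF alg fin] chordal_dist_rational[OF 1 g(1) s(1)] that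
          chordal_dist_rational[OF 2 g(2) s(2)] unfolding I by blast
    qed blast
  qed
  obtain E1' where A': "chordal CARD('d) V1 E1'" "E1 \<union> ?U \<times> ?U \<subseteq> E1'" "forces TYPE('d) V1 (E1 \<union> ?U \<times> ?U) E1'"
    using chordal_add_clique[OF 1, of ?U] by blast
  obtain E2' where B': "chordal CARD('d) V2 E2'" "E2 \<union> ?U \<times> ?U \<subseteq> E2'" "forces TYPE('d) V2 (E2 \<union> ?U \<times> ?U) E2'"
    using chordal_add_clique[OF 2, of ?U] by blast
  have ch: "chordal CARD('d) ?V (E1' \<union> E2')"
    using A'(2) B'(2) card by (intro chordal_glue[OF B'(1) A'(1) refl]) auto
  have f: "forces TYPE('d) ?V ?E (?E \<union> ?U \<times> ?U)"
    by (rule forces_Un[OF forces_subset fU]) blast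
  have "forces TYPE('d) ?V ?E E1'"
    by (rule forces_trans[OF f forces_mono[OF A'(3)]]) blast+
  moreover have "forces TYPE('d) ?V ?E E2'"
    by (rule forces_trans[OF f forces_mono[OF B'(3)]]) blast+
  ultimately have "forces TYPE('d) ?V ?E (E1' \<union> E2')" by (rule forces_Un)
  then show ?thesis using ch A'(2) B'(2) by blast
qed

text \<open>Undoing the construction of \<open>V2\<close> shrinks the overlap by at most one vertex
  at a time. It reaches either an overlap of exactly d vertices, or a single clique, in which the
  overlap is already a clique.\<close>

lemma chordal_union:
  assumes "chordal CARD('d::finite) V2 E2" "chordal CARD('d) V1 E1" "CARD('d) \<le> card (V1 \<inter> V2)"
  shows "\<exists>E'. chordal CARD('d) (V1 \<union> V2) E' \<and> E1 \<union> E2 \<subseteq> E' \<and> forces TYPE('d) (V1 \<union> V2) (E1 \<union> E2) E'"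
  using assms
proof (induction rule: chordal.induct)
  case (chordal_base V)
  let ?U = "V1 \<inter> V"
  obtain E1' where E1': "chordal CARD('d) V1 E1'" "E1 \<union> ?U \<times> ?U \<subseteq> E1'" "forces TYPE('d) V1 (E1 \<union> ?U \<times> ?U) E1'"
    using chordal_add_clique[OF chordal_base.prems(1), of ?U] by blast
  have "chordal CARD('d) (V1 \<union> V) (E1' \<union> V \<times> V)"
    using E1'(2) chordal_base.prems(2)
    by (intro chordal_glue[OF chordal.chordal_base[OF chordal_base.hyps] E1'(1) refl]) auto
  moreover have "forces TYPE('d) (V1 \<union> V) (E1 \<union> V \<times> V) (E1' \<union> V \<times> V)"
    by (rule forces_Un[OF forces_mono[OF E1'(3)] forces_subset]) blast+
  moreover have "E1 \<union> V \<times> V \<subseteq> E1' \<union> V \<times> V" using E1'(2) by blast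
  ultimately show ?case by blast
next
  case (chordal_step V E v K)
  let ?E = "E \<union> insert v K \<times> insert v K"
  have 2: "chordal CARD('d) (insert v V) ?E" using chordal_step.hyps by (rule chordal.chordal_step)
  show ?case
  proof (cases "card (V1 \<inter> insert v V) = CARD('d)")
    case True
    then show ?thesis by (rule chordal_union_hinge[OF chordal_step.prems(1) 2])
  next
    case False
    have fin: "finite (V1 \<inter> V)" using chordal_finite[OF chordal_step.prems(1)] by simp
    have le: "CARD('d) \<le> card (V1 \<inter> V)"
    proof (cases "v \<in> V1")
      case True
      then have "card (V1 \<inter> insert v V) = Suc (card (V1 \<inter> V))"
        using fin chordal_step.hyps(2) by simp
      then show ?thesis using False chordal_step.prems(2) by simp
    next
      case False
      then show ?thesis using chordal_step.prems(2) by simp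
    qed
    obtain E' where E': "chordal CARD('d) (V1 \<union> V) E'" "E1 \<union> E \<subseteq> E'" "forces TYPE('d) (V1 \<union> V) (E1 \<union> E) E'"
      using chordal_step.IH[OF chordal_step.prems(1) le] by blast
    have f: "forces TYPE('d) (V1 \<union> insert v V) (E1 \<union> ?E) (E' \<union> insert v K \<times> insert v K)"
      by (rule forces_Un[OF forces_mono[OF E'(3)] forces_subset]) blast+
    show ?thesis
    proof (cases "v \<in> V1")
      \<comment> \<open>The vertex survives in \<open>V1\<close>, so it cannot be attached anew; its
        closed neighbourhood is added as a clique instead.\<close>
      case True
      then have V: "V1 \<union> insert v V = V1 \<union> V" by blast
      have "insert v K \<subseteq> V1 \<union> V" using True chordal_step.hyps(3) by blast
      from chordal_add_clique[OF E'(1) this] obtain E'' where E'': "chordal CARD('d) (V1 \<union> V) E''"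
        "E' \<union> insert v K \<times> insert v K \<subseteq> E''"
        "forces TYPE('d) (V1 \<union> V) (E' \<union> insert v K \<times> insert v K) E''" by blast
      have "forces TYPE('d) (V1 \<union> V) (E1 \<union> ?E) E''"
        using f E''(3) unfolding V by (rule forces_trans)
      moreover have "E1 \<union> ?E \<subseteq> E''" using E'(2) E''(2) by blast
      ultimately show ?thesis using E''(1) unfolding V by blast
    next
      case False
      have "chordal CARD('d) (insert v (V1 \<union> V)) (E' \<union> insert v K \<times> insert v K)"
        using False chordal_step.hyps E'(2) by (intro chordal.chordal_step[OF E'(1)]) auto
      then have "chordal CARD('d) (V1 \<union> insert v V) (E' \<union> insert v K \<times> insert v K)" by simp
      moreover have "E1 \<union> ?E \<subseteq> E' \<union> insert v K \<times> insert v K" using E'(2) by blast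
      ultimately show ?thesis using f by blast
    qed
  qed
qed

lemma chordal_card: "chordal d V E \<Longrightarrow> Suc d \<le> card V"
  by (induction rule: chordal.induct) (auto simp: chordal_finite)

text \<open>After the old vertices are put back in place, the last vertex sits at \<open>p v\<close>
  or at one mirror image \<open>z\<close>. The latter either has all the right distances or changes
  one of them by a fixed positive gap, which a small perturbation cannot bridge.\<close>

lemma chordal_locally_rigid:
  fixes p :: "'a \<Rightarrow> real ^ 'd::finite"
  assumes "chordal CARD('d) V E" "generic_on V p"
  shows "\<exists>\<epsilon>>0. \<forall>q. same_dist E p q \<and> (\<forall>x\<in>V. dist (p x) (q x) < \<epsilon>) \<longrightarrow> same_dist (V \<times> V) p q"
  using assms
proof (induction rule: chordal.induct)
  case (chordal_base V)
  show ?case by (rule exI[of _ 1]) simp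
next
  case (chordal_step V E v K)
  have gen: "generic_on V p" using chordal_step.prems by (rule generic_on_mono) blast
  have fV: "finite V" by (rule chordal_finite[OF chordal_step.hyps(1)])
  obtain \<epsilon> where \<epsilon>: "\<epsilon> > 0"
    "\<And>q. same_dist E p q \<Longrightarrow> \<forall>x\<in>V. dist (p x) (q x) < \<epsilon> \<Longrightarrow> same_dist (V \<times> V) p q"
    using chordal_step.IH[OF gen] by blast
  obtain L where L: "L \<subseteq> K" "card L = CARD('d)"
    using chordal_step.hyps(4) by (metis obtain_subset_with_card_n)
  have LV: "L \<subseteq> V" using L(1) chordal_step.hyps(3) by blast
  have "L \<noteq> V" using chordal_card[OF chordal_step.hyps(1)] L(2) by auto
  then obtain w where w: "w \<in> V" "w \<notin> L" using LV by blast
  have fr: "frame p w L" by (rule generic_frame[OF gen w LV L(2)])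
  obtain z where z: "\<And>y. \<forall>s\<in>L. dist y (p s) = dist (p v) (p s) \<Longrightarrow> y = p v \<or> y = z"
    using frame_equidistant[OF fr real_subfield_UNIV, of "p v"] by (auto simp: vecs_def)
  \<comment> \<open>Half the gap, because both ends of the pair may move by \<open>\<eta>\<close>.
    The value 1 is a harmless default where \<open>z\<close> causes no change.\<close>
  define \<delta> where "\<delta> x = (if dist z (p x) = dist (p v) (p x) then 1 else \<bar>dist z (p x) - dist (p v) (p x)\<bar> / 2)" for x
  define \<eta> where "\<eta> = Min (insert \<epsilon> (\<delta> ` V))"
  have \<eta>: "\<eta> \<le> \<epsilon>" "\<And>x. x \<in> V \<Longrightarrow> \<eta> \<le> \<delta> x" "\<eta> > 0"
    using fV \<epsilon>(1) by (auto simp: \<eta>_def \<delta>_def)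
  show ?case
  proof (intro exI conjI allI impI, rule \<eta>(3), elim conjE)
    fix q assume pq: "same_dist (E \<union> insert v K \<times> insert v K) p q"
      and near: "\<forall>x\<in>insert v V. dist (p x) (q x) < \<eta>"
    have "same_dist E p q" using pq by (rule same_dist_mono) blast
    moreover have "\<forall>x\<in>V. dist (p x) (q x) < \<epsilon>" using near \<eta>(1) by (meson insertI2 less_le_trans)
    ultimately have sV: "same_dist (V \<times> V) p q" by (rule \<epsilon>(2))
    have "insert w L \<times> insert w L \<subseteq> V \<times> V" using w LV by blast
    then have "same_dist (insert w L \<times> insert w L) p q" by (rule same_dist_mono[OF sV])
    from normalize_on_frame[OF fr this] obtain q'
      where q': "\<And>x y. dist (q' x) (q' y) = dist (q x) (q y)" "\<And>s. s \<in> insert w L \<Longrightarrow> q' s = p s"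
      by blast
    have qV: "q' x = p x" if x: "x \<in> V" for x
    proof (rule frame_point_unique[OF fr])
      fix s assume s: "s \<in> insert w L"
      then have "s \<in> V" using w LV by blast
      then have "dist (p x) (p s) = dist (q x) (q s)" using same_distD[OF sV] x by blast
      then show "dist (q' x) (p s) = dist (p x) (p s)" using q'(1)[of x s] q'(2)[OF s] by simp
    qed
    have "dist (q' v) (p s) = dist (p v) (p s)" if s: "s \<in> L" for s
    proof -
      have "dist (p v) (p s) = dist (q v) (q s)" using same_distD[OF pq] L(1) s by blast
      then show ?thesis using q'(1)[of v s] q'(2)[of s] s by simp
    qed
    then have qv: "q' v = p v \<or> q' v = z" using z by blast
    have dv: "dist (p v) (p x) = dist (q v) (q x)" if x: "x \<in> V" for x
    proof (rule ccontr)
      assume ne: "dist (p v) (p x) \<noteq> dist (q v) (q x)"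
      have "dist (q v) (q x) = dist (q' v) (p x)" using q'(1)[of v x] qV[OF x] by simp
      then have qz: "dist (q v) (q x) = dist z (p x)" using qv ne by auto
      then have \<delta>x: "\<delta> x = \<bar>dist (q v) (q x) - dist (p v) (p x)\<bar> / 2" using ne by (simp add: \<delta>_def)
      have "\<bar>dist (q v) (q x) - dist (p v) (p x)\<bar> \<le> dist (p v) (q v) + dist (p x) (q x)"
        using dist_triangle[of "q v" "q x" "p v"] dist_triangle[of "p v" "q x" "p x"]
          dist_triangle[of "p v" "p x" "q v"] dist_triangle[of "q v" "p x" "q x"]
        by (simp add: dist_commute abs_le_iff)
      also have "\<dots> < 2 * \<eta>" using near x by (smt (verit) insertCI)
      finally show False using \<eta>(2)[OF x] \<delta>x by simp
    qed
    have "dist (p x) (p y) = dist (q x) (q y)" if "x \<in> insert v V" "y \<in> insert v V" for x y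
    proof -
      consider "x \<in> V" "y \<in> V" | "x = v" "y \<in> V" | "x \<in> V" "y = v" | "x = v" "y = v"
        using \<open>x \<in> _\<close> \<open>y \<in> _\<close> by blast
      then show ?thesis
      proof cases
        case 1
        then show ?thesis using same_distD[OF sV] by blast
      next
        case 3
        then show ?thesis using dv[of x] by (simp add: dist_commute)
      qed (simp_all add: dv)
    qed
    then show "same_dist (insert v V \<times> insert v V) p q" unfolding same_dist_def by blast
  qed
qed

section \<open>Closed skeletons and their separators\<close>

text \<open>The one consequence of maximality that separation arguments use: a clique of d + 1
  vertices pins down every vertex joined to all of it, so two such vertices have a forced
  distance.\<close>

definition clique_closed :: "nat \<Rightarrow> ('a \<times> 'a) set \<Rightarrow> bool" where
  "clique_closed d E \<longleftrightarrow> (\<forall>C x y. card C = Suc d \<and> insert x C \<times> insert x C \<subseteq> E \<and>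
     insert y C \<times> insert y C \<subseteq> E \<longrightarrow> (x, y) \<in> E)"

lemma clique_closedD:
  "clique_closed d E \<Longrightarrow> card C = Suc d \<Longrightarrow> insert x C \<times> insert x C \<subseteq> E \<Longrightarrow>
    insert y C \<times> insert y C \<subseteq> E \<Longrightarrow> (x, y) \<in> E"
  unfolding clique_closed_def by metis

lemma clique_forces_pair:
  assumes C: "C \<subseteq> V" "card C = Suc CARD('d::finite)"
    and xy: "insert x C \<times> insert x C \<subseteq> E" "insert y C \<times> insert y C \<subseteq> E"
  shows "forces TYPE('d) V E ({x, y} \<times> {x, y})"
  unfolding forces_def
proof (intro allI impI, elim conjE)
  fix p q :: "'a \<Rightarrow> real ^ 'd" assume gen: "generic_on V p" and pq: "same_dist E p q"
  have fin: "finite C" using C(2) by (simp add: card_ge_0_finite)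
  from C(2) obtain a where a: "a \<in> C" by fastforce
  have aC: "insert a (C - {a}) = C" using a by blast
  have fr: "frame p a (C - {a})"
    using C a fin by (intro generic_frame[OF gen]) auto
  have "same_dist (insert a (C - {a}) \<times> insert a (C - {a})) p q"
    unfolding aC by (rule same_dist_mono[OF pq]) (use xy in blast)
  from normalize_on_frame[OF fr this] obtain q'
    where q': "\<And>x y. dist (q' x) (q' y) = dist (q x) (q y)" "\<And>s. s \<in> C \<Longrightarrow> q' s = p s"
    unfolding aC by blast
  have eq: "q' u = p u" if u: "insert u C \<times> insert u C \<subseteq> E" for u
  proof (rule frame_point_unique[OF fr])
    fix s assume "s \<in> insert a (C - {a})"
    then have s: "s \<in> C" unfolding aC .
    then have "dist (p u) (p s) = dist (q u) (q s)" using same_distD[OF pq] u by blast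
    then show "dist (q' u) (p s) = dist (p u) (p s)" using q'(1)[of u s] q'(2)[OF s] by simp
  qed
  have "dist (p s) (p t) = dist (q s) (q t)" if "s \<in> {x, y}" "t \<in> {x, y}" for s t
    using that eq[OF xy(1)] eq[OF xy(2)] q'(1)[of s t] by auto
  then show "same_dist ({x, y} \<times> {x, y}) p q" unfolding same_dist_def by blast
qed

text \<open>There are finitely many forced chordal extensions on \<open>V\<close>; an
  inclusion-maximal one is closed, since \<open>chordal_add_clique\<close> could otherwise enlarge
  it.\<close>

lemma chordal_closure:
  assumes ch: "chordal CARD('d::finite) V E"
  shows "\<exists>E'. chordal CARD('d) V E' \<and> E \<subseteq> E' \<and> forces TYPE('d) V E E' \<and> clique_closed CARD('d) E'"
proof -
  let ?P = "\<lambda>E'. chordal CARD('d) V E' \<and> E \<subseteq> E' \<and> forces TYPE('d) V E E'"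
  have "{E'. ?P E'} \<subseteq> Pow (V \<times> V)" using chordal_subset by blast
  moreover have "finite (Pow (V \<times> V))" using chordal_finite[OF ch] by simp
  ultimately have fin: "finite {E'. ?P E'}" by (rule finite_subset)
  have "E \<in> {E'. ?P E'}" using ch forces_subset[OF subset_refl] by simp
  then have "{E'. ?P E'} \<noteq> {}" by (rule ex_in_conv[THEN iffD1, OF exI])
  from finite_has_maximal[OF fin this]
  obtain M where M0: "M \<in> {E'. ?P E'}" "\<forall>E'\<in>{E'. ?P E'}. M \<subseteq> E' \<longrightarrow> M = E'"
    by (rule bexE)
  then have M: "?P M" by simp
  have "clique_closed CARD('d) M"
    unfolding clique_closed_def
  proof (intro allI impI, elim conjE)
    fix C x y
    assume C: "card C = Suc CARD('d)" "insert x C \<times> insert x C \<subseteq> M" "insert y C \<times> insert y C \<subseteq> M"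
    have CV: "C \<subseteq> V" "{x, y} \<subseteq> V" using C chordal_subset[of _ V M] M by blast+
    obtain E' where E': "chordal CARD('d) V E'" "M \<union> {x, y} \<times> {x, y} \<subseteq> E'"
      "forces TYPE('d) V (M \<union> {x, y} \<times> {x, y}) E'"
      using chordal_add_clique[OF conjunct1[OF M] CV(2)] by blast
    have "forces TYPE('d) V M (M \<union> {x, y} \<times> {x, y})"
      by (rule forces_Un[OF forces_subset[OF subset_refl] clique_forces_pair[OF CV(1) C]])
    then have "forces TYPE('d) V M E'" using E'(3) by (rule forces_trans)
    then have "?P E'" using E' M forces_trans by blast
    then have "M = E'" using M0(2) E'(2) by blast
    then show "(x, y) \<in> M" using E'(2) by blast
  qed
  then show ?thesis using M by blast
qed

lemma clique_on_one_side:
  assumes "E \<subseteq> A \<times> A \<union> B \<times> B" "K \<times> K \<subseteq> E"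
  shows "K \<subseteq> A \<or> K \<subseteq> B"
  using assms by blast

text \<open>A last vertex with exactly d neighbours is cut off by them. With more neighbours, some
  neighbour \<open>s\<close> is not adjacent to \<open>z\<close>; the separation of \<open>s\<close>
  and \<open>z\<close> has the clique \<open>K\<close> on the side of \<open>s\<close>, and
  \<open>v\<close> joins that side.\<close>

lemma chordal_separation:
  assumes "chordal d V E" "clique_closed d E" "x \<in> V" "y \<in> V" "(x, y) \<notin> E"
  shows "\<exists>A B. A \<union> B = V \<and> card (A \<inter> B) = d \<and> x \<in> A - B \<and> y \<in> B - A \<and> E \<subseteq> A \<times> A \<union> B \<times> B"
  using assms
proof (induction arbitrary: x y rule: chordal.induct)
  case (chordal_base V)
  then show ?case by blast
next
  case (chordal_step V E v K)
  let ?E = "E \<union> insert v K \<times> insert v K"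
  note EV = chordal_subset[OF chordal_step.hyps(1)]
  have cl: "clique_closed d E"
    unfolding clique_closed_def
  proof (intro allI impI, elim conjE)
    fix C s t assume C: "card C = Suc d" "insert s C \<times> insert s C \<subseteq> E" "insert t C \<times> insert t C \<subseteq> E"
    have "(s, t) \<in> ?E"
      by (rule clique_closedD[OF chordal_step.prems(1) C(1)]) (use C(2,3) in blast)+
    moreover have "s \<in> V" "t \<in> V" using C EV by blast+
    ultimately show "(s, t) \<in> E" using chordal_step.hyps(2,5) by blast
  qed
  note IH = chordal_step.IH[OF cl]
  have attach: "\<exists>A B. A \<union> B = insert v V \<and> card (A \<inter> B) = d \<and> v \<in> A - B \<and> z \<in> B - A \<and>
      ?E \<subseteq> A \<times> A \<union> B \<times> B" if z: "z \<in> V" "(v, z) \<notin> ?E" for z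
  proof (cases "card K = d")
    case True
    have "insert v K \<inter> V = K" using chordal_step.hyps(2,3) by blast
    then have "card (insert v K \<inter> V) = d" using True by simp
    moreover have "insert v K \<union> V = insert v V" "v \<in> insert v K - V" "z \<in> V - insert v K"
      "?E \<subseteq> insert v K \<times> insert v K \<union> V \<times> V"
      using z chordal_step.hyps(2,3) EV by blast+
    ultimately show ?thesis by blast
  next
    case False
    then have "Suc d \<le> card K" using chordal_step.hyps(4) by simp
    then obtain C where C: "C \<subseteq> K" "card C = Suc d" by (metis obtain_subset_with_card_n)
    \<comment> \<open>Otherwise \<open>v\<close> and \<open>z\<close> would share the (d + 1)-clique
      \<open>C\<close>, and closedness would make them adjacent.\<close>
    have "\<exists>s\<in>C. (s, z) \<notin> E"
    proof (rule ccontr)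
      assume "\<not> ?thesis"
      then have "\<And>s. s \<in> C \<Longrightarrow> (s, z) \<in> E \<and> (z, s) \<in> E"
        using chordal_sym[OF chordal_step.hyps(1)] by blast
      then have "insert z C \<times> insert z C \<subseteq> ?E"
        using C(1) chordal_step.hyps(5) chordal_refl[OF chordal_step.hyps(1) z(1)] by blast
      moreover have "insert v C \<times> insert v C \<subseteq> ?E" using C(1) by blast
      ultimately show False
        using clique_closedD[OF chordal_step.prems(1) C(2)] z(2) by blast
    qed
    then obtain s where s: "s \<in> K" "(s, z) \<notin> E" using C(1) by blast
    then have "s \<in> V" using chordal_step.hyps(3) by blast
    from IH[OF this z(1) s(2)] obtain A B where AB: "A \<union> B = V" "card (A \<inter> B) = d"
      "s \<in> A - B" "z \<in> B - A" "E \<subseteq> A \<times> A \<union> B \<times> B" by blast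
    then have "K \<subseteq> A" using clique_on_one_side[OF AB(5) chordal_step.hyps(5)] s(1) by blast
    moreover have "insert v A \<inter> B = A \<inter> B" using AB(1) chordal_step.hyps(2) by blast
    moreover have "z \<noteq> v" using z(1) chordal_step.hyps(2) by blast
    ultimately have "card (insert v A \<inter> B) = d" "insert v A \<union> B = insert v V" "v \<in> insert v A - B"
      "z \<in> B - insert v A" "?E \<subseteq> insert v A \<times> insert v A \<union> B \<times> B"
      using AB chordal_step.hyps(2) by (simp, blast+)
    then show ?thesis by blast
  qed
  consider "x \<in> V" "y \<in> V" | "x = v" "y \<in> V" | "y = v" "x \<in> V" | "x = v" "y = v"
    using chordal_step.prems(2,3) by blast
  then show ?case
  proof cases
    case 1
    have "(x, y) \<notin> E" using chordal_step.prems(4) by blast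
    from IH[OF 1 this] obtain A B where AB: "A \<union> B = V" "card (A \<inter> B) = d"
      "x \<in> A - B" "y \<in> B - A" "E \<subseteq> A \<times> A \<union> B \<times> B" by blast
    have i: "insert v A \<inter> B = A \<inter> B" "A \<inter> insert v B = A \<inter> B" using AB(1) chordal_step.hyps(2) by blast+
    have ne: "x \<noteq> v" "y \<noteq> v" using 1 chordal_step.hyps(2) by blast+
    consider "K \<subseteq> A" | "K \<subseteq> B" using clique_on_one_side[OF AB(5) chordal_step.hyps(5)] by blast
    then show ?thesis
    proof cases
      case 1
      have "insert v A \<union> B = insert v V" "x \<in> insert v A - B" "y \<in> B - insert v A"
        "?E \<subseteq> insert v A \<times> insert v A \<union> B \<times> B" using AB ne 1 by blast+
      then show ?thesis using AB(2) i(1) by metis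
    next
      case 2
      have "A \<union> insert v B = insert v V" "x \<in> A - insert v B" "y \<in> insert v B - A"
        "?E \<subseteq> A \<times> A \<union> insert v B \<times> insert v B" using AB ne 2 by blast+
      then show ?thesis using AB(2) i(2) by metis
    qed
  next
    case 2
    then show ?thesis using attach[of y] chordal_step.prems(4) by blast
  next
    case 3
    then have "(v, x) \<notin> ?E"
      using chordal_step.prems(4) EV chordal_step.hyps(2) by blast
    from attach[OF 3(2) this] obtain A B where "A \<union> B = insert v V" "card (A \<inter> B) = d"
      "v \<in> A - B" "x \<in> B - A" "?E \<subseteq> A \<times> A \<union> B \<times> B" by blast
    then show ?thesis using 3(1) by (intro exI[of _ B] exI[of _ A]) (auto simp: Int_commute)
  next
    case 4
    then show ?thesis using chordal_step.prems(4) by blast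
  qed
qed

section \<open>Reflection across a small separator\<close>

text \<open>The hyperplane contains the points of \<open>S\<close> but neither \<open>p x\<close>,
  where the left side is 0, nor \<open>p y\<close>. If enough vertices are left, \<open>S\<close> is
  enlarged to d of them; were \<open>p y\<close> on their hyperplane, the frame at \<open>y\<close>
  would force \<open>n = 0\<close>.\<close>

lemma generic_separating_hyperplane:
  fixes p :: "'a \<Rightarrow> real ^ 'd::finite"
  assumes gen: "generic_on V p" and V: "finite V" "CARD('d) < card V"
    and S: "S \<subseteq> V - {x, y}" "card S \<le> CARD('d)" and xy: "x \<in> V" "y \<in> V" "x \<noteq> y"
  shows "\<exists>n. (\<forall>s\<in>S. n \<bullet> (p s - p x) = 1) \<and> n \<bullet> (p y - p x) \<noteq> 1 \<and> n \<noteq> 0"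
proof (cases "card V = Suc CARD('d)")
  case True
  \<comment> \<open>Only d - 1 vertices remain besides \<open>x\<close> and \<open>y\<close>, too
    few to span a hyperplane, so the value at \<open>y\<close> is free and prescribed as 2, anything
    but 1.\<close>
  have "frame p x (V - {x})" using True V(1) xy by (intro generic_frame[OF gen]) auto
  then obtain n where n: "\<And>s. s \<in> V - {x} \<Longrightarrow> n \<bullet> (p s - p x) = (if s = y then 2 else 1)"
    using frame_solve[of p x "V - {x}" "\<lambda>s. if s = y then 2 else 1"] by blast
  have "n \<bullet> (p y - p x) = 2" using n[of y] xy by simp
  moreover have "n \<bullet> (p s - p x) = 1" if "s \<in> S" for s
  proof -
    have "s \<in> V - {x}" "s \<noteq> y" using S(1) that by blast+
    then show ?thesis using n[of s] by simp
  qed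
  ultimately show ?thesis by (intro exI[of _ n]) auto
next
  case False
  have "card (V - {x, y}) = card V - 2" using xy V(1) by (simp add: card_Diff_subset)
  then have "CARD('d) \<le> card (V - {x, y})" using False V(2) by simp
  then obtain T where T: "S \<subseteq> T" "T \<subseteq> V - {x, y}" "card T = CARD('d)"
    using S V(1) by (meson exists_subset_between finite_Diff)
  have fx: "frame p x T" and fy: "frame p y T"
    using T xy by (auto intro!: generic_frame[OF gen])
  obtain n where n: "\<And>s. s \<in> T \<Longrightarrow> n \<bullet> (p s - p x) = 1"
    using frame_solve[OF fx, of "\<lambda>_. 1"] by blast
  obtain t where "t \<in> T" using frame_nonempty[OF fx] by blast
  then have n0: "n \<noteq> 0" using n[of t] by auto
  have "n \<bullet> (p y - p x) \<noteq> 1"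
  proof
    assume 1: "n \<bullet> (p y - p x) = 1"
    have "n = 0"
    proof (rule frame_orthogonal_zero[OF fy])
      show "n \<bullet> (p s - p y) = 0" if "s \<in> T" for s
        using n[OF that] 1 by (simp add: inner_diff_right)
    qed
    then show False using n0 by blast
  qed
  then show ?thesis using n n0 T(1) by blast
qed

text \<open>The reflection \<open>r\<close> fixes the overlap, so moving only the \<open>B\<close>
  side keeps the distances within each side. As neither \<open>p x\<close> nor \<open>p y\<close>
  lies on the mirror, their distance changes.\<close>

lemma separated_reflection:
  fixes p :: "'a \<Rightarrow> real ^ 'd::finite"
  assumes gen: "generic_on V p" and V: "finite V" "CARD('d) < card V"
    and AB: "A \<union> B = V" "card (A \<inter> B) \<le> CARD('d)" and x: "x \<in> A - B" and y: "y \<in> B - A"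
  shows "\<exists>q. same_dist (A \<times> A \<union> B \<times> B) p q \<and> dist (p x) (p y) \<noteq> dist (q x) (q y)"
proof -
  have "A \<inter> B \<subseteq> V - {x, y}" "x \<in> V" "y \<in> V" "x \<noteq> y" using AB(1) x y by blast+
  from generic_separating_hyperplane[OF gen V this(1) AB(2) this(2-)] obtain n where n:
    "\<And>s. s \<in> A \<inter> B \<Longrightarrow> n \<bullet> (p s - p x) = 1" "n \<bullet> (p y - p x) \<noteq> 1" "n \<noteq> 0" by blast
  define N where "N = n \<bullet> n"
  have N: "N \<noteq> 0" using n(3) by (simp add: N_def)
  define r where "r z = z - (2 * (n \<bullet> (z - p x) - 1) / N) *\<^sub>R n" for z
  have sq: "(u - c *\<^sub>R n) \<bullet> (u - c *\<^sub>R n) = u \<bullet> u - c * (2 * (n \<bullet> u) - c * N)" for u c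
    unfolding N_def by (simp add: inner_simps inner_commute algebra_simps)
  have iso: "dist (r a) (r b) = dist a b" for a b
  proof -
    define c where "c = 2 * (n \<bullet> (a - b)) / N"
    define u where "u z = 2 * (n \<bullet> (z - p x) - 1) / N" for z
    have "u a - u b = c"
      unfolding c_def u_def diff_divide_distrib[symmetric] by (simp add: inner_diff_right)
    moreover have "r a - r b = (a - b) - (u a - u b) *\<^sub>R n"
      unfolding r_def u_def[symmetric] by (simp add: algebra_simps)
    ultimately have "r a - r b = (a - b) - c *\<^sub>R n" by simp
    moreover have "c * N = 2 * (n \<bullet> (a - b))" using N by (simp add: c_def)
    ultimately show ?thesis unfolding dist_eq_dist_iff_inner by (simp add: sq)
  qed
  define q where "q v = (if v \<in> A then p v else r (p v))" for v
  have qB: "q v = r (p v)" if "v \<in> B" for v using n(1)[of v] that by (auto simp: q_def r_def)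
  have "same_dist (A \<times> A \<union> B \<times> B) p q"
    unfolding same_dist_def using iso by (auto simp: qB) (simp add: q_def)
  moreover have "dist (p x) (p y) \<noteq> dist (q x) (q y)"
  proof -
    define h where "h = n \<bullet> (p y - p x)"
    define c where "c = 2 * (h - 1) / N"
    have "r (p y) - p x = (p y - p x) - c *\<^sub>R n" unfolding r_def c_def h_def by simp
    \<comment> \<open>Since \<open>c * N = 2 * (h - 1)\<close>, the squared distance drops by
      exactly \<open>2 * c\<close>, which is nonzero.\<close>
    then have "(r (p y) - p x) \<bullet> (r (p y) - p x) = (p y - p x) \<bullet> (p y - p x) - c * (2 * h - c * N)"
      by (simp only: sq h_def)
    moreover have "c * N = 2 * (h - 1)" using N by (simp add: c_def)
    moreover have "c \<noteq> 0" using n(2) N by (simp add: c_def h_def)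
    ultimately have "dist (r (p y)) (p x) \<noteq> dist (p y) (p x)" unfolding dist_eq_dist_iff_inner by simp
    moreover have "q y = r (p y)" "q x = p x" using x y by (auto simp: q_def)
    ultimately show ?thesis by (simp add: dist_commute)
  qed
  ultimately show ?thesis by blast
qed

section \<open>Menger's theorem\<close>

lemma walk_to_path:
  assumes "successively R vs" "vs \<noteq> []"
  shows "\<exists>ws. ws \<noteq> [] \<and> distinct ws \<and> successively R ws \<and> hd ws = hd vs \<and> last ws = last vs \<and>
    set ws \<subseteq> set vs"
  using assms
proof (induction vs)
  case Nil
  then show ?case by simp
next
  case (Cons v vs)
  show ?case
  proof (cases "vs = []")
    case True
    then show ?thesis by (intro exI[of _ "[v]"]) auto
  next
    case False
    then obtain ws where ws: "ws \<noteq> []" "distinct ws" "successively R ws" "hd ws = hd vs"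
      "last ws = last vs" "set ws \<subseteq> set vs"
      using Cons by (auto simp: successively_Cons)
    show ?thesis
    proof (cases "v \<in> set ws")
      case True
      then obtain a b where "ws = a @ v # b" by (auto simp: in_set_conv_decomp)
      with ws False show ?thesis
        by (intro exI[of _ "v # b"]) (auto simp: successively_append_iff)
    next
      case nin: False
      with ws False Cons.prems show ?thesis
        by (intro exI[of _ "v # ws"]) (auto simp: successively_Cons)
    qed
  qed
qed

text \<open>Ordered pairs allow the induction in Menger's theorem to delete one arc at a time; an
  undirected graph enters through its symmetric relation. A single vertex of
  \<open>A \<inter> B\<close> counts as a path.\<close>

definition dpath :: "('a \<times> 'a) set \<Rightarrow> 'a set \<Rightarrow> 'a set \<Rightarrow> 'a list \<Rightarrow> bool" where
  "dpath E A B vs \<longleftrightarrow> vs \<noteq> [] \<and> distinct vs \<and> successively (\<lambda>u v. (u, v) \<in> E) vs \<and> hd vs \<in> A \<and> last vs \<in> B"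

definition dseparator :: "('a \<times> 'a) set \<Rightarrow> 'a set \<Rightarrow> 'a set \<Rightarrow> 'a set \<Rightarrow> bool" where
  "dseparator E A B S \<longleftrightarrow> (\<forall>vs. dpath E A B vs \<longrightarrow> set vs \<inter> S \<noteq> {})"

text \<open>Using the arc \<open>(x, y)\<close> would put \<open>x\<close> before the last position
  and \<open>y\<close> after the first.\<close>

lemma successively_insert_edge:
  assumes "successively (\<lambda>u v. (u, v) \<in> insert (x, y) E) vs" "x \<notin> set (butlast vs) \<or> y \<notin> set (tl vs)"
  shows "successively (\<lambda>u v. (u, v) \<in> E) vs"
  using assms by (induction vs rule: induct_list012) (auto split: if_splits)

lemma dseparator_insert_edge:
  assumes "dseparator E A B S" "z = x \<or> z = y"
  shows "dseparator (insert (x, y) E) A B (insert z S)"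
  unfolding dseparator_def
proof (intro allI impI)
  fix vs assume vs: "dpath (insert (x, y) E) A B vs"
  show "set vs \<inter> insert z S \<noteq> {}"
  proof (cases "x \<notin> set (butlast vs) \<or> y \<notin> set (tl vs)")
    case True
    then have "dpath E A B vs" using vs successively_insert_edge unfolding dpath_def by metis
    then show ?thesis using assms(1) unfolding dseparator_def by blast
  next
    case False
    then have "x \<in> set vs" "y \<in> set vs" by (auto dest: in_set_butlastD) (metis list.set_sel(2) tl_Nil)
    then show ?thesis using assms(2) by auto
  qed
qed

lemma split_list_first_in:
  assumes "set vs \<inter> S \<noteq> {}"
  obtains a z b where "vs = a @ z # b" "z \<in> S" "set a \<inter> S = {}"
  using split_list_first_prop[of vs "\<lambda>z. z \<in> S"] assms by blast

lemma split_list_last_in: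
  assumes "set vs \<inter> S \<noteq> {}"
  obtains a z b where "vs = a @ z # b" "z \<in> S" "set b \<inter> S = {}"
  using split_list_last_prop[of vs "\<lambda>z. z \<in> S"] assms by blast

text \<open>A path cut at its first vertex in \<open>insert x S\<close> can have \<open>x\<close>
  only at its end, so this initial piece does not use the new arc and \<open>X\<close> meets it.
  \<open>dseparator_last\<close> is the mirror image.\<close>

lemma dseparator_first:
  assumes "dseparator (insert (x, y) E) A B (insert x S)" "dseparator E A (insert x S) X"
  shows "dseparator (insert (x, y) E) A B X"
  unfolding dseparator_def
proof (intro allI impI)
  fix vs assume vs: "dpath (insert (x, y) E) A B vs"
  then have "set vs \<inter> insert x S \<noteq> {}" using assms(1) unfolding dseparator_def by blast
  then obtain a z b where s: "vs = a @ z # b" "z \<in> insert x S" "set a \<inter> insert x S = {}"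
    by (rule split_list_first_in)
  have suc: "successively (\<lambda>u v. (u, v) \<in> insert (x, y) E) (a @ [z])"
    using vs unfolding s(1) dpath_def by (simp add: successively_append_iff)
  have "successively (\<lambda>u v. (u, v) \<in> E) (a @ [z])"
    by (rule successively_insert_edge[OF suc]) (use s(3) in auto)
  moreover have "hd (a @ [z]) = hd vs" "distinct (a @ [z])"
    using vs unfolding s(1) dpath_def by (simp_all add: hd_append)
  ultimately have "dpath E A (insert x S) (a @ [z])"
    using vs s(2) unfolding dpath_def by simp
  then have "set (a @ [z]) \<inter> X \<noteq> {}" using assms(2) unfolding dseparator_def by blast
  then show "set vs \<inter> X \<noteq> {}" using s(1) by auto
qed

lemma dseparator_last:
  assumes "dseparator (insert (x, y) E) A B (insert y S)" "dseparator E (insert y S) B X"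
  shows "dseparator (insert (x, y) E) A B X"
  unfolding dseparator_def
proof (intro allI impI)
  fix vs assume vs: "dpath (insert (x, y) E) A B vs"
  then have "set vs \<inter> insert y S \<noteq> {}" using assms(1) unfolding dseparator_def by blast
  then obtain a z b where s: "vs = a @ z # b" "z \<in> insert y S" "set b \<inter> insert y S = {}"
    by (rule split_list_last_in)
  have suc: "successively (\<lambda>u v. (u, v) \<in> insert (x, y) E) (z # b)"
    using vs unfolding s(1) dpath_def by (simp add: successively_append_iff)
  have "successively (\<lambda>u v. (u, v) \<in> E) (z # b)"
    by (rule successively_insert_edge[OF suc]) (use s(3) in auto)
  moreover have "last (z # b) = last vs" "distinct (z # b)"
    using vs unfolding s(1) dpath_def by simp_all
  ultimately have "dpath E (insert y S) B (z # b)"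
    using vs s(2) unfolding dpath_def by simp
  then have "set (z # b) \<inter> X \<noteq> {}" using assms(2) unfolding dseparator_def by blast
  then show "set vs \<inter> X \<noteq> {}" using s(1) by auto
qed

definition linkage :: "('a \<times> 'a) set \<Rightarrow> 'a set \<Rightarrow> 'a set \<Rightarrow> 'a list set \<Rightarrow> bool" where
  "linkage E A B P \<longleftrightarrow> finite P \<and> (\<forall>vs\<in>P. dpath E A B vs) \<and>
     (\<forall>vs\<in>P. \<forall>ws\<in>P. vs \<noteq> ws \<longrightarrow> set vs \<inter> set ws = {})"

text \<open>As many disjoint paths as vertices of \<open>B\<close>: each vertex of \<open>B\<close>
  is the end of exactly one path, so no path can pass through \<open>B\<close> before its
  end.\<close>

lemma linkage_last_bij:
  assumes P: "linkage E A B P" and B: "finite B" "card P = card B"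
  shows "bij_betw last P B" "\<And>vs. vs \<in> P \<Longrightarrow> set vs \<inter> B = {last vs}"
proof -
  have inj: "inj_on last P"
  proof (rule inj_onI, rule ccontr)
    fix vs ws assume "vs \<in> P" "ws \<in> P" "last vs = last ws" "vs \<noteq> ws"
    then show False using P last_in_set unfolding linkage_def dpath_def by (metis disjoint_iff)
  qed
  moreover have "last ` P \<subseteq> B" using P unfolding linkage_def dpath_def by auto
  ultimately have im: "last ` P = B" using B by (simp add: card_image card_subset_eq)
  then show "bij_betw last P B" using inj by (simp add: bij_betw_def)
  fix vs assume vs: "vs \<in> P"
  have "z = last vs" if z: "z \<in> set vs" "z \<in> B" for z
  proof -
    obtain ws where ws: "ws \<in> P" "z = last ws" using im z(2) by blast
    then have "z \<in> set ws" using P unfolding linkage_def dpath_def by auto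
    then have "ws = vs" using P vs ws(1) z(1) unfolding linkage_def by blast
    then show ?thesis using ws by simp
  qed
  moreover have "last vs \<in> set vs" "last vs \<in> B" using vs P unfolding linkage_def dpath_def by auto
  ultimately show "set vs \<inter> B = {last vs}" by blast
qed

lemma linkage_hd_bij:
  assumes P: "linkage E A B P" and A: "finite A" "card P = card A"
  shows "bij_betw hd P A" "\<And>vs. vs \<in> P \<Longrightarrow> set vs \<inter> A = {hd vs}"
proof -
  have inj: "inj_on hd P"
  proof (rule inj_onI, rule ccontr)
    fix vs ws assume "vs \<in> P" "ws \<in> P" "hd vs = hd ws" "vs \<noteq> ws"
    then show False using P list.set_sel(1) unfolding linkage_def dpath_def by (metis disjoint_iff)
  qed
  moreover have "hd ` P \<subseteq> A" using P unfolding linkage_def dpath_def by auto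
  ultimately have im: "hd ` P = A" using A by (simp add: card_image card_subset_eq)
  then show "bij_betw hd P A" using inj by (simp add: bij_betw_def)
  fix vs assume vs: "vs \<in> P"
  have "z = hd vs" if z: "z \<in> set vs" "z \<in> A" for z
  proof -
    obtain ws where ws: "ws \<in> P" "z = hd ws" using im z(2) by blast
    then have "z \<in> set ws" using P unfolding linkage_def dpath_def by auto
    then have "ws = vs" using P vs ws(1) z(1) unfolding linkage_def by blast
    then show ?thesis using ws by simp
  qed
  moreover have "hd vs \<in> set vs" "hd vs \<in> A" using vs P unfolding linkage_def dpath_def by auto
  ultimately show "set vs \<inter> A = {hd vs}" by blast
qed

text \<open>If the paths met outside \<open>S\<close>, following \<open>vs\<close> up to the meeting
  point and \<open>ws\<close> from there would avoid \<open>S\<close>, as \<open>vs\<close> touches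
  \<open>S\<close> at most at its end and \<open>ws\<close> at most at its start.\<close>

lemma linkage_crossing:
  assumes sep: "dseparator E A B S"
    and vs: "dpath E A (insert x S) vs" "set vs \<inter> insert x S = {last vs}"
    and ws: "dpath E (insert y S) B ws" "set ws \<inter> insert y S = {hd ws}"
    and z: "z \<in> set vs" "z \<in> set ws"
  shows "z \<in> S"
proof (rule ccontr)
  assume zS: "z \<notin> S"
  obtain a b where v: "vs = a @ z # b" using z(1) by (auto simp: in_set_conv_decomp)
  obtain c e where w: "ws = c @ z # e" using z(2) by (auto simp: in_set_conv_decomp)
  have "successively (\<lambda>u v. (u, v) \<in> E) (a @ z # e)"
    using vs(1) ws(1) unfolding v w dpath_def
    by (auto simp: successively_append_iff)
  from walk_to_path[OF this] obtain us where us: "us \<noteq> []" "distinct us"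
      "successively (\<lambda>u v. (u, v) \<in> E) us" "hd us = hd (a @ z # e)" "last us = last (a @ z # e)"
      "set us \<subseteq> set (a @ z # e)" by auto
  have "hd (a @ z # e) = hd vs" by (simp add: v hd_append)
  moreover have "last (a @ z # e) = last ws" by (simp add: w)
  ultimately have "dpath E A B us" using us vs(1) ws(1) unfolding dpath_def by simp
  then obtain t where t: "t \<in> S" "t \<in> set a \<union> set e"
    using sep us(6) zS unfolding dseparator_def by fastforce
  then show False
  proof (cases "t \<in> set a")
    case True
    then have "t \<in> set vs \<inter> insert x S" using t by (simp add: v)
    then have "t = last vs" unfolding vs(2) by simp
    moreover have "last vs \<in> set (z # b)" by (simp add: v)
    ultimately show ?thesis using True vs(1) unfolding dpath_def v by auto
  next
    case False
    then have te: "t \<in> set e" using t by blast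
    have "t \<in> set ws \<inter> insert y S" using t te by (simp add: w)
    then have "t = hd ws" unfolding ws(2) by simp
    moreover have "hd ws \<in> set (c @ [z])" by (cases c) (auto simp: w)
    ultimately show ?thesis using te ws(1) unfolding dpath_def w by auto
  qed
qed

text \<open>Goering's argument: if deleting an edge xy destroys the bound, a separator S of size
  k - 1 of the smaller graph yields the two separators S + x and S + y of size k, and the induction
  hypothesis is applied on both sides of S.\<close>

theorem menger_sets:
  assumes "finite E" "finite A" "finite B"
    and "\<And>S. finite S \<Longrightarrow> dseparator E A B S \<Longrightarrow> k \<le> card S"
  shows "\<exists>P. linkage E A B P \<and> card P = k"
  using assms
proof (induction E arbitrary: A B rule: finite_induct)
  case empty
  have "dseparator {} A B (A \<inter> B)"
    unfolding dseparator_def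
  proof (intro allI impI)
    fix vs :: "'a list" assume vs: "dpath {} A B vs"
    then obtain v vs' where "vs = v # vs'" unfolding dpath_def by (cases vs) auto
    moreover from this vs have "vs' = []" unfolding dpath_def by (cases vs') auto
    ultimately show "set vs \<inter> (A \<inter> B) \<noteq> {}" using vs unfolding dpath_def by simp
  qed
  then have "k \<le> card (A \<inter> B)" using empty by blast
  then obtain X where X: "X \<subseteq> A \<inter> B" "card X = k" "finite X"
    by (metis obtain_subset_with_card_n)
  have "linkage {} A B ((\<lambda>v. [v]) ` X)"
    using X unfolding linkage_def dpath_def by auto
  moreover have "card ((\<lambda>v. [v]) ` X) = k" using X by (simp add: card_image inj_on_def)
  ultimately show ?case by blast
next
  case (insert e E)
  obtain x y where e: "e = (x, y)" by fastforce
  show ?case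
  proof (cases "\<forall>S. finite S \<longrightarrow> dseparator E A B S \<longrightarrow> k \<le> card S")
    case True
    then obtain P where P: "linkage E A B P" "card P = k" using insert by blast
    have "linkage (insert e E) A B P"
      using P(1) unfolding linkage_def dpath_def by (auto elim!: successively_mono)
    then show ?thesis using P(2) by blast
  next
    case False
    then obtain S where S: "finite S" "dseparator E A B S" "card S < k" by auto
    have sx: "dseparator (insert (x, y) E) A B (insert x S)"
      and sy: "dseparator (insert (x, y) E) A B (insert y S)"
      using dseparator_insert_edge[OF S(2)] by auto
    have kx: "k \<le> card (insert x S)" and ky: "k \<le> card (insert y S)"
      using insert.prems(3) sx sy S(1) unfolding e by auto
    have xS: "x \<notin> S" and yS: "y \<notin> S" using kx ky S(1,3) by (auto simp: insert_absorb)
    have cx: "card (insert x S) = k" and cy: "card (insert y S) = k"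
      using kx ky S xS yS by auto
    obtain P where P: "linkage E A (insert x S) P" "card P = k"
      using insert.IH[of A "insert x S"] insert.prems S(1) dseparator_first[OF sx] unfolding e
      by blast
    obtain Q where Q: "linkage E (insert y S) B Q" "card Q = k"
      using insert.IH[of "insert y S" B] insert.prems S(1) dseparator_last[OF sy] unfolding e
      by blast
    note P' = linkage_last_bij[OF P(1)] and Q' = linkage_hd_bij[OF Q(1)]
    have Pb: "bij_betw last P (insert x S)" "\<And>vs. vs \<in> P \<Longrightarrow> set vs \<inter> insert x S = {last vs}"
      using P' S(1) P(2) cx by auto
    have Qb: "bij_betw hd Q (insert y S)" "\<And>vs. vs \<in> Q \<Longrightarrow> set vs \<inter> insert y S = {hd vs}"
      using Q' S(1) Q(2) cy by auto
    define p where "p = the_inv_into P last"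
    define q where "q = the_inv_into Q hd"
    have p: "p s \<in> P" "last (p s) = s" if "s \<in> insert x S" for s
      using that Pb(1) unfolding p_def bij_betw_def
      by (auto intro: the_inv_into_into f_the_inv_into_f)
    have q: "q s \<in> Q" "hd (q s) = s" if "s \<in> insert y S" for s
      using that Qb(1) unfolding q_def bij_betw_def
      by (auto intro: the_inv_into_into f_the_inv_into_f)
    have dp: "dpath E A (insert x S) vs" if "vs \<in> P" for vs using P(1) that unfolding linkage_def by blast
    have dq: "dpath E (insert y S) B vs" if "vs \<in> Q" for vs using Q(1) that unfolding linkage_def by blast
    have cross: "z \<in> S \<and> z = s \<and> z = t"
      if "s \<in> insert x S" "t \<in> insert y S" "z \<in> set (p s)" "z \<in> set (q t)" for s t z
    proof -
      have "z \<in> S"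
        using linkage_crossing[OF S(2) dp Pb(2) dq Qb(2) that(3,4)] p q that(1,2) by blast
      moreover have "z = last (p s)" using Pb(2)[OF p(1)[OF that(1)]] that(3) \<open>z \<in> S\<close> by blast
      moreover have "z = hd (q t)" using Qb(2)[OF q(1)[OF that(2)]] that(4) \<open>z \<in> S\<close> by blast
      ultimately show ?thesis using p q that by auto
    qed
    \<comment> \<open>The path ending in \<open>x\<close> crosses the deleted arc to the path
      starting in \<open>y\<close>. At any other \<open>s\<close> the two paths share
      \<open>s\<close>, hence the \<open>tl\<close> in \<open>r\<close> below.\<close>
    define t where "t s = (if s = x then y else s)" for s
    have t: "t s \<in> insert y S" if "s \<in> insert x S" for s using that by (auto simp: t_def)
    define r where "r s = (if s = x then p x @ q y else p s @ tl (q s))" for s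
    have ne: "p s \<noteq> []" "q (t s) \<noteq> []" if "s \<in> insert x S" for s
      using dp[OF p(1)[OF that]] dq[OF q(1)[OF t[OF that]]] unfolding dpath_def by auto
    have setr: "set (r s) = set (p s) \<union> set (q (t s))" if s: "s \<in> insert x S" for s
    proof (cases "s = x")
      case False
      then have s': "s \<in> S" using s by simp
      then have "q s = s # tl (q s)" using ne[OF s] False q(2)[of s] unfolding t_def
        by (metis insertI2 list.collapse)
      then have "set (q s) = insert s (set (tl (q s)))" by (metis list.simps(15))
      moreover have "s \<in> set (p s)" using p(2)[OF s] ne[OF s] last_in_set by metis
      ultimately show ?thesis using False by (auto simp: r_def t_def)
    qed (simp add: r_def t_def)
    have "dpath (insert e E) A B (r s)" if s: "s \<in> insert x S" for s
    proof -
      have P1: "p s \<noteq> []" "distinct (p s)" "successively (\<lambda>u v. (u, v) \<in> insert e E) (p s)"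
        "hd (p s) \<in> A" "last (p s) = s"
        using dp[OF p(1)[OF s]] p(2)[OF s] unfolding dpath_def by (auto elim!: successively_mono)
      have Q1: "q (t s) \<noteq> []" "distinct (q (t s))" "successively (\<lambda>u v. (u, v) \<in> insert e E) (q (t s))"
        "last (q (t s)) \<in> B" "hd (q (t s)) = t s"
        using dq[OF q(1)[OF t[OF s]]] q(2)[OF t[OF s]] unfolding dpath_def by (auto elim!: successively_mono)
      show ?thesis
      proof (cases "s = x")
        case True
        have "set (p x) \<inter> set (q y) = {}" using cross[of x y] xS by auto
        then show ?thesis using P1 Q1 True e
          by (auto simp: dpath_def r_def t_def successively_append_iff)
      next
        case False
        then have s': "s \<in> S" using s by simp
        have qs: "q s = s # tl (q s)" using Q1(1,5) False unfolding t_def by (metis list.collapse)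
        have ts: "t s = s" using False by (simp add: t_def)
        have "set (p s) \<inter> set (tl (q s)) = {}"
        proof (rule ccontr)
          assume "set (p s) \<inter> set (tl (q s)) \<noteq> {}"
          then obtain z where z: "z \<in> set (p s)" "z \<in> set (tl (q s))" by blast
          then have "z \<in> set (q s)" using qs by (metis list.set_intros(2))
          then have "z = s" using cross[OF s, of s z] z(1) s' by blast
          then show False using z(2) Q1(2) qs unfolding ts by (metis distinct.simps(2))
        qed
        moreover have "distinct (tl (q s))" using Q1(2) ts by (simp add: distinct_tl)
        moreover have "successively (\<lambda>u v. (u, v) \<in> insert e E) (p s @ tl (q s))"
        proof -
          obtain l where l: "q s = s # l" using qs by blast
          show ?thesis using P1(1,3,5) Q1(3) unfolding ts l
            by (auto simp: successively_append_iff successively_Cons)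
        qed
        moreover have "last (p s @ tl (q s)) \<in> B"
        proof (cases "tl (q s) = []")
          case True
          then have "last (q s) = s" using qs by (metis last.simps)
          then show ?thesis using True P1(5) Q1(4) ts by simp
        next
          case False
          then have "last (q s) = last (tl (q s))" by (simp add: last_tl)
          then show ?thesis using False Q1(4) ts by simp
        qed
        ultimately show ?thesis using P1 False by (simp add: dpath_def r_def)
      qed
    qed
    moreover have disj: "set (r s) \<inter> set (r s') = {}"
      if "s \<in> insert x S" "s' \<in> insert x S" "s \<noteq> s'" for s s'
    proof -
      have tt: "t s \<noteq> t s'" using that xS yS by (auto simp: t_def)
      have "p s \<noteq> p s'" using p(2) that by metis
      then have 1: "set (p s) \<inter> set (p s') = {}" using P(1) p(1) that unfolding linkage_def by blast
      have "q (t s) \<noteq> q (t s')" using q(2) t that tt by metis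
      then have 2: "set (q (t s)) \<inter> set (q (t s')) = {}"
        using Q(1) q(1) t that unfolding linkage_def by blast
      have 3: "set (p u) \<inter> set (q (t v)) = {}"
        if uv: "u \<in> insert x S" "v \<in> insert x S" "u \<noteq> v" for u v
      proof (rule ccontr)
        assume "set (p u) \<inter> set (q (t v)) \<noteq> {}"
        then obtain z where "z \<in> set (p u)" "z \<in> set (q (t v))" by blast
        then have "z \<in> S" "z = u" "z = t v" using cross[OF uv(1) t[OF uv(2)]] by blast+
        then show False using uv(3) yS unfolding t_def by (auto split: if_splits)
      qed
      show ?thesis using 1 2 3[OF that] 3[OF that(2,1)] that by (auto simp: setr)
    qed
    ultimately have "linkage (insert e E) A B (r ` insert x S)"
      unfolding linkage_def using S(1) by auto
    moreover have "inj_on r (insert x S)"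
    proof (rule inj_onI, rule ccontr)
      fix s s' assume *: "s \<in> insert x S" "s' \<in> insert x S" "r s = r s'" "s \<noteq> s'"
      then have "set (r s) = {}" using disj[of s s'] by simp
      then show False using setr[OF *(1)] ne[OF *(1)] by simp
    qed
    ultimately show ?thesis using cx card_image by blast
  qed
qed

section \<open>Separations and Menger's theorem for two vertices\<close>

definition separation :: "'a ugraph \<Rightarrow> 'a set \<Rightarrow> 'a set \<Rightarrow> bool" where
  "separation G A B \<longleftrightarrow> A \<union> B = verts G \<and> (\<forall>e\<in>edges G. e \<subseteq> A \<or> e \<subseteq> B)"

lemma separation_path_meets:
  assumes "separation G A B" "successively (\<lambda>u v. {u, v} \<in> edges G) vs" "vs \<noteq> []"
    "hd vs \<in> A" "last vs \<in> B"
  shows "set vs \<inter> (A \<inter> B) \<noteq> {}"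
  using assms(2-)
proof (induction vs rule: induct_list012)
  case (3 u v vs)
  then have "{u, v} \<subseteq> A \<or> {u, v} \<subseteq> B" using assms(1) unfolding separation_def by auto
  with 3 show ?case by auto
qed auto

text \<open>Each path picks a vertex of the overlap; since \<open>x\<close> and \<open>y\<close> are
  not in it, internally disjoint paths pick different ones.\<close>

lemma local_connectivity_le_separation:
  assumes G: "simple_graph G" and sep: "separation G A B" and x: "x \<in> A - B" and y: "y \<in> B - A"
  shows "local_connectivity G x y \<le> card (A \<inter> B)"
proof -
  have fin: "finite (A \<inter> B)"
    using G sep unfolding simple_graph_def separation_def by (metis finite_Int finite_Un)
  have le: "card P \<le> card (A \<inter> B)" if P: "internally_disjoint_paths G x y P" for P
  proof -
    have "\<exists>z. z \<in> set vs \<and> z \<in> A \<inter> B" if "vs \<in> P" for vs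
    proof -
      have "is_path G x y vs" using P that unfolding internally_disjoint_paths_def by blast
      then show ?thesis
        using separation_path_meets[OF sep, of vs] x y unfolding is_path_def by blast
    qed
    then obtain f where f: "\<And>vs. vs \<in> P \<Longrightarrow> f vs \<in> set vs \<and> f vs \<in> A \<inter> B" by metis
    have "inj_on f P"
    proof (rule inj_onI, rule ccontr)
      fix vs ws assume *: "vs \<in> P" "ws \<in> P" "f vs = f ws" "vs \<noteq> ws"
      then have "f vs \<in> {x, y}"
        using f P unfolding internally_disjoint_paths_def by (metis IntI subsetD)
      then show False using f[OF *(1)] x y by auto
    qed
    then show ?thesis using f fin by (meson card_inj_on_le image_subsetI)
  qed
  have "internally_disjoint_paths G x y {}" unfolding internally_disjoint_paths_def by simp
  then have "{card P | P. internally_disjoint_paths G x y P} \<noteq> {}" by blast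
  moreover have sub: "{card P | P. internally_disjoint_paths G x y P} \<subseteq> {..card (A \<inter> B)}"
    by (clarsimp simp: le)
  moreover have "finite {card P | P. internally_disjoint_paths G x y P}"
    by (rule finite_subset[OF sub]) simp
  ultimately have "Max {card P | P. internally_disjoint_paths G x y P} \<in> {..card (A \<inter> B)}"
    using Max_in by blast
  then show ?thesis unfolding local_connectivity_def by simp
qed

lemma card_le_local_connectivity:
  assumes G: "simple_graph G" and P: "internally_disjoint_paths G x y P"
  shows "card P \<le> local_connectivity G x y"
proof -
  let ?L = "{vs. set vs \<subseteq> verts G \<and> distinct vs}"
  have fL: "finite ?L" using G finite_subset_distinct unfolding simple_graph_def by blast
  have "Q \<subseteq> ?L" if "internally_disjoint_paths G x y Q" for Q
    using that unfolding internally_disjoint_paths_def is_path_def by blast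
  then have "{card P | P. internally_disjoint_paths G x y P} \<subseteq> {..card ?L}"
    using card_mono[OF fL] by auto
  then have "finite {card P | P. internally_disjoint_paths G x y P}" using finite_subset by blast
  then show ?thesis unfolding local_connectivity_def using P by (intro Max_ge) auto
qed

lemma rtrancl_imp_walk:
  assumes "(x, y) \<in> R\<^sup>*"
  shows "\<exists>vs. vs \<noteq> [] \<and> hd vs = x \<and> last vs = y \<and> successively (\<lambda>u v. (u, v) \<in> R) vs"
  using assms
proof (induction rule: rtrancl_induct)
  case base
  show ?case by (intro exI[of _ "[x]"]) auto
next
  case (step y z)
  then obtain vs where "vs \<noteq> []" "hd vs = x" "last vs = y" "successively (\<lambda>u v. (u, v) \<in> R) vs"
    by blast
  with step show ?case by (intro exI[of _ "vs @ [z]"]) (auto simp: successively_append_iff)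
qed

text \<open>Let \<open>C\<close> be the set of vertices reachable from \<open>x\<close> off
  \<open>S\<close>. Edges leave \<open>C\<close> only into \<open>S\<close>, so
  \<open>C \<union> S\<close> and the complement of \<open>C\<close> are the two sides.\<close>

lemma separation_of_no_path:
  assumes G: "simple_graph G" and S: "S \<subseteq> verts G" and x: "x \<in> verts G - S" and y: "y \<in> verts G - S"
    and no: "\<nexists>vs. is_path (remove_verts G S) x y vs"
  shows "\<exists>A B. separation G A B \<and> A \<inter> B = S \<and> x \<in> A - B \<and> y \<in> B - A"
proof -
  define R where "R = {(u, v). {u, v} \<in> edges (remove_verts G S)}"
  define C where "C = {u. (x, u) \<in> R\<^sup>*}"
  have e: "u \<in> verts G - S" if "{u, v} \<in> edges (remove_verts G S)" for u v
    using that G unfolding remove_verts_def simple_graph_def by auto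
  have e': "v \<in> verts G - S" if "{u, v} \<in> edges (remove_verts G S)" for u v
    using that e[of v u] by (simp add: insert_commute)
  have CV: "C \<subseteq> verts G - S"
  proof
    fix u assume "u \<in> C"
    then have "(x, u) \<in> R\<^sup>*" by (simp add: C_def)
    then show "u \<in> verts G - S"
    proof (cases rule: rtranclE)
      case (step u')
      then show ?thesis using e' unfolding R_def by blast
    qed (use x in simp)
  qed
  have "y \<notin> C"
  proof
    assume "y \<in> C"
    then have "(x, y) \<in> R\<^sup>*" by (simp add: C_def)
    from rtrancl_imp_walk[OF this] walk_to_path obtain vs where vs: "vs \<noteq> []" "distinct vs"
      "hd vs = x" "last vs = y" "successively (\<lambda>u v. (u, v) \<in> R) vs" by metis
    have "set vs \<subseteq> verts G - S"
      using vs(1,3,5) x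
    proof (induction vs arbitrary: x rule: induct_list012)
      case (3 u v vs)
      then have "{v, u} \<in> edges (remove_verts G S)" by (simp add: R_def insert_commute)
      from e[OF this] have "set (v # vs) \<subseteq> verts G - S" using 3 by auto
      then show ?case using 3 by auto
    qed auto
    then have "is_path (remove_verts G S) x y vs"
      using vs unfolding is_path_def R_def by (simp add: remove_verts_def)
    then show False using no by blast
  qed
  have xC: "x \<in> C" by (simp add: C_def)
  have "separation G (C \<union> S) (verts G - C)"
    unfolding separation_def
  proof (intro conjI ballI)
    show "C \<union> S \<union> (verts G - C) = verts G" using CV S by blast
    fix f assume f: "f \<in> edges G"
    then obtain u v where uv: "f = {u, v}" using G unfolding simple_graph_def by (meson card_2_iff)
    have fV: "u \<in> verts G" "v \<in> verts G" using f G uv unfolding simple_graph_def by auto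
    have step: "b \<in> C" if "a \<in> C" "{a, b} = f" "b \<notin> S" for a b
    proof -
      have "(a, b) \<in> R" using that f CV unfolding R_def remove_verts_def by auto
      then show ?thesis using that(1) unfolding C_def by (auto intro: rtrancl_into_rtrancl)
    qed
    show "f \<subseteq> C \<union> S \<or> f \<subseteq> verts G - C"
      using step[of u v] step[of v u] uv fV by auto
  qed
  moreover have "(C \<union> S) \<inter> (verts G - C) = S" using CV S by blast
  ultimately show ?thesis using xC \<open>y \<notin> C\<close> x y CV by blast
qed

text \<open>The set version is applied between the neighbourhoods of \<open>x\<close> and of
  \<open>y\<close> with both vertices deleted; putting \<open>x\<close> in front and
  \<open>y\<close> at the end turns disjoint paths into internally disjoint ones.\<close>

theorem menger_vertices:
  assumes G: "simple_graph G" and x: "x \<in> verts G" and y: "y \<in> verts G" and xy: "x \<noteq> y" "{x, y} \<notin> edges G"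
    and k: "local_connectivity G x y < k"
  shows "\<exists>A B. separation G A B \<and> card (A \<inter> B) < k \<and> x \<in> A - B \<and> y \<in> B - A"
proof -
  let ?R = "\<lambda>u v. {u, v} \<in> edges G"
  define E where "E = {(u, v). {u, v} \<in> edges G \<and> u \<notin> {x, y} \<and> v \<notin> {x, y}}"
  define A0 where "A0 = {u. {x, u} \<in> edges G}"
  define B0 where "B0 = {u. {u, y} \<in> edges G}"
  have edge: "u \<noteq> v \<and> u \<in> verts G \<and> v \<in> verts G" if "{u, v} \<in> edges G" for u v
    using that G unfolding simple_graph_def by (metis card_2_iff doubleton_eq_iff insert_subset singleton_insert_inj_eq')
  have fV: "finite (verts G)" using G unfolding simple_graph_def by blast
  have fA: "finite A0" "finite B0" "finite E"
    unfolding A0_def B0_def E_def using edge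
    by (auto intro!: finite_subset[OF _ fV] finite_subset[OF _ finite_cartesian_product[OF fV fV]])
  have loop: "{u} \<notin> edges G" for u using edge[of u u] by auto
  have AB: "A0 \<inter> {x, y} = {}" "B0 \<inter> {x, y} = {}"
    using loop xy unfolding A0_def B0_def by (auto simp: insert_commute)
  have inV: "set vs \<subseteq> verts G - {x, y}" if "dpath E A0 B0 vs" for vs
  proof -
    have h: "hd vs \<in> verts G - {x, y}" using that AB(1) edge unfolding dpath_def A0_def by auto
    have "successively (\<lambda>u v. (u, v) \<in> E) vs" "vs \<noteq> []" using that unfolding dpath_def by auto
    then show ?thesis using h
    proof (induction vs rule: induct_list012)
      case (3 u v vs)
      then show ?case using edge unfolding E_def by auto
    qed auto
  qed
  have "\<exists>S. finite S \<and> dseparator E A0 B0 S \<and> card S < k"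
  proof (rule ccontr)
    assume "\<not> ?thesis"
    then have "\<exists>P. linkage E A0 B0 P \<and> card P = k"
      using fA by (intro menger_sets) (auto simp: not_less)
    then obtain P where P: "linkage E A0 B0 P" "card P = k" by blast
    have "is_path G x y (x # vs @ [y])" if "vs \<in> P" for vs
    proof -
      have vs: "dpath E A0 B0 vs" using P that unfolding linkage_def by blast
      have s: "successively ?R vs"
        using vs unfolding dpath_def E_def by (auto elim!: successively_mono)
      show ?thesis
        using vs s inV[OF vs] x y xy(1) unfolding is_path_def dpath_def A0_def B0_def
        by (auto simp: successively_Cons successively_append_iff)
    qed
    moreover have "set vs \<inter> set ws = {}" if "vs \<in> P" "ws \<in> P" "vs \<noteq> ws" for vs ws
      using P that unfolding linkage_def by blast
    ultimately have "internally_disjoint_paths G x y ((\<lambda>vs. x # vs @ [y]) ` P)"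
      unfolding internally_disjoint_paths_def by auto
    from card_le_local_connectivity[OF G this] have "k \<le> local_connectivity G x y"
      using P(2) by (simp add: card_image inj_on_def)
    then show False using k by simp
  qed
  then obtain S0 where S0: "finite S0" "dseparator E A0 B0 S0" "card S0 < k" by blast
  \<comment> \<open>The separator may contain \<open>x\<close>, \<open>y\<close> or elements outside
    the graph. Paths between the neighbourhoods never visit these, so trimming it is safe.\<close>
  define S where "S = S0 \<inter> (verts G - {x, y})"
  have S: "S \<subseteq> verts G" "x \<notin> S" "y \<notin> S" "finite S" "card S < k"
    using S0 card_mono[of S0 S] unfolding S_def by auto
  have "\<nexists>vs. is_path (remove_verts G S) x y vs"
  proof
    assume "\<exists>vs. is_path (remove_verts G S) x y vs"
    then obtain vs where vs: "is_path (remove_verts G S) x y vs" by blast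
    then obtain vs' where vs': "vs = x # vs'" unfolding is_path_def by (cases vs) auto
    then have "vs' \<noteq> []" using vs xy(1) unfolding is_path_def by auto
    then obtain ws where ws: "vs' = ws @ [y]"
      using vs vs' unfolding is_path_def by (cases vs' rule: rev_cases) auto
    have suc: "successively ?R (x # ws @ [y])" and d: "distinct (x # ws @ [y])"
      and sub: "set ws \<inter> S = {}"
      using vs unfolding vs' ws is_path_def remove_verts_def by (auto elim!: successively_mono)
    have ne: "ws \<noteq> []" using suc xy by auto
    have "successively (\<lambda>u v. (u, v) \<in> E) ws"
    proof -
      have "successively ?R ws" using suc ne by (auto simp: successively_Cons successively_append_iff)
      then show ?thesis
      proof (rule successively_mono)
        show "(u, v) \<in> E" if "u \<in> set ws" "v \<in> set ws" "?R u v" for u v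
          using that d unfolding E_def by auto
      qed
    qed
    then have dp: "dpath E A0 B0 ws"
      using suc d ne unfolding dpath_def A0_def B0_def
      by (auto simp: successively_Cons successively_append_iff)
    then have "set ws \<inter> S0 \<noteq> {}" using S0(2) unfolding dseparator_def by blast
    then show False using sub inV[OF dp] unfolding S_def by blast
  qed
  then show ?thesis using separation_of_no_path[OF G S(1), of x y] x y S by blast
qed

section \<open>Globally linked pairs and gluing constructions\<close>

lemma generic_iff_generic_on: "generic G p \<longleftrightarrow> generic_on (verts G) p"
  unfolding generic_def generic_on_def coords_def by simp

lemma exists_generic:
  assumes "finite V"
  shows "\<exists>p :: 'a \<Rightarrow> real ^ 'd::finite. generic_on V p"
proof -
  have "finite (V \<times> (UNIV :: 'd set))" using assms by simp
  from exists_algebraically_independent_rat[OF this] obtain a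
    where a: "algebraically_independent_rat (V \<times> (UNIV :: 'd set)) a" by blast
  have "coords (\<lambda>v. \<chi> i. a (v, i)) = a" by (simp add: coords_def fun_eq_iff)
  then have "generic_on V (\<lambda>v. \<chi> i. a (v, i))" using a unfolding generic_on_def by simp
  then show ?thesis by blast
qed

lemma chordal_complete:
  assumes "finite V" "Suc d \<le> card V"
  shows "chordal d V (V \<times> V)"
proof -
  obtain C where C: "C \<subseteq> V" "card C = Suc d" using assms by (metis obtain_subset_with_card_n)
  then have "finite C" using assms(1) finite_subset by blast
  then have "chordal d C (C \<times> C)" using C(2) by (rule chordal_base)
  from chordal_attach_clique[OF _ this, of "V - C" C] have "chordal d (C \<union> (V - C))
    (C \<times> C \<union> (C \<union> (V - C)) \<times> (C \<union> (V - C)))" using assms C(2) by auto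
  moreover have "C \<union> (V - C) = V" "C \<times> C \<union> V \<times> V = V \<times> V" using C(1) by blast+
  ultimately show ?thesis by simp
qed

section \<open>Skeletons of graphs with a gluing construction\<close>

definition chordal_skeleton :: "'d::finite itself \<Rightarrow> 'a ugraph \<Rightarrow> ('a \<times> 'a) set \<Rightarrow> bool" where
  "chordal_skeleton _ G E \<longleftrightarrow> chordal CARD('d) (verts G) E \<and> (\<forall>x y. {x, y} \<in> edges G \<longrightarrow> (x, y) \<in> E) \<and>
     (\<forall>p q :: 'a \<Rightarrow> real ^ 'd. generic_on (verts G) p \<and> equivalent_realizations G p q \<longrightarrow> same_dist E p q)"

lemma globally_rigid_skeleton:
  assumes G: "simple_graph G" "CARD('d::finite) + 1 \<le> card (verts G)" "globally_rigid TYPE('d) G"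
  shows "chordal_skeleton TYPE('d) G (verts G \<times> verts G)"
  unfolding chordal_skeleton_def
proof (intro conjI allI impI)
  show "chordal CARD('d) (verts G) (verts G \<times> verts G)"
    using G(1,2) by (intro chordal_complete) (auto simp: simple_graph_def)
  show "(x, y) \<in> verts G \<times> verts G" if "{x, y} \<in> edges G" for x y
    using G(1) that unfolding simple_graph_def by auto
  show "same_dist (verts G \<times> verts G) p q"
    if "generic_on (verts G) p \<and> equivalent_realizations G p q" for p q :: "'a \<Rightarrow> real ^ 'd"
  proof -
    have "congruent_realizations G p q"
      using G(3) that unfolding globally_rigid_def generic_iff_generic_on by blast
    then show ?thesis unfolding same_dist_def congruent_realizations_def dist_norm by blast
  qed
qed

lemma union_skeleton:
  assumes G: "chordal_skeleton TYPE('d::finite) G E" and H: "chordal_skeleton TYPE('d) H F"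
    and card: "CARD('d) \<le> card (verts G \<inter> verts H)"
  shows "\<exists>E'. chordal_skeleton TYPE('d) (graph_union G H) E'"
proof -
  let ?V = "verts G \<union> verts H"
  obtain E' where E': "chordal CARD('d) ?V E'" "E \<union> F \<subseteq> E'" "forces TYPE('d) ?V (E \<union> F) E'"
    using chordal_union[of "verts H" F "verts G" E] G H card unfolding chordal_skeleton_def by blast
  have "chordal_skeleton TYPE('d) (graph_union G H) E'"
    unfolding chordal_skeleton_def
  proof (intro conjI allI impI)
    show "chordal CARD('d) (verts (graph_union G H)) E'" using E'(1) by (simp add: graph_union_def)
    show "(x, y) \<in> E'" if "{x, y} \<in> edges (graph_union G H)" for x y
      using that G H E'(2) unfolding graph_union_def chordal_skeleton_def by auto
    show "same_dist E' p q"
      if pq: "generic_on (verts (graph_union G H)) p \<and> equivalent_realizations (graph_union G H) p q"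
      for p q :: "'a \<Rightarrow> real ^ 'd"
    proof -
      have gen: "generic_on ?V p" using pq by (simp add: graph_union_def)
      have "equivalent_realizations G p q" "equivalent_realizations H p q"
        using pq unfolding equivalent_realizations_def graph_union_def by auto
      moreover have "generic_on (verts G) p" "generic_on (verts H) p"
        using generic_on_mono[OF gen] by blast+
      ultimately have "same_dist E p q" "same_dist F p q"
        using G H unfolding chordal_skeleton_def by blast+
      then have "same_dist (E \<union> F) p q" by (simp add: same_dist_Un)
      then show ?thesis using E'(3) gen unfolding forces_def by blast
    qed
  qed
  then show ?thesis by blast
qed

lemma gluing_construction_skeleton:
  assumes "gluing_construction TYPE('d::finite) Gs G"
  shows "\<exists>E. chordal_skeleton TYPE('d) G E"
proof -
  have step: "simple_graph (Gs ! i) \<and>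
        ((card (verts (Gs ! i)) \<ge> CARD('d) + 1 \<and> globally_rigid TYPE('d) (Gs ! i)) \<or>
         (\<exists>j l. j < l \<and> l < i \<and> Gs ! i = graph_union (Gs ! j) (Gs ! l) \<and>
            card (verts (Gs ! j) \<inter> verts (Gs ! l)) \<ge> CARD('d)))" if "i < length Gs" for i
    using assms that unfolding gluing_construction_def by metis
  have "\<exists>E. chordal_skeleton TYPE('d) (Gs ! i) E" if "i < length Gs" for i
    using that
  proof (induction i rule: less_induct)
    case (less i)
    consider "CARD('d) + 1 \<le> card (verts (Gs ! i))" "globally_rigid TYPE('d) (Gs ! i)"
      | j l where "j < l" "l < i" "Gs ! i = graph_union (Gs ! j) (Gs ! l)"
          "CARD('d) \<le> card (verts (Gs ! j) \<inter> verts (Gs ! l))"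
      using step[OF less.prems] by blast
    then show ?case
    proof cases
      case 1
      then show ?thesis using globally_rigid_skeleton step[OF less.prems] by blast
    next
      case 2
      have "\<exists>E. chordal_skeleton TYPE('d) (Gs ! j) E" "\<exists>E. chordal_skeleton TYPE('d) (Gs ! l) E"
        using 2 less by auto
      then show ?thesis using union_skeleton 2(4) unfolding 2(3) by blast
    qed
  qed
  moreover have "Gs \<noteq> []" "G = Gs ! (length Gs - 1)"
    using assms unfolding gluing_construction_def by (auto simp: last_conv_nth)
  ultimately show ?thesis by simp
qed

lemma separation_equivalent_realization:
  fixes p :: "'a \<Rightarrow> real ^ 'd::finite"
  assumes G: "simple_graph G" and card: "CARD('d) + 1 \<le> card (verts G)"
    and sep: "separation G A B" "card (A \<inter> B) \<le> CARD('d)" "x \<in> A - B" "y \<in> B - A"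
    and gen: "generic_on (verts G) p"
  shows "\<exists>q. equivalent_realizations G p q \<and> norm (p x - p y) \<noteq> norm (q x - q y)"
proof -
  have "finite (verts G)" "CARD('d) < card (verts G)" "A \<union> B = verts G"
    using G card sep(1) unfolding simple_graph_def separation_def by auto
  from separated_reflection[OF gen this sep(2-4)] obtain q
    where q: "same_dist (A \<times> A \<union> B \<times> B) p q" "dist (p x) (p y) \<noteq> dist (q x) (q y)" by blast
  have sides: "\<forall>e\<in>edges G. e \<subseteq> A \<or> e \<subseteq> B" using sep(1) unfolding separation_def by (rule conjunct2)
  have "equivalent_realizations G p q"
    unfolding equivalent_realizations_def
  proof (intro allI impI)
    fix u v assume "{u, v} \<in> edges G"
    with sides have "{u, v} \<subseteq> A \<or> {u, v} \<subseteq> B" by (rule bspec)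
    then have "(u, v) \<in> A \<times> A \<union> B \<times> B" by blast
    then show "norm (p u - p v) = norm (q u - q v)"
      using same_distD[OF q(1)] by (simp add: dist_norm)
  qed
  then show ?thesis using q(2) by (auto simp: dist_norm)
qed

text \<open>Both notions quantify over all generic realizations, so refuting them requires one to
  exist; the reflection provides the second realization.\<close>

lemma separation_not_linked:
  assumes G: "simple_graph G" and card: "CARD('d::finite) + 1 \<le> card (verts G)"
    and sep: "separation G A B" "card (A \<inter> B) \<le> CARD('d)" "x \<in> A - B" "y \<in> B - A"
  shows "\<not> globally_linked TYPE('d) G x y" "\<not> globally_rigid TYPE('d) G"
proof -
  obtain p :: "'a \<Rightarrow> real ^ 'd" where p: "generic_on (verts G) p"
    using exists_generic[of "verts G"] G by (auto simp: simple_graph_def)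
  obtain q where q: "equivalent_realizations G p q" "norm (p x - p y) \<noteq> norm (q x - q y)"
    using separation_equivalent_realization[OF G card sep p] by blast
  show "\<not> globally_linked TYPE('d) G x y"
    using p q unfolding globally_linked_def generic_iff_generic_on by blast
  have "x \<in> verts G" "y \<in> verts G" using sep unfolding separation_def by blast+
  then show "\<not> globally_rigid TYPE('d) G"
    using p q unfolding globally_rigid_def generic_iff_generic_on congruent_realizations_def by blast
qed

lemma skeleton_closure:
  assumes "chordal_skeleton TYPE('d::finite) G E"
  shows "\<exists>E'. chordal_skeleton TYPE('d) G E' \<and> clique_closed CARD('d) E'"
proof -
  obtain E' where E': "chordal CARD('d) (verts G) E'" "E \<subseteq> E'" "forces TYPE('d) (verts G) E E'"
    "clique_closed CARD('d) E'"
    using chordal_closure assms unfolding chordal_skeleton_def by blast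
  then have "chordal_skeleton TYPE('d) G E'"
    using assms unfolding chordal_skeleton_def forces_def by blast
  then show ?thesis using E'(4) by blast
qed

lemma skeleton_separation:
  assumes G: "simple_graph G" and sk: "chordal_skeleton TYPE('d::finite) G E"
    and cl: "clique_closed CARD('d) E" and xy: "x \<in> verts G" "y \<in> verts G" "(x, y) \<notin> E"
  shows "\<exists>A B. separation G A B \<and> card (A \<inter> B) = CARD('d) \<and> x \<in> A - B \<and> y \<in> B - A"
proof -
  obtain A B where AB: "A \<union> B = verts G" "card (A \<inter> B) = CARD('d)" "x \<in> A - B" "y \<in> B - A"
    "E \<subseteq> A \<times> A \<union> B \<times> B"
    using chordal_separation[OF _ cl xy] sk unfolding chordal_skeleton_def by blast
  have "separation G A B"
    unfolding separation_def
  proof (intro conjI ballI, rule AB(1))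
    fix e assume e: "e \<in> edges G"
    then obtain u v where uv: "e = {u, v}" using G unfolding simple_graph_def by (meson card_2_iff)
    then have "(u, v) \<in> E" using e sk unfolding chordal_skeleton_def by blast
    then have "(u, v) \<in> A \<times> A \<union> B \<times> B" using AB(5) by blast
    then show "e \<subseteq> A \<or> e \<subseteq> B" using uv by blast
  qed
  then show ?thesis using AB by blast
qed

lemma skeleton_rigid:
  assumes sk: "chordal_skeleton TYPE('d::finite) G E"
  shows "rigid TYPE('d) G"
  unfolding rigid_def generic_iff_generic_on
proof (intro allI impI)
  fix p :: "'a \<Rightarrow> real ^ 'd" assume p: "generic_on (verts G) p"
  obtain \<epsilon> where \<epsilon>: "\<epsilon> > 0" "\<And>q. same_dist E p q \<Longrightarrow> \<forall>x\<in>verts G. dist (p x) (q x) < \<epsilon> \<Longrightarrow>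
      same_dist (verts G \<times> verts G) p q"
    using chordal_locally_rigid[OF _ p] sk unfolding chordal_skeleton_def by blast
  show "\<exists>\<epsilon>>0. \<forall>q. equivalent_realizations G p q \<and> (\<forall>x\<in>verts G. norm (p x - q x) < \<epsilon>) \<longrightarrow>
      congruent_realizations G p q"
  proof (intro exI conjI allI impI, rule \<epsilon>(1), elim conjE)
    fix q assume q: "equivalent_realizations G p q" "\<forall>x\<in>verts G. norm (p x - q x) < \<epsilon>"
    have "same_dist E p q" using sk p q(1) unfolding chordal_skeleton_def by blast
    then have "same_dist (verts G \<times> verts G) p q" using \<epsilon>(2) q(2) by (simp add: dist_norm)
    then show "congruent_realizations G p q"
      unfolding same_dist_def congruent_realizations_def dist_norm by blast
  qed
qed

lemma skeleton_globally_linked: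
  assumes sk: "chordal_skeleton TYPE('d::finite) G E" and xy: "(x, y) \<in> E"
  shows "globally_linked TYPE('d) G x y"
  unfolding globally_linked_def generic_iff_generic_on
proof (intro allI impI)
  fix p q :: "'a \<Rightarrow> real ^ 'd" assume "generic_on (verts G) p \<and> equivalent_realizations G p q"
  then have "same_dist E p q" using sk unfolding chordal_skeleton_def by blast
  from same_distD[OF this xy] show "norm (p x - p y) = norm (q x - q y)" by (simp add: dist_norm)
qed

lemma separation_not_connected:
  assumes sep: "separation G A B" and xy: "x \<in> A - B" "y \<in> B - A"
  shows "\<not> graph_connected (remove_verts G (A \<inter> B))"
proof
  assume "graph_connected (remove_verts G (A \<inter> B))"
  moreover have "x \<in> verts G - A \<inter> B" "y \<in> verts G - A \<inter> B" using sep xy unfolding separation_def by blast+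
  ultimately obtain vs where vs: "is_path (remove_verts G (A \<inter> B)) x y vs"
    unfolding graph_connected_def by (auto simp: remove_verts_def)
  then have "successively (\<lambda>u v. {u, v} \<in> edges G) vs" "vs \<noteq> []" "hd vs = x" "last vs = y"
    unfolding is_path_def remove_verts_def by (auto elim!: successively_mono)
  then have "set vs \<inter> (A \<inter> B) \<noteq> {}" using separation_path_meets[OF sep] xy by blast
  moreover have "set vs \<subseteq> verts G - A \<inter> B" using vs unfolding is_path_def remove_verts_def by simp
  ultimately show False by blast
qed

text \<open>A disconnecting set of at most d vertices yields a reflection. The bound d + 2 is part
  of being (d + 1)-connected, and a complete graph on d + 1 vertices is globally rigid without
  meeting it.\<close>

lemma globally_rigid_imp_k_connected:
  assumes G: "simple_graph G" and card: "CARD('d::finite) + 2 \<le> card (verts G)"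
    and gr: "globally_rigid TYPE('d) G"
  shows "k_connected (CARD('d) + 1) G"
  unfolding k_connected_def
proof (intro conjI allI impI)
  show "CARD('d) + 1 + 1 \<le> card (verts G)" using card by simp
  fix S assume S: "S \<subseteq> verts G" "card S < CARD('d) + 1"
  show "graph_connected (remove_verts G S)"
  proof (rule ccontr)
    assume "\<not> ?thesis"
    then obtain x y where xy: "x \<in> verts G - S" "y \<in> verts G - S"
        "\<nexists>vs. is_path (remove_verts G S) x y vs"
      unfolding graph_connected_def by (auto simp: remove_verts_def)
    from separation_of_no_path[OF G S(1) this] obtain A B
      where "separation G A B" "A \<inter> B = S" "x \<in> A - B" "y \<in> B - A" by blast
    then show False using separation_not_linked(2)[where 'd = 'd, OF G, of A B x y] card S(2) gr by auto
  qed
qed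

theorem theorem4p10:
  fixes G :: "'a ugraph"
  assumes "simple_graph G"
    and "\<exists>Gs. gluing_construction TYPE('d::finite) Gs G"
  shows "joined TYPE('d) G \<and>
    (card (verts G) \<ge> CARD('d) + 2 \<longrightarrow>
      (globally_rigid TYPE('d) G \<longleftrightarrow> k_connected (CARD('d) + 1) G))"
proof -
  note G = assms(1)
  obtain E where sk: "chordal_skeleton TYPE('d) G E" and cl: "clique_closed CARD('d) E"
    using gluing_construction_skeleton skeleton_closure assms(2) by blast
  have card: "CARD('d) + 1 \<le> card (verts G)"
    using assms(2) unfolding gluing_construction_def by blast
  have linked: "globally_linked TYPE('d) G x y \<longleftrightarrow>
      {x, y} \<in> edges G \<or> local_connectivity G x y \<ge> CARD('d) + 1"
    if xy: "x \<in> verts G" "y \<in> verts G" "x \<noteq> y" for x y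
  proof
    assume l: "globally_linked TYPE('d) G x y"
    show "{x, y} \<in> edges G \<or> local_connectivity G x y \<ge> CARD('d) + 1"
    proof (rule ccontr)
      assume "\<not> ?thesis"
      then have "{x, y} \<notin> edges G" "local_connectivity G x y < CARD('d) + 1" by auto
      from menger_vertices[OF G xy this] obtain A B
        where "separation G A B" "card (A \<inter> B) < CARD('d) + 1" "x \<in> A - B" "y \<in> B - A" by blast
      then show False using separation_not_linked(1)[where 'd = 'd, OF G card, of A B x y] l by auto
    qed
  next
    assume r: "{x, y} \<in> edges G \<or> local_connectivity G x y \<ge> CARD('d) + 1"
    have "(x, y) \<in> E"
    proof (rule ccontr)
      assume n: "(x, y) \<notin> E"
      then have "local_connectivity G x y \<ge> CARD('d) + 1"
        using r sk unfolding chordal_skeleton_def by blast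
      moreover obtain A B where "separation G A B" "card (A \<inter> B) = CARD('d)" "x \<in> A - B" "y \<in> B - A"
        using skeleton_separation[OF G sk cl xy(1,2) n] by blast
      then have "local_connectivity G x y \<le> CARD('d)"
        using local_connectivity_le_separation[OF G] by metis
      ultimately show False by simp
    qed
    then show "globally_linked TYPE('d) G x y" by (rule skeleton_globally_linked[OF sk])
  qed
  then have "joined TYPE('d) G"
    unfolding joined_def using card skeleton_rigid[OF sk] by blast
  \<comment> \<open>A pair missing from \<open>E\<close> would have a separator of size d, so
    connectivity makes the closed skeleton complete.\<close>
  moreover have "globally_rigid TYPE('d) G" if k: "k_connected (CARD('d) + 1) G"
  proof -
    have "(x, y) \<in> E" if xy: "x \<in> verts G" "y \<in> verts G" for x y
    proof (rule ccontr)
      assume "(x, y) \<notin> E"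
      from skeleton_separation[OF G sk cl xy this] obtain A B
        where AB: "separation G A B" "card (A \<inter> B) = CARD('d)" "x \<in> A - B" "y \<in> B - A" by blast
      then have "A \<inter> B \<subseteq> verts G" unfolding separation_def by blast
      then have "graph_connected (remove_verts G (A \<inter> B))" using k AB(2) unfolding k_connected_def by simp
      then show False using separation_not_connected[OF AB(1,3,4)] by blast
    qed
    then have "globally_linked TYPE('d) G x y" if "x \<in> verts G" "y \<in> verts G" for x y
      using skeleton_globally_linked[OF sk] that by blast
    then show ?thesis
      unfolding globally_rigid_def globally_linked_def congruent_realizations_def by blast
  qed
  ultimately show ?thesis using globally_rigid_imp_k_connected[OF G] by blast
qed

end
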